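(* Let $X$ ($m\times p$) and $S$ ($p\times p$) be independent with $X\sim \mathcal N_{m\times p}(\Theta, I_m\otimes\Sigma)$ and $S\sim\mathcal W_p(n,\Sigma)$. For real parameters $a,b,c$ of the hierarchical prior described in the context, put $k_0=\dfrac{a-c+p+(m\wedge p)-1}{a+m+p+(m\wedge p)}$ and consider the closed-form generalized Bayes estimator $$\widehat\Theta^{GB}=X-k_0X\{I_p+(1-k_0)S^{-1}X^\top X\}^{-1}.$$ (i) Assume $p>m+1$, $n\ge p$, $b=a+m-n$, $a>-2m-1$, $-2<c<a+p$ and $$k_0=\frac{a-c+m+p-1}{a+2m+p}\le\frac{2(p-m-1)}{n+p-1}.$$ Then $\widehat\Theta^{GB}$ improves on $X$ relative to the matrix quadratic loss $L_M(\widehat\Theta,\Theta)=(\widehat\Theta-\Theta)\Sigma^{-1}(\widehat\Theta-\Theta)^\top$. (ii) Assume $n\ge p$, $b=a+(m\wedge p)-n$, $a>-m-(m\wedge p)-1$, $(m\wedge p)-m-2<c<a+p$ and $$k_0=\frac{a-c+p+(m\wedge p)-1}{a+m+p+(m\wedge p)}\le\frac{2(|p-m|-1)}{n-p+2(m\wedge p)+2|p-m|-1}.$$ Then $\widehat\Theta^{GB}$ improves on $X$ relative to the scalar quadratic loss $L_Q(\widehat\Theta,\Theta)=\mathrm{tr}\{(\widehat\Theta-\Theta)\Sigma^{-1}(\widehat\Theta-\Theta)^\top\}$.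
   Context: $m\wedge p=\min(m,p)$. $\mathcal N_{m\times p}(M,A\otimes\Sigma)$ denotes the matrix normal distribution with density proportional to $\exp[-\tfrac12\mathrm{tr}\{A^{-1}(X-M)\Sigma^{-1}(X-M)^\top\}]$; $\mathcal W_p(n,\Sigma)$ is the Wishart distribution with $n$ degrees of freedom and scale matrix $\Sigma$ ($p\times p$ positive definite). Both $\Theta$ and $\Sigma$ are unknown. Hierarchical prior with parameters $a,b,c$: $\Theta\mid\Sigma,\Omega\sim\mathcal N_{m\times p}(0,\Omega\otimes\Sigma)$, $\pi(\Omega)\propto|I_m+\Omega|^{-a/2-m}|\Omega|^{c/2}$ ($\Omega$ positive definite $m\times m$), $\pi(\Sigma^{-1})\propto|\Sigma^{-1}|^{(b-1)/2}$. The estimator $\widehat\Theta^{GB}$ displayed in the claim is the one the paper obtains as the generalized Bayes estimator for this prior when $b=a+(m\wedge p)-n$; for the present claim it is defined by the displayed formula. The risk is the expected loss. Under a scalar loss, $\delta_1$ improves on (dominates) $\delta_2$ if the risk of $\delta_1$ is at most that of $\delta_2$ for all $(\Theta,\Sigma)$ with strict inequality for some $(\Theta,\Sigma)$. Under the matrix loss, the same is meant in the positive semidefinite (Löwner) order: the risk of $\delta_2$ minus that of $\delta_1$ is positive semidefinite for all $(\Theta,\Sigma)$ and nonzero for some $(\Theta,\Sigma)$. *)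

theory Defs
  imports "HOL-Probability.Probability"
begin

definition pos_semidef :: "real^'n^'n \<Rightarrow> bool" where
  "pos_semidef A \<longleftrightarrow> transpose A = A \<and> (\<forall>x. 0 \<le> x \<bullet> (A *v x))"

definition pos_def :: "real^'n^'n \<Rightarrow> bool" where
  "pos_def A \<longleftrightarrow> transpose A = A \<and> (\<forall>x. x \<noteq> 0 \<longrightarrow> 0 < x \<bullet> (A *v x))"

definition matrix_normal_kernel ::
    "real^'p^'m \<Rightarrow> real^'m^'m \<Rightarrow> real^'p^'p \<Rightarrow> real^'p^'m \<Rightarrow> real" where
  "matrix_normal_kernel M A \<Sigma> X =
     exp (- trace (matrix_inv A ** (X - M) ** matrix_inv \<Sigma> ** transpose (X - M)) / 2)"

definition matrix_normal ::
    "real^'p^'m \<Rightarrow> real^'m^'m \<Rightarrow> real^'p^'p \<Rightarrow> (real^'p^'m) measure" where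
  "matrix_normal M A \<Sigma> =
     density lborel (\<lambda>X. ennreal (matrix_normal_kernel M A \<Sigma> X /
                                   (LINT Y|lborel. matrix_normal_kernel M A \<Sigma> Y)))"

text \<open>The Wishart distribution with an integer number \<open>n\<close> of degrees of freedom is the law of
  the sum of the \<open>n\<close> matrices \<open>Z\<^sub>i\<^sup>T Z\<^sub>i\<close>, where the \<open>1 \<times> p\<close> row vectors \<open>Z\<^sub>i\<close> are independent
  and normal with mean zero and covariance matrix \<open>\<Sigma>\<close>.\<close>

definition wishart :: "nat \<Rightarrow> real^'p^'p \<Rightarrow> (real^'p^'p) measure" where
  "wishart n \<Sigma> =
     distr (PiM {..<n} (\<lambda>_. matrix_normal (0 :: real^'p^1) (mat 1) \<Sigma>)) borel
           (\<lambda>Z. \<Sum>i<n. transpose (Z i) ** Z i)"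

text \<open>The joint law of the independent pair \<open>(X, S)\<close>.\<close>

definition model :: "nat \<Rightarrow> real^'p^'m \<Rightarrow> real^'p^'p \<Rightarrow> ((real^'p^'m) \<times> (real^'p^'p)) measure" where
  "model n \<Theta> \<Sigma> = matrix_normal \<Theta> (mat 1) \<Sigma> \<Otimes>\<^sub>M wishart n \<Sigma>"

type_synonym ('m, 'p) estimator = "real^'p^'m \<Rightarrow> real^'p^'p \<Rightarrow> real^'p^'m"

definition matrix_loss :: "real^'p^'p \<Rightarrow> real^'p^'m \<Rightarrow> real^'p^'m \<Rightarrow> real^'m^'m" where
  "matrix_loss \<Sigma> T \<Theta> = (T - \<Theta>) ** matrix_inv \<Sigma> ** transpose (T - \<Theta>)"

definition quadratic_loss :: "real^'p^'p \<Rightarrow> real^'p^'m \<Rightarrow> real^'p^'m \<Rightarrow> real" where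
  "quadratic_loss \<Sigma> T \<Theta> = trace ((T - \<Theta>) ** matrix_inv \<Sigma> ** transpose (T - \<Theta>))"

definition matrix_risk ::
    "nat \<Rightarrow> ('m::finite, 'p::finite) estimator \<Rightarrow> real^'p^'m \<Rightarrow> real^'p^'p \<Rightarrow> real^'m^'m" where
  "matrix_risk n \<delta> \<Theta> \<Sigma> = (LINT (X, S)|model n \<Theta> \<Sigma>. matrix_loss \<Sigma> (\<delta> X S) \<Theta>)"

text \<open>The scalar loss is nonnegative for positive definite \<open>\<Sigma>\<close>, so its expectation always exists
  as an extended real.\<close>

definition quadratic_risk ::
    "nat \<Rightarrow> ('m::finite, 'p::finite) estimator \<Rightarrow> real^'p^'m \<Rightarrow> real^'p^'p \<Rightarrow> ennreal" where
  "quadratic_risk n \<delta> \<Theta> \<Sigma> =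
     (\<integral>\<^sup>+ (X, S). ennreal (quadratic_loss \<Sigma> (\<delta> X S) \<Theta>) \<partial>model n \<Theta> \<Sigma>)"

text \<open>The Bochner integral of a non-integrable function is \<open>0\<close>, so dominance under the matrix loss
  must include the finiteness of both matrix risks.\<close>

definition has_matrix_risk ::
    "nat \<Rightarrow> ('m::finite, 'p::finite) estimator \<Rightarrow> real^'p^'m \<Rightarrow> real^'p^'p \<Rightarrow> bool" where
  "has_matrix_risk n \<delta> \<Theta> \<Sigma> \<longleftrightarrow>
     integrable (model n \<Theta> \<Sigma>) (\<lambda>(X, S). matrix_loss \<Sigma> (\<delta> X S) \<Theta>)"

definition improves_matrix_loss ::
    "nat \<Rightarrow> ('m::finite, 'p::finite) estimator \<Rightarrow> ('m, 'p) estimator \<Rightarrow> bool" where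
  "improves_matrix_loss n \<delta>1 \<delta>2 \<longleftrightarrow>
     (\<forall>\<Theta> \<Sigma>. pos_def \<Sigma> \<longrightarrow>
        has_matrix_risk n \<delta>1 \<Theta> \<Sigma> \<and> has_matrix_risk n \<delta>2 \<Theta> \<Sigma> \<and>
        pos_semidef (matrix_risk n \<delta>2 \<Theta> \<Sigma> - matrix_risk n \<delta>1 \<Theta> \<Sigma>)) \<and>
     (\<exists>\<Theta> \<Sigma>. pos_def \<Sigma> \<and> matrix_risk n \<delta>2 \<Theta> \<Sigma> - matrix_risk n \<delta>1 \<Theta> \<Sigma> \<noteq> 0)"

definition improves_quadratic_loss ::
    "nat \<Rightarrow> ('m::finite, 'p::finite) estimator \<Rightarrow> ('m, 'p) estimator \<Rightarrow> bool" where
  "improves_quadratic_loss n \<delta>1 \<delta>2 \<longleftrightarrow>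
     (\<forall>\<Theta> \<Sigma>. pos_def \<Sigma> \<longrightarrow> quadratic_risk n \<delta>1 \<Theta> \<Sigma> \<le> quadratic_risk n \<delta>2 \<Theta> \<Sigma>) \<and>
     (\<exists>\<Theta> \<Sigma>. pos_def \<Sigma> \<and> quadratic_risk n \<delta>1 \<Theta> \<Sigma> < quadratic_risk n \<delta>2 \<Theta> \<Sigma>)"

text \<open>\<open>S\<close> is almost surely invertible under \<^const>\<open>model\<close> when \<open>n \<ge> p\<close>; on the remaining null set
  the value of the estimator is immaterial.\<close>

definition gb_estimator :: "real \<Rightarrow> ('m::finite, 'p::finite) estimator" where
  "gb_estimator k X S =
     X - k *\<^sub>R (X ** matrix_inv (mat 1 + (1 - k) *\<^sub>R (matrix_inv S ** transpose X ** X)))"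

end

theory Submission
  imports Defs
begin

text \<open>Write \<open>K\<close> for the inverse of \<open>\<Sigma>\<close>, \<open>t = 1 - k\<close>, and \<open>S\<close> as the sum of the \<open>z\<^sub>a z\<^sub>a\<^sup>T\<close> over \<open>n\<close>
independent normal rows \<open>z\<^sub>a\<close>. With \<open>P\<close> the inverse of \<open>S + t X\<^sup>T X\<close>, the estimator is
\<open>X - k X P S\<close> (\<open>gb_estimator_eq\<close>). It suffices to study the quadratic forms of the matrix loss:
they decide the Loewner order, and the scalar loss is the sum of the forms at the coordinate
vectors. Fix a vector \<open>v\<close> and put \<open>u = X\<^sup>T v\<close>, \<open>y = P u\<close>, \<open>r = (X - \<Theta>)\<^sup>T v\<close>. The loss form at \<open>v\<close>
is that of \<open>r - k S y\<close>, so the risk differs from that of \<open>X\<close> through the expectations of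
\<open>r \<bullet> K S y\<close> and \<open>S y \<bullet> K S y\<close> alone.

Both are evaluated by Gaussian integration by parts (\<open>stein\<close>). The first is differentiated in
\<open>X\<close> along the rank one directions \<open>v e\<^sup>T\<close>; the second, written as the sum of the
\<open>(z\<^sub>a \<bullet> y) (z\<^sub>a \<bullet> K S y)\<close>, is differentiated in each row \<open>z\<^sub>a\<close>, which is a form of Haff's
identity for the Wishart law. They become the expectations of
\<open>A = \<tau> (|v|\<^sup>2 - t u \<bullet> y) - t y \<bullet> S y\<close> and \<open>B = (n + p + 1 - 2 \<tau>) y \<bullet> S y - 2 (S y) \<bullet> P (S y)\<close>, where
\<open>\<tau>\<close> is the trace of \<open>S P\<close> (\<open>expectation_cross\<close>, \<open>expectation_energy\<close>). Hence the risk of \<open>X\<close>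
exceeds that of the estimator, at \<open>v\<close>, by the expectation of \<open>2 k A - k\<^sup>2 B\<close> (\<open>risk_formula\<close>).

Integration by parts needs functions that are differentiable everywhere, while \<open>P\<close> does not
exist where \<open>S + t X\<^sup>T X\<close> is singular. So \<open>P\<close> is first taken as the inverse of
\<open>S + t X\<^sup>T X + eps I\<close>. Bounds uniform in \<open>eps\<close> come from one principle: if
\<open>(x \<bullet> y)\<^sup>2 \<le> c (y \<bullet> Q y)\<close> for all \<open>y\<close>, then \<open>x \<bullet> Q' x \<le> c\<close> for the inverse \<open>Q'\<close> of \<open>Q\<close>
(\<open>inverse_form_bound\<close>). Then \<open>eps\<close> tends to \<open>0\<close> by dominated convergence, since \<open>S\<close> is almost surely invertible for \<open>n \<ge> p\<close>.

Finally \<open>2 k A - k\<^sup>2 B\<close> is examined where \<open>S\<close> is positive definite. If \<open>p \<ge> m + 1\<close>, it is positive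
for every \<open>v \<noteq> 0\<close>: with
\<open>\<eta> = |v|\<^sup>2 - t u \<bullet> y\<close> one has \<open>t y \<bullet> S y < \<eta>\<close> and \<open>\<tau> \<ge> p - m\<close>, and the bound on \<open>k\<close> is equivalent to
\<open>k (n - p + 2 m + 1) \<le> 2 t (p - m - 1)\<close>, which is what the terms linear in \<open>\<eta>\<close> and \<open>y \<bullet> S y\<close> require;
all other terms have the right sign. If \<open>m \<ge> p + 1\<close>, the same happens after summing over the
coordinate vectors, when \<open>\<tau>\<close> takes the role of \<open>\<eta>\<close>. The conditions on \<open>a\<close> and \<open>c\<close> place \<open>k0\<close>
strictly between \<open>0\<close> and \<open>1\<close>.\<close>

section \<open>Gaussian integration by parts\<close>

lemma integral_lborel_translate:
  fixes f :: "'a::euclidean_space \<Rightarrow> real"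
  assumes "f \<in> borel_measurable borel"
  shows "(\<integral>x. f (x + a) \<partial>lborel) = (\<integral>x. f x \<partial>lborel)"
proof -
  have "(\<integral>x. f x \<partial>lborel) = (\<integral>x. f x \<partial>distr lborel borel ((+) a))"
    by (simp add: lborel_distr_plus)
  also have "\<dots> = (\<integral>x. f (a + x) \<partial>lborel)"
    using assms by (intro integral_distr) auto
  finally show ?thesis by (simp add: add.commute)
qed

lemma integrable_lborel_translate:
  fixes f :: "'a::euclidean_space \<Rightarrow> real"
  assumes "integrable lborel f"
  shows "integrable lborel (\<lambda>x. f (x + a))"
proof -
  have m: "f \<in> borel_measurable borel" using assms by simp
  have "integrable (distr lborel borel ((+) a)) f"
    using assms by (simp add: lborel_distr_plus)
  then show ?thesis
    using m by (subst (asm) integrable_distr_eq) (auto simp: add.commute)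
qed

text \<open>Integrate \<open>g (x + v) - g x = \<integral>\<^sub>0\<^sup>1 g' (x + s v) ds\<close> over \<open>x\<close>. By translation invariance the left side
gives \<open>0\<close>, and after Fubini every slice \<open>s\<close> on the right contributes the integral of \<open>g'\<close>.\<close>

lemma integral_directional_derivative_eq_0:
  fixes g g' :: "'a::euclidean_space \<Rightarrow> real"
  assumes g: "integrable lborel g" and g': "integrable lborel g'"
    and der: "\<And>x. ((\<lambda>s. g (x + s *\<^sub>R v)) has_real_derivative g' x) (at 0)"
  shows "(\<integral>x. g' x \<partial>lborel) = 0"
proof -
  have [measurable]: "g \<in> borel_measurable borel" "g' \<in> borel_measurable borel"
    using g g' by auto
  define f where "f = (\<lambda>(s::real, x). indicator {0..1} s * g' (x + s *\<^sub>R v))"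
  have f_meas[measurable]: "f \<in> borel_measurable (lborel \<Otimes>\<^sub>M lborel)"
    unfolding f_def by measurable
  have int1: "(\<integral>x. norm (f (s, x)) \<partial>lborel) = indicator {0..1} s * (\<integral>x. \<bar>g' x\<bar> \<partial>lborel)" for s
    using integral_lborel_translate[of "\<lambda>x. \<bar>g' x\<bar>" "s *\<^sub>R v"]
    by (simp add: f_def abs_mult)
  have int: "integrable (lborel \<Otimes>\<^sub>M lborel) f"
  proof (rule lborel_pair.Fubini_integrable)
    show "integrable lborel (\<lambda>s. \<integral>x. norm (f (s, x)) \<partial>lborel)"
      unfolding int1 by (auto intro!: integrable_mult_left integrable_real_indicator)
    show "AE s in lborel. integrable lborel (\<lambda>x. f (s, x))"
      using integrable_lborel_translate[OF g'] by (auto simp: f_def)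
  qed simp
  have int': "integrable (lborel \<Otimes>\<^sub>M lborel) (case_prod (\<lambda>s x. f (s, x)))"
    using int by simp
  have der': "((\<lambda>s. g (x + s *\<^sub>R v)) has_real_derivative g' (x + s *\<^sub>R v)) (at s)" for x s
  proof -
    have "((\<lambda>r. g (x + (s + r) *\<^sub>R v)) has_real_derivative g' (x + s *\<^sub>R v)) (at 0)"
      using der[of "x + s *\<^sub>R v"] by (simp add: algebra_simps)
    then show ?thesis
      using DERIV_shift[of "\<lambda>s. g (x + s *\<^sub>R v)" "g' (x + s *\<^sub>R v)" 0 s] by (simp add: add.commute)
  qed
  \<comment> \<open>Almost every slice of \<open>f\<close> is Lebesgue integrable, and then its integral is the gauge integral of the derivative.\<close>
  have ftc: "(\<integral>s. f (s, x) \<partial>lborel) = g (x + v) - g x"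
    if i: "integrable lborel (\<lambda>s. f (s, x))" for x
  proof -
    have "((\<lambda>s. g' (x + s *\<^sub>R v)) has_integral (g (x + 1 *\<^sub>R v) - g (x + 0 *\<^sub>R v))) {0..1}"
      by (rule fundamental_theorem_of_calculus)
        (auto simp flip: has_real_derivative_iff_has_vector_derivative intro!: DERIV_subset[OF der'])
    then have "((\<lambda>s. if s \<in> {0..1} then g' (x + s *\<^sub>R v) else 0) has_integral (g (x + v) - g x)) UNIV"
      by (subst has_integral_restrict_UNIV) simp
    moreover have "(\<lambda>s. if s \<in> {0..1} then g' (x + s *\<^sub>R v) else 0) = (\<lambda>s. f (s, x))"
      by (auto simp: f_def indicator_def)
    ultimately show ?thesis
      using has_integral_integral_lborel[OF i] has_integral_unique by metis
  qed
  have "(\<integral>x. g' x \<partial>lborel) = (\<integral>s. indicator {0..1} s * (\<integral>x. g' x \<partial>lborel) \<partial>(lborel :: real measure))"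
    by simp
  also have "\<dots> = (\<integral>s. (\<integral>x. f (s, x) \<partial>lborel) \<partial>lborel)"
    using integral_lborel_translate[of g'] by (simp add: f_def)
  also have "\<dots> = (\<integral>x. (\<integral>s. f (s, x) \<partial>lborel) \<partial>lborel)"
    using lborel_pair.Fubini_integral[OF int'] by simp
  also have "\<dots> = (\<integral>x. g (x + v) - g x \<partial>lborel)"
  proof (rule integral_cong_AE)
    show "AE x in lborel. (\<integral>s. f (s, x) \<partial>lborel) = g (x + v) - g x"
      using lborel_pair.AE_integrable_snd[OF int'] by eventually_elim (rule ftc)
  qed auto
  also have "\<dots> = 0"
    using g integral_lborel_translate[of g v] by (simp add: integrable_lborel_translate)
  finally show ?thesis .
qed

lemma integrable_exp_norm_squared:
  assumes "0 < (c::real)"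
  shows "integrable (lborel :: 'a::euclidean_space measure) (\<lambda>x. exp (- c * (norm x)\<^sup>2))"
proof -
  interpret product_sigma_finite "\<lambda>_::'a. lborel :: real measure" ..
  let ?T = "\<lambda>f. \<Sum>b\<in>Basis. f b *\<^sub>R b :: 'a"
  have 1: "integrable lborel (\<lambda>x::real. exp (- c * x\<^sup>2))"
  proof -
    have "integrable lborel (normal_density 0 (sqrt (1 / (2 * c))))"
      by (rule integrable_normal_density) (use assms in auto)
    then have "integrable lborel (\<lambda>x. sqrt (pi / c) * normal_density 0 (sqrt (1 / (2 * c))) x)"
      by (rule integrable_mult_right)
    moreover have "sqrt (pi / c) * normal_density 0 (sqrt (1 / (2 * c))) x = exp (- c * x\<^sup>2)" for x
      using assms by (simp add: normal_density_def real_sqrt_divide field_simps)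
    ultimately show ?thesis by simp
  qed
  have "integrable (\<Pi>\<^sub>M b\<in>(Basis::'a set). (lborel::real measure)) (\<lambda>f. \<Prod>b\<in>Basis. exp (- c * (f b)\<^sup>2))"
    by (rule product_integrable_prod) (use 1 in auto)
  moreover have "(\<Prod>b\<in>Basis. exp (- c * (f b)\<^sup>2)) = exp (- c * (norm (?T f))\<^sup>2)" for f :: "'a \<Rightarrow> real"
  proof -
    have "(norm (?T f))\<^sup>2 = (\<Sum>b\<in>Basis. (f b)\<^sup>2)"
      unfolding power2_norm_eq_inner
      by (subst euclidean_inner) (simp add: power2_eq_square inner_sum_left inner_Basis if_distrib cong: if_cong)
    then show ?thesis by (simp add: exp_sum sum_distrib_left)
  qed
  ultimately have "integrable (\<Pi>\<^sub>M b\<in>(Basis::'a set). (lborel::real measure)) (\<lambda>f. exp (- c * (norm (?T f))\<^sup>2))"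
    by simp
  then show ?thesis
    by (subst lborel_eq, subst integrable_distr_eq) auto
qed

text \<open>A normal law on a Euclidean space, given by its mean and its precision operator \<open>L\<close>. The abstract
form serves both the matrix \<open>X\<close> and a single row of the Wishart sample.\<close>

locale gaussian =
  fixes \<mu> :: "'a::euclidean_space" and L :: "'a \<Rightarrow> 'a"
  assumes linear_L: "linear L"
    and selfadjoint: "L x \<bullet> y = x \<bullet> L y"
    and posdef: "x \<noteq> 0 \<Longrightarrow> 0 < L x \<bullet> x"
begin

definition kernel :: "'a \<Rightarrow> real" where
  "kernel x = exp (- (L (x - \<mu>) \<bullet> (x - \<mu>)) / 2)"

definition mass :: real where "mass = (\<integral>x. kernel x \<partial>lborel)"

definition law :: "'a measure" where
  "law = density lborel (\<lambda>x. ennreal (kernel x / mass))"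

lemma continuous_on_L: "continuous_on A L"
  by (simp add: linear_continuous_on linear_L linear_linear)

lemma measurable_L[measurable]: "L \<in> borel_measurable borel"
  by (rule borel_measurable_continuous_onI) (rule continuous_on_L)

lemma measurable_kernel[measurable]: "kernel \<in> borel_measurable borel"
  unfolding kernel_def by measurable

lemma kernel_pos: "0 < kernel x" by (simp add: kernel_def)

text \<open>The form attains its minimum on the compact unit sphere, and the minimum is positive.\<close>

lemma coercive: obtains c where "0 < c" "\<And>x. c * (norm x)\<^sup>2 \<le> L x \<bullet> x"
proof -
  have "\<exists>x\<in>sphere (0::'a) 1. \<forall>y\<in>sphere 0 1. L x \<bullet> x \<le> L y \<bullet> y"
    by (rule continuous_attains_inf) (auto intro!: continuous_intros continuous_on_L)
  then obtain x where x: "norm x = 1" "\<And>y. norm y = 1 \<Longrightarrow> L x \<bullet> x \<le> L y \<bullet> y"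
    by auto
  have "(L x \<bullet> x) * (norm y)\<^sup>2 \<le> L y \<bullet> y" for y
  proof (cases "y = 0")
    case False
    have "L x \<bullet> x \<le> L (y /\<^sub>R norm y) \<bullet> (y /\<^sub>R norm y)"
      using False by (intro x(2)) simp
    also have "\<dots> = (L y \<bullet> y) / (norm y)\<^sup>2"
      by (simp add: linear_cmul[OF linear_L] power2_eq_square field_simps)
    finally show ?thesis using False by (simp add: field_simps)
  qed simp
  moreover have "0 < L x \<bullet> x" using x(1) by (intro posdef) auto
  ultimately show ?thesis using that by blast
qed

text \<open>The polynomial factor is absorbed by half of the Gaussian exponent, through \<open>x \<le> exp x\<close>.\<close>

lemma integrable_kernel_moment:
  "integrable lborel (\<lambda>x. (1 + (norm (x - \<mu>))\<^sup>2) * kernel x)"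
proof -
  obtain c where c: "0 < c" "\<And>x. c * (norm x)\<^sup>2 \<le> L x \<bullet> x" by (rule coercive) blast
  have "integrable lborel (\<lambda>x. (1 + 4 / c) * exp (- (c / 4) * (norm (x + - \<mu>))\<^sup>2))"
    by (intro integrable_mult_right integrable_lborel_translate[of "\<lambda>x. exp (- (c / 4) * (norm x)\<^sup>2)"]
        integrable_exp_norm_squared) (use c in auto)
  then show ?thesis
  proof (rule Bochner_Integration.integrable_bound)
    have "norm ((1 + (norm (x - \<mu>))\<^sup>2) * kernel x)
        \<le> norm ((1 + 4 / c) * exp (- (c / 4) * (norm (x + - \<mu>))\<^sup>2))" for x
    proof -
      define r where "r = (norm (x - \<mu>))\<^sup>2"
      have r: "0 \<le> r" by (simp add: r_def)
      have "c * r / 4 \<le> exp (c * r / 4)" using exp_ge_add_one_self[of "c * r / 4"] by linarith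
      then have "c * r \<le> 4 * exp (c * r / 4)" by simp
      then have "r \<le> 4 / c * exp (c * r / 4)" using c by (simp add: field_simps)
      moreover have "1 \<le> exp (c * r / 4)" using r c by simp
      ultimately have "1 + r \<le> (1 + 4 / c) * exp (c * r / 4)"
        unfolding distrib_right by linarith
      moreover have "kernel x \<le> exp (- c * r / 2)"
        using c(2)[of "x - \<mu>"] by (simp add: kernel_def r_def)
      ultimately have "(1 + r) * kernel x \<le> (1 + 4 / c) * exp (c * r / 4) * exp (- c * r / 2)"
        using r kernel_pos[of x] c by (intro mult_mono) auto
      also have "\<dots> = (1 + 4 / c) * exp (- (c / 4) * r)"
        by (simp flip: exp_add)
      finally show ?thesis
        using kernel_pos[of x] c r by (simp add: r_def[symmetric] abs_mult)
    qed
    then show "AE x in lborel. norm ((1 + (norm (x - \<mu>))\<^sup>2) * kernel x)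
        \<le> norm ((1 + 4 / c) * exp (- (c / 4) * (norm (x + - \<mu>))\<^sup>2))" by simp
  qed simp
qed

lemma integrable_kernel: "integrable lborel kernel"
  by (rule Bochner_Integration.integrable_bound[OF integrable_kernel_moment])
    (auto simp: abs_mult kernel_pos less_imp_le)

lemma mass_pos: "0 < mass"
proof -
  have "mass \<noteq> 0"
  proof
    assume "mass = 0"
    then have "AE x in lborel. kernel x = 0"
      using integral_nonneg_eq_0_iff_AE[OF integrable_kernel] kernel_pos
      by (auto simp: mass_def less_imp_le)
    then have "AE x in (lborel :: 'a measure). False"
      by eventually_elim (metis kernel_pos less_irrefl)
    then have "emeasure lborel (UNIV :: 'a set) = 0"
      by (subst (asm) AE_iff_measurable[where N=UNIV]) auto
    then show False by (simp add: emeasure_lborel_UNIV)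
  qed
  moreover have "0 \<le> mass"
    unfolding mass_def by (intro integral_nonneg_AE) (auto simp: kernel_pos less_imp_le)
  ultimately show ?thesis by simp
qed

lemma density_pos: "0 < kernel x / mass"
  by (simp add: kernel_pos mass_pos)

lemma sets_law[simp, measurable_cong]: "sets law = sets borel"
  by (simp add: law_def)

lemma space_law[simp]: "space law = UNIV"
  by (simp add: law_def)

lemma prob_space_law: "prob_space law"
proof
  have "emeasure law (space law) = (\<integral>\<^sup>+x. ennreal (kernel x / mass) \<partial>lborel)"
    by (simp add: law_def emeasure_density)
  also have "\<dots> = ennreal (\<integral>x. kernel x / mass \<partial>lborel)"
    by (intro nn_integral_eq_integral) (auto simp: integrable_kernel density_pos less_imp_le)
  also have "\<dots> = 1"
    using mass_pos by (simp flip: mass_def)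
  finally show "emeasure law (space law) = 1" .
qed

lemma integral_law:
  fixes f :: "'a \<Rightarrow> real"
  assumes [measurable]: "f \<in> borel_measurable borel"
  shows "(\<integral>x. f x \<partial>law) = (\<integral>x. f x * kernel x \<partial>lborel) / mass"
proof -
  have "(\<integral>x. f x \<partial>law) = (\<integral>x. (kernel x / mass) *\<^sub>R f x \<partial>lborel)"
    unfolding law_def by (rule integral_density) (auto simp: density_pos less_imp_le)
  then show ?thesis by (simp add: mult.commute)
qed

lemma integrable_law:
  fixes f :: "'a \<Rightarrow> real"
  assumes [measurable]: "f \<in> borel_measurable borel"
  shows "integrable law f \<longleftrightarrow> integrable lborel (\<lambda>x. f x * kernel x)"
proof -
  have "integrable law f \<longleftrightarrow> integrable lborel (\<lambda>x. (kernel x / mass) *\<^sub>R f x)"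
    unfolding law_def by (rule integrable_density) (auto simp: density_pos less_imp_le)
  moreover have "(kernel x / mass) *\<^sub>R f x = inverse mass * (f x * kernel x)" for x
    by (simp add: field_simps)
  ultimately show ?thesis using mass_pos by simp
qed

lemma integrable_law_quadratic_growth:
  fixes f :: "'a \<Rightarrow> real"
  assumes [measurable]: "f \<in> borel_measurable borel"
    and "\<And>x. \<bar>f x\<bar> \<le> C * (1 + (norm (x - \<mu>))\<^sup>2)"
  shows "integrable law f"
proof -
  have "integrable lborel (\<lambda>x. C * ((1 + (norm (x - \<mu>))\<^sup>2) * kernel x))"
    by (intro integrable_mult_right integrable_kernel_moment)
  then have "integrable lborel (\<lambda>x. f x * kernel x)"
  proof (rule Bochner_Integration.integrable_bound)
    have "norm (f x * kernel x) \<le> norm (C * ((1 + (norm (x - \<mu>))\<^sup>2) * kernel x))" for x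
    proof -
      have "\<bar>f x\<bar> * kernel x \<le> C * (1 + (norm (x - \<mu>))\<^sup>2) * kernel x"
        using assms(2)[of x] kernel_pos[of x] by (intro mult_right_mono) auto
      also have "\<dots> \<le> \<bar>C * ((1 + (norm (x - \<mu>))\<^sup>2) * kernel x)\<bar>" by (simp add: mult.assoc)
      finally show ?thesis using kernel_pos[of x] by (simp add: abs_mult)
    qed
    then show "AE x in lborel. norm (f x * kernel x) \<le> norm (C * ((1 + (norm (x - \<mu>))\<^sup>2) * kernel x))"
      by simp
  qed simp
  then show ?thesis by (simp add: integrable_law)
qed

lemma AE_lawI: "AE x in lborel. P x \<Longrightarrow> AE x in law. P x"
  unfolding law_def by (subst AE_density) auto

lemma kernel_derivative:
  "((\<lambda>s. kernel (x + s *\<^sub>R v)) has_real_derivative (- (L (x - \<mu>) \<bullet> v) * kernel x)) (at 0)"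
proof -
  define y where "y = x - \<mu>"
  have comm: "L v \<bullet> y = L y \<bullet> v"
    by (metis selfadjoint inner_commute)
  have eq: "L (x + s *\<^sub>R v - \<mu>) \<bullet> (x + s *\<^sub>R v - \<mu>)
      = L y \<bullet> y + 2 * s * (L y \<bullet> v) + s\<^sup>2 * (L v \<bullet> v)" for s
  proof -
    have 1: "x + s *\<^sub>R v - \<mu> = y + s *\<^sub>R v" by (simp add: y_def)
    have 2: "L (y + s *\<^sub>R v) = L y + s *\<^sub>R L v"
      by (simp add: linear_add[OF linear_L] linear_cmul[OF linear_L])
    show ?thesis
      unfolding 1 2 by (simp add: inner_add_left inner_add_right comm power2_eq_square algebra_simps)
  qed
  have eq0: "L (x - \<mu>) \<bullet> (x - \<mu>) = L y \<bullet> y" by (simp add: y_def)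
  show ?thesis
    unfolding kernel_def eq eq0 by (auto intro!: derivative_eq_intros simp: y_def)
qed

text \<open>Stein's identity: the directional derivative of \<open>f\<close> times the Gaussian kernel integrates to \<open>0\<close>, and
the kernel contributes the factor \<open>- (L (x - \<mu>) \<bullet> v)\<close>.\<close>

lemma stein:
  fixes f f' :: "'a \<Rightarrow> real"
  assumes [measurable]: "f \<in> borel_measurable borel" "f' \<in> borel_measurable borel"
    and der: "\<And>x. ((\<lambda>s. f (x + s *\<^sub>R v)) has_real_derivative f' x) (at 0)"
    and f: "\<And>x. \<bar>f x\<bar> \<le> C * (1 + norm (x - \<mu>))"
    and f': "\<And>x. \<bar>f' x\<bar> \<le> C * (1 + norm (x - \<mu>))"
  shows "integrable law (\<lambda>x. (L (x - \<mu>) \<bullet> v) * f x)"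
    and "integrable law f'"
    and "(\<integral>x. (L (x - \<mu>) \<bullet> v) * f x \<partial>law) = (\<integral>x. f' x \<partial>law)"
proof -
  have C: "0 \<le> C" using order_trans[OF abs_ge_zero f[of \<mu>]] by simp
  have le: "1 + r \<le> 2 * (1 + r\<^sup>2)" "r * (1 + r) \<le> 2 * (1 + r\<^sup>2)" for r :: real
  proof -
    have "r * 2 \<le> 1 + r * r" "0 \<le> r * r"
      using zero_le_power2[of "r - 1"] by (simp_all add: power2_eq_square algebra_simps)
    then show "1 + r \<le> 2 * (1 + r\<^sup>2)" "r * (1 + r) \<le> 2 * (1 + r\<^sup>2)"
      unfolding power2_eq_square distrib_left by linarith+
  qed
  have lin: "\<bar>h x\<bar> \<le> (2 * C) * (1 + (norm (x - \<mu>))\<^sup>2)" if "\<bar>h x\<bar> \<le> C * (1 + norm (x - \<mu>))" for h x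
  proof -
    have "C * (1 + norm (x - \<mu>)) \<le> C * (2 * (1 + (norm (x - \<mu>))\<^sup>2))"
      by (intro mult_left_mono le C)
    also have "\<dots> = (2 * C) * (1 + (norm (x - \<mu>))\<^sup>2)" by simp
    finally show ?thesis using that by (rule order_trans[rotated])
  qed
  have i: "integrable law f" "integrable law f'"
    by (rule integrable_law_quadratic_growth[OF _ lin]; fact f f' assms)+
  obtain K where K: "\<And>x. norm (L x) \<le> norm x * K" "0 \<le> K"
    using bounded_linear.nonneg_bounded linear_L linear_conv_bounded_linear by blast
  have "\<bar>(L (x - \<mu>) \<bullet> v) * f x\<bar> \<le> (2 * (K * norm v * C)) * (1 + (norm (x - \<mu>))\<^sup>2)" for x
  proof -
    have "\<bar>L (x - \<mu>) \<bullet> v\<bar> \<le> norm (L (x - \<mu>)) * norm v" by (rule Cauchy_Schwarz_ineq2)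
    also have "\<dots> \<le> (norm (x - \<mu>) * K) * norm v" by (intro mult_right_mono K) auto
    finally have "\<bar>L (x - \<mu>) \<bullet> v\<bar> * \<bar>f x\<bar> \<le> ((norm (x - \<mu>) * K) * norm v) * (C * (1 + norm (x - \<mu>)))"
      using f[of x] K(2) by (intro mult_mono) auto
    also have "\<dots> = (K * norm v * C) * (norm (x - \<mu>) * (1 + norm (x - \<mu>)))" by simp
    also have "\<dots> \<le> (K * norm v * C) * (2 * (1 + (norm (x - \<mu>))\<^sup>2))"
      using K(2) C by (intro mult_left_mono le) auto
    also have "\<dots> = (2 * (K * norm v * C)) * (1 + (norm (x - \<mu>))\<^sup>2)" by simp
    finally show ?thesis by (simp only: abs_mult)
  qed
  then show i3: "integrable law (\<lambda>x. (L (x - \<mu>) \<bullet> v) * f x)"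
    by (intro integrable_law_quadratic_growth) auto
  show "integrable law f'" by fact
  let ?g = "\<lambda>x. f' x * kernel x - ((L (x - \<mu>) \<bullet> v) * f x) * kernel x"
  have k: "integrable lborel (\<lambda>x. f x * kernel x)" "integrable lborel (\<lambda>x. f' x * kernel x)"
    "integrable lborel (\<lambda>x. ((L (x - \<mu>) \<bullet> v) * f x) * kernel x)"
    using i i3 by (simp_all add: integrable_law)
  have "(\<integral>x. ?g x \<partial>lborel) = 0"
  proof (rule integral_directional_derivative_eq_0)
    show "integrable lborel (\<lambda>x. f x * kernel x)" by fact
    show "integrable lborel ?g" using k by auto
    show "((\<lambda>s. f (x + s *\<^sub>R v) * kernel (x + s *\<^sub>R v)) has_real_derivative ?g x) (at 0)" for x
      by (rule derivative_eq_intros der kernel_derivative)+ (simp add: algebra_simps)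
  qed
  then show "(\<integral>x. (L (x - \<mu>) \<bullet> v) * f x \<partial>law) = (\<integral>x. f' x \<partial>law)"
    using k by (simp add: integral_law)
qed

end

section \<open>Matrix products and inverses\<close>

lemma bounded_bilinear_matrix_mult:
  "bounded_bilinear ((**) :: real^'n^'m \<Rightarrow> real^'k^'n \<Rightarrow> real^'k^'m)"
proof -
  have "bilinear ((**) :: real^'n^'m \<Rightarrow> real^'k^'n \<Rightarrow> real^'k^'m)"
    unfolding bilinear_def
    by (auto intro!: linearI simp: matrix_matrix_mult_def vec_eq_iff sum.distrib sum_distrib_left algebra_simps)
  then show ?thesis by (simp add: bilinear_conv_bounded_bilinear)
qed

lemmas matrix_mult_diff_left = bounded_bilinear.diff_left[OF bounded_bilinear_matrix_mult]
  and matrix_mult_diff_right = bounded_bilinear.diff_right[OF bounded_bilinear_matrix_mult]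
  and matrix_mult_scaleR_left = bounded_bilinear.scaleR_left[OF bounded_bilinear_matrix_mult]
  and matrix_mult_scaleR_right = bounded_bilinear.scaleR_right[OF bounded_bilinear_matrix_mult]

lemma bounded_bilinear_matrix_vector_mult:
  "bounded_bilinear ((*v) :: real^'n^'m \<Rightarrow> real^'n \<Rightarrow> real^'m)"
proof -
  have "bilinear ((*v) :: real^'n^'m \<Rightarrow> real^'n \<Rightarrow> real^'m)"
    unfolding bilinear_def
    by (auto intro!: linearI simp: matrix_vector_mult_def vec_eq_iff sum.distrib sum_distrib_left algebra_simps)
  then show ?thesis by (simp add: bilinear_conv_bounded_bilinear)
qed

lemmas matrix_vector_add_left = bounded_bilinear.add_left[OF bounded_bilinear_matrix_vector_mult]
  and matrix_vector_minus_left = bounded_bilinear.minus_left[OF bounded_bilinear_matrix_vector_mult]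
  and matrix_vector_minus_right = bounded_bilinear.minus_right[OF bounded_bilinear_matrix_vector_mult]
  and matrix_vector_scaleR_left = bounded_bilinear.scaleR_left[OF bounded_bilinear_matrix_vector_mult]

text \<open>The rank one matrix \<open>x y\<^sup>T\<close>.\<close>

definition outer :: "real^'n \<Rightarrow> real^'m \<Rightarrow> real^'m^'n" where
  "outer x y = (\<chi> i j. x $ i * y $ j)"

lemma outer_mult_vector: "outer x y *v w = (y \<bullet> w) *\<^sub>R x"
  by (simp add: outer_def matrix_vector_mult_def vec_eq_iff inner_vec_def sum_distrib_left
      sum_distrib_right mult_ac)

lemma bounded_bilinear_outer: "bounded_bilinear (outer :: real^'n \<Rightarrow> real^'m \<Rightarrow> real^'m^'n)"
proof -
  have "bilinear (outer :: real^'n \<Rightarrow> real^'m \<Rightarrow> real^'m^'n)"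
    unfolding bilinear_def
    by (auto intro!: linearI simp: outer_def vec_eq_iff algebra_simps)
  then show ?thesis by (simp add: bilinear_conv_bounded_bilinear)
qed

lemma transpose_outer: "transpose (outer x y) = outer y x"
  by (simp add: outer_def transpose_def vec_eq_iff mult.commute)

lemma linear_transpose: "linear (transpose :: real^'n^'m \<Rightarrow> real^'m^'n)"
  by (rule linearI) (simp_all add: transpose_def vec_eq_iff)

lemma linear_trace: "linear (trace :: real^'n^'n \<Rightarrow> real)"
  by (rule linearI) (simp_all add: trace_def sum.distrib sum_distrib_left)

lemma trace_outer_mult: "trace (outer x y ** A) = y \<bullet> (A *v x)"
  by (simp add: trace_def outer_def matrix_matrix_mult_def matrix_vector_mult_def inner_vec_def
      sum_distrib_left sum_distrib_right mult_ac) (rule sum.swap)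

lemma inner_matrix_mult_transpose:
  fixes A :: "real^'n^'n"
  assumes "transpose A = A"
  shows "(A *v x) \<bullet> y = x \<bullet> (A *v y)"
  unfolding transpose_matrix_vector[of A x, unfolded assms] by (rule dot_lmul_matrix)

lemma trace_eq_sum_axis: "trace A = (\<Sum>l\<in>UNIV. axis l 1 \<bullet> (A *v axis l 1))" for A :: "real^'n^'n"
  by (simp add: trace_def inner_axis' matrix_vector_mult_basis column_def)

lemma sum_axis_inner: "(\<Sum>l\<in>UNIV. (axis l 1 \<bullet> x) * (axis l 1 \<bullet> y)) = x \<bullet> y" for x y :: "real^'n"
proof -
  have "axis l 1 \<bullet> x = x $ l" for l and x :: "real^'n" by (simp add: inner_axis')
  then show ?thesis by (simp add: inner_vec_def)
qed

lemma matrix_inv_inverse: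
  fixes A :: "real^'n^'n"
  assumes "invertible A"
  shows "A ** matrix_inv A = mat 1" "matrix_inv A ** A = mat 1"
proof -
  have "A ** matrix_inv A = mat 1 \<and> matrix_inv A ** A = mat 1"
    unfolding matrix_inv_def by (rule someI_ex) (use assms in \<open>simp add: invertible_def\<close>)
  then show "A ** matrix_inv A = mat 1" "matrix_inv A ** A = mat 1" by auto
qed

lemma matrix_inv_mult_vector:
  fixes A :: "real^'n^'n"
  assumes "invertible A"
  shows "A *v (matrix_inv A *v x) = x" "matrix_inv A *v (A *v x) = x"
  using matrix_inv_inverse[OF assms] by (simp_all add: matrix_vector_mul_assoc)

lemma matrix_inv_eqI:
  fixes A :: "real^'n^'n"
  assumes "A ** B = mat 1"
  shows "matrix_inv A = B"
proof -
  have BA: "B ** A = mat 1" using assms matrix_left_right_inverse by blast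
  then have "invertible A" using assms by (auto simp: invertible_def)
  then show ?thesis
    by (metis BA matrix_inv_inverse(1) matrix_mul_assoc matrix_mul_lid matrix_mul_rid)
qed

lemma continuous_on_det: "continuous_on A (det :: real^'n^'n \<Rightarrow> real)"
  unfolding det_def by (intro continuous_intros)

text \<open>Cramer's rule shows that the entries of the inverse depend continuously on the matrix.\<close>

lemma matrix_inv_cramer:
  fixes A :: "real^'n^'n"
  assumes "det A \<noteq> 0"
  shows "matrix_inv A = (\<chi> k l. det (\<chi> i j. if j = k then axis l 1 $ i else A $ i $ j) / det A)"
proof -
  have "invertible A" using assms by (simp add: invertible_det_nz)
  then have "A *v (matrix_inv A *v axis l 1) = axis l 1" for l
    by (rule matrix_inv_mult_vector)
  then have "matrix_inv A *v axis l 1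
      = (\<chi> k. det (\<chi> i j. if j = k then axis l 1 $ i else A $ i $ j) / det A)" for l
    using cramer[OF assms] by blast
  then show ?thesis
    by (simp add: vec_eq_iff matrix_vector_mult_basis column_def)
qed

lemma continuous_on_matrix_inv: "continuous_on {A :: real^'n^'n. invertible A} matrix_inv"
proof -
  have "continuous_on {A :: real^'n^'n. invertible A}
      (\<lambda>A. \<chi> k l. det (\<chi> i j. if j = k then axis l 1 $ i else A $ i $ j) / det A)"
  proof (intro continuous_on_vec_lambda continuous_on_divide continuous_on_compose2[OF continuous_on_det[of UNIV]])
    show "continuous_on {A :: real^'n^'n. invertible A} (\<lambda>A. if j = k then axis l 1 $ i else A $ i $ j)"
      for i j k l :: 'n
      by (cases "j = k") (auto intro!: continuous_intros)
  qed (auto simp: invertible_det_nz intro!: continuous_intros)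
  then show ?thesis
    by (rule continuous_on_cong[THEN iffD1, rotated 2])
      (auto simp: matrix_inv_cramer invertible_det_nz)
qed

lemma open_invertible: "open {A :: real^'n^'n. invertible A}"
proof -
  have "open (det -` (- {0}) :: (real^'n^'n) set)"
    by (intro open_vimage continuous_on_det) auto
  then show ?thesis by (simp add: invertible_det_nz vimage_def)
qed

lemma isCont_matrix_inv:
  fixes A :: "real^'n^'n"
  assumes "invertible A"
  shows "isCont matrix_inv A"
proof -
  have "\<forall>A\<in>{A :: real^'n^'n. invertible A}. isCont matrix_inv A"
    by (rule iffD1[OF continuous_on_eq_continuous_at[OF open_invertible] continuous_on_matrix_inv])
  then show ?thesis using assms by simp
qed

text \<open>On all singular matrices \<^const>\<open>matrix_inv\<close> takes one and the same default value, so it is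
measurable on the whole space.\<close>

lemma measurable_matrix_inv[measurable]:
  "(matrix_inv :: real^'n^'n \<Rightarrow> real^'n^'n) \<in> borel_measurable borel"
proof -
  have "matrix_inv A = (SOME B. False)" if "\<not> invertible A" for A :: "real^'n^'n"
    using that unfolding matrix_inv_def invertible_def by metis
  then have eq: "(matrix_inv :: real^'n^'n \<Rightarrow> real^'n^'n)
      = (\<lambda>A. if A \<in> {A. invertible A} then matrix_inv A else (SOME B. False))"
    by auto
  show ?thesis
    apply (subst eq)
    by (rule borel_measurable_continuous_on_if)
      (auto intro!: continuous_on_matrix_inv borel_open open_invertible continuous_intros)
qed

text \<open>By the resolvent identity \<open>A' - B' = B' (B - A) A'\<close> for the inverses \<open>A'\<close> and \<open>B'\<close>, the error of the
linear approximation is a product of \<open>B - A\<close> with a factor that tends to \<open>0\<close>.\<close>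

lemma has_derivative_matrix_inv:
  fixes A :: "real^'n^'n"
  assumes A: "invertible A"
  shows "(matrix_inv has_derivative (\<lambda>H. - (matrix_inv A ** H ** matrix_inv A))) (at A)"
proof -
  note bb = bounded_bilinear_matrix_mult[where 'n='n and 'm='n and 'k='n]
  let ?P = "matrix_inv A"
  obtain K where K: "0 < K" "\<And>(B :: real^'n^'n) (C :: real^'n^'n). norm (B ** C) \<le> norm B * norm C * K"
    using bounded_bilinear.pos_bounded[OF bb] by blast
  have ev: "\<forall>\<^sub>F B in at A. B \<in> {B. invertible B}"
    using A by (intro eventually_at_in_open' open_invertible) auto
  show ?thesis
    unfolding has_derivative_iff_norm
  proof
    have "bounded_linear (\<lambda>H. ?P ** H ** ?P)"
      using bounded_linear_compose[OF bounded_bilinear.bounded_linear_left[OF bb] bounded_bilinear.bounded_linear_right[OF bb]] by simp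
    then show "bounded_linear (\<lambda>H. - (?P ** H ** ?P))" by (rule bounded_linear_minus)
    have "((\<lambda>B. norm (matrix_inv B - ?P) * (K * norm ?P * K)) \<longlongrightarrow> norm (?P - ?P) * (K * norm ?P * K)) (at A)"
      using isCont_matrix_inv[OF A] by (intro tendsto_intros) (simp add: isCont_def)
    then have lim: "((\<lambda>B. norm (matrix_inv B - ?P) * (K * norm ?P * K)) \<longlongrightarrow> 0) (at A)" by simp
    show "((\<lambda>B. norm (matrix_inv B - ?P - - (?P ** (B - A) ** ?P)) / norm (B - A)) \<longlongrightarrow> 0) (at A)"
    proof (rule Lim_null_comparison[OF _ lim])
      show "\<forall>\<^sub>F B in at A. norm (norm (matrix_inv B - ?P - - (?P ** (B - A) ** ?P)) / norm (B - A))
          \<le> norm (matrix_inv B - ?P) * (K * norm ?P * K)"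
        using ev
      proof eventually_elim
        case (elim B)
        then have B: "invertible B" by simp
        let ?R = "matrix_inv B"
        have "?R ** (B - A) ** ?P = ?R ** B ** ?P - ?R ** (A ** ?P)"
          by (simp add: matrix_mult_diff_left matrix_mult_diff_right matrix_mul_assoc)
        then have res: "?R ** (B - A) ** ?P = ?P - ?R"
          by (simp add: matrix_inv_inverse[OF A] matrix_inv_inverse[OF B])
        have "?R - ?P - - (?P ** (B - A) ** ?P) = - ((?R - ?P) ** (B - A) ** ?P)"
          using res by (simp add: matrix_mult_diff_left)
        then have "norm (?R - ?P - - (?P ** (B - A) ** ?P)) = norm ((?R - ?P) ** (B - A) ** ?P)"
          by simp
        also have "\<dots> \<le> norm ((?R - ?P) ** (B - A)) * norm ?P * K" by (rule K)
        also have "\<dots> \<le> (norm (?R - ?P) * norm (B - A) * K) * norm ?P * K"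
          using K by (intro mult_right_mono) auto
        finally show ?case
          by (cases "B = A") (simp_all add: field_simps)
      qed
    qed
  qed
qed

lemma has_vector_derivative_matrix_inv:
  fixes Q :: "real \<Rightarrow> real^'n^'n"
  assumes "(Q has_vector_derivative Q') (at s)" "invertible (Q s)"
  shows "((\<lambda>s. matrix_inv (Q s)) has_vector_derivative - (matrix_inv (Q s) ** Q' ** matrix_inv (Q s))) (at s)"
proof -
  have "((\<lambda>s. matrix_inv (Q s)) has_derivative
      (\<lambda>h. - (matrix_inv (Q s) ** (h *\<^sub>R Q') ** matrix_inv (Q s)))) (at s)"
    using has_derivative_compose[OF assms(1)[unfolded has_vector_derivative_def] has_derivative_matrix_inv[OF assms(2)]] .
  moreover have "- (matrix_inv (Q s) ** (h *\<^sub>R Q') ** matrix_inv (Q s))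
      = h *\<^sub>R (- (matrix_inv (Q s) ** Q' ** matrix_inv (Q s)))" for h
    by (simp add: matrix_mult_scaleR_left
        matrix_mult_scaleR_right)
  ultimately show ?thesis by (simp add: has_vector_derivative_def)
qed

section \<open>Positive semidefinite forms\<close>

lemma pos_semidef_Cauchy_Schwarz:
  assumes "pos_semidef A"
  shows "(x \<bullet> (A *v y))\<^sup>2 \<le> (x \<bullet> (A *v x)) * (y \<bullet> (A *v y))"
proof -
  define a b c where "a = x \<bullet> (A *v x)" "b = x \<bullet> (A *v y)" "c = y \<bullet> (A *v y)"
  have sym: "y \<bullet> (A *v x) = b"
    using inner_matrix_mult_transpose[of A x y] assms unfolding pos_semidef_def a_b_c_def
    by (metis inner_commute)
  have q: "0 \<le> a + 2 * s * b + s\<^sup>2 * c" for s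
  proof -
    have "0 \<le> (x + s *\<^sub>R y) \<bullet> (A *v (x + s *\<^sub>R y))" using assms by (simp add: pos_semidef_def)
    also have "\<dots> = a + s * b + s * (y \<bullet> (A *v x)) + s * s * c"
      by (simp add: matrix_vector_right_distrib matrix_vector_mult_scaleR inner_add_left inner_add_right
          a_b_c_def algebra_simps)
    finally show ?thesis by (simp add: sym power2_eq_square mult.commute mult.left_commute)
  qed
  have c: "0 \<le> c" using assms by (simp add: pos_semidef_def a_b_c_def)
  have "b\<^sup>2 \<le> a * c"
  proof (cases "c = 0")
    case True
    have "b = 0"
    proof (rule ccontr)
      assume "b \<noteq> 0"
      then show False using q[of "- (a + 1) / (2 * b)"] True by (simp add: field_simps)
    qed
    then show ?thesis using True by simp
  next
    case False
    then have "0 < c" using c by simp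
    then show ?thesis using q[of "- b / c"] by (simp add: field_simps power2_eq_square)
  qed
  then show ?thesis by (simp add: a_b_c_def)
qed

lemma pos_def_imp_pos_semidef: "pos_def A \<Longrightarrow> pos_semidef A"
  unfolding pos_def_def pos_semidef_def by (metis inner_zero_left less_imp_le order_refl)

lemma pos_def_invertible:
  assumes "pos_def Q" shows "invertible Q"
proof -
  have "Q *v x \<noteq> 0" if "x \<noteq> 0" for x
    using assms that by (metis inner_zero_right less_irrefl pos_def_def)
  then show ?thesis
    unfolding invertible_left_inverse matrix_left_invertible_ker by blast
qed

lemma transpose_matrix_inv:
  fixes A :: "real^'n^'n"
  assumes "invertible A" "transpose A = A"
  shows "transpose (matrix_inv A) = matrix_inv A"
proof -
  have "A ** transpose (matrix_inv A) = mat 1"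
    using matrix_transpose_mul[of "matrix_inv A" A] assms by (simp add: matrix_inv_inverse)
  then show ?thesis by (rule matrix_inv_eqI[symmetric])
qed

lemma pos_def_matrix_inv:
  assumes "pos_def Q" shows "pos_def (matrix_inv Q)"
proof -
  note inv = pos_def_invertible[OF assms]
  have "0 < x \<bullet> (matrix_inv Q *v x)" if "x \<noteq> 0" for x
  proof -
    let ?y = "matrix_inv Q *v x"
    have "Q *v ?y = x" by (simp add: matrix_inv_mult_vector inv)
    moreover from this that have "?y \<noteq> 0" by (metis matrix_vector_mult_0_right)
    ultimately show ?thesis using assms unfolding pos_def_def by (metis inner_commute)
  qed
  then show ?thesis
    using transpose_matrix_inv[OF inv] assms by (simp add: pos_def_def)
qed

text \<open>For \<open>y = Q' x\<close>, where \<open>Q'\<close> is the inverse of \<open>Q\<close>, the hypothesis reads \<open>a\<^sup>2 \<le> K a\<close> with \<open>a = x \<bullet> Q' x\<close>.\<close>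

lemma inverse_form_bound:
  assumes Q: "pos_def Q" and K: "\<And>y. (x \<bullet> y)\<^sup>2 \<le> K * (y \<bullet> (Q *v y))" "0 \<le> K"
  shows "x \<bullet> (matrix_inv Q *v x) \<le> K"
proof -
  let ?a = "x \<bullet> (matrix_inv Q *v x)"
  have "?a\<^sup>2 \<le> K * ?a"
    using K(1)[of "matrix_inv Q *v x"] matrix_inv_mult_vector(1)[OF pos_def_invertible[OF Q], of x]
      inner_commute[of x "matrix_inv Q *v x"] by metis
  moreover have "0 \<le> ?a"
    using pos_def_imp_pos_semidef[OF pos_def_matrix_inv[OF Q]] by (simp add: pos_semidef_def)
  ultimately show ?thesis
    using K(2) by (metis antisym_conv2 linorder_le_less_linear mult_le_cancel_right_pos power2_eq_square)
qed

section \<open>Gram matrices and the ridge inverse\<close>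

text \<open>The matrix \<open>Z\<^sup>T Z\<close> for the matrix \<open>Z\<close> with rows \<open>z a\<close>.\<close>

definition gram :: "'i set \<Rightarrow> ('i \<Rightarrow> real^'p) \<Rightarrow> real^'p^'p" where
  "gram I z = (\<Sum>a\<in>I. outer (z a) (z a))"

lemma gram_mult_vector: "gram I z *v y = (\<Sum>a\<in>I. (z a \<bullet> y) *\<^sub>R z a)"
  by (simp add: gram_def bounded_bilinear.sum_left[OF bounded_bilinear_matrix_vector_mult] outer_mult_vector)

lemma gram_form: "x \<bullet> (gram I z *v y) = (\<Sum>a\<in>I. (z a \<bullet> x) * (z a \<bullet> y))"
  by (simp add: gram_mult_vector inner_sum_right inner_commute mult.commute)

lemma transpose_gram: "transpose (gram I z) = gram I z"
  unfolding gram_def by (simp add: linear_sum[OF linear_transpose] transpose_outer)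

lemma pos_semidef_gram: "pos_semidef (gram I z)"
  by (simp add: pos_semidef_def transpose_gram gram_form sum_nonneg)

lemma trace_gram_mult: "trace (gram I z ** A) = (\<Sum>a\<in>I. z a \<bullet> (A *v z a))"
  by (simp add: gram_def bounded_bilinear.sum_left[OF bounded_bilinear_matrix_mult]
      linear_sum[OF linear_trace] trace_outer_mult)

lemma trace_gram: "trace (gram I z) = (\<Sum>a\<in>I. (norm (z a))\<^sup>2)"
  using trace_gram_mult[of I z "mat 1"] by (simp add: power2_norm_eq_inner)

lemma gram_form_le_trace: "w \<bullet> (gram I z *v w) \<le> trace (gram I z) * (norm w)\<^sup>2"
proof -
  have "(z a \<bullet> w)\<^sup>2 \<le> (norm (z a))\<^sup>2 * (norm w)\<^sup>2" for a
    using Cauchy_Schwarz_ineq[of "z a" w] by (simp add: power2_norm_eq_inner)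
  then show ?thesis
    by (simp add: gram_form trace_gram sum_distrib_right sum_mono flip: power2_eq_square)
qed

lemma row_le_gram:
  assumes "finite I" "a \<in> I"
  shows "(z a \<bullet> y)\<^sup>2 \<le> y \<bullet> (gram I z *v y)"
  unfolding gram_form using assms
  by (simp add: member_le_sum[of a I "\<lambda>a. (z a \<bullet> y) * (z a \<bullet> y)"] power2_eq_square)

lemma transpose_mult_form:
  fixes X :: "real^'p^'m"
  shows "x \<bullet> ((transpose X ** X) *v y) = (X *v x) \<bullet> (X *v y)"
proof -
  have "(transpose X ** X) *v y = (X *v y) v* X"
    by (simp flip: matrix_vector_mul_assoc)
  then show ?thesis by (simp add: inner_commute[of x] dot_lmul_matrix inner_commute[of "X *v x"])
qed

text \<open>The term \<open>eps I\<close> with \<open>eps > 0\<close> keeps the matrix invertible for every \<open>X\<close> and every \<open>S \<ge> 0\<close>; the estimator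
belongs to \<open>eps = 0\<close>.\<close>

definition ridge_matrix :: "real \<Rightarrow> real \<Rightarrow> real^'p^'m \<Rightarrow> real^'p^'p \<Rightarrow> real^'p^'p" where
  "ridge_matrix t eps X S = S + t *\<^sub>R (transpose X ** X) + eps *\<^sub>R mat 1"

definition ridge_inv :: "real \<Rightarrow> real \<Rightarrow> real^'p^'m \<Rightarrow> real^'p^'p \<Rightarrow> real^'p^'p" where
  "ridge_inv t eps X S = matrix_inv (ridge_matrix t eps X S)"

lemma ridge_matrix_form:
  fixes X :: "real^'p^'m"
  shows "y \<bullet> (ridge_matrix t eps X S *v y) = y \<bullet> (S *v y) + t * (norm (X *v y))\<^sup>2 + eps * (norm y)\<^sup>2"
  unfolding ridge_matrix_def
  by (simp only: matrix_vector_add_left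
      matrix_vector_scaleR_left
      inner_add_right inner_scaleR_right transpose_mult_form power2_norm_eq_inner matrix_vector_mul_lid)

lemma transpose_ridge_matrix:
  assumes "transpose S = S"
  shows "transpose (ridge_matrix t eps X S) = ridge_matrix t eps X S"
  unfolding ridge_matrix_def
  by (simp add: linear_add[OF linear_transpose] transpose_scalar matrix_transpose_mul assms)

text \<open>Two situations are covered at once: a regularised inverse with \<open>eps > 0\<close> and arbitrary \<open>S \<ge> 0\<close>, and the
actual inverse with \<open>eps = 0\<close> and positive definite \<open>S\<close>.\<close>

locale ridge =
  fixes S :: "real^'p^'p" and X :: "real^'p^'m" and t eps :: real
  assumes S: "pos_semidef S" and t: "0 < t" and eps_nonneg: "0 \<le> eps"
    and nondeg: "eps = 0 \<Longrightarrow> pos_def S"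
begin

abbreviation Q where "Q \<equiv> ridge_matrix t eps X S"
abbreviation P where "P \<equiv> ridge_inv t eps X S"

lemma S_nonneg: "0 \<le> y \<bullet> (S *v y)"
  using S by (simp add: pos_semidef_def)

lemma S_sym: "(S *v x) \<bullet> y = x \<bullet> (S *v y)"
  using S by (simp add: pos_semidef_def inner_matrix_mult_transpose)

lemma pos_def_Q: "pos_def Q"
proof -
  have "0 < y \<bullet> (Q *v y)" if "y \<noteq> 0" for y
  proof (cases "eps = 0")
    case True
    then have "0 < y \<bullet> (S *v y)" using nondeg that by (simp add: pos_def_def)
    then show ?thesis unfolding ridge_matrix_form using t eps_nonneg
      by (intro add_pos_nonneg) auto
  next
    case False
    then have "0 < eps * (norm y)\<^sup>2" using eps_nonneg that by simp
    then show ?thesis unfolding ridge_matrix_form using t S_nonneg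
      by (intro add_nonneg_pos) auto
  qed
  then show ?thesis
    using transpose_ridge_matrix S by (auto simp: pos_def_def pos_semidef_def)
qed

lemma invertible_Q: "invertible Q"
  by (rule pos_def_invertible[OF pos_def_Q])

lemma pos_def_P: "pos_def P"
  unfolding ridge_inv_def by (rule pos_def_matrix_inv[OF pos_def_Q])

lemma P_nonneg: "0 \<le> x \<bullet> (P *v x)"
  using pos_def_imp_pos_semidef[OF pos_def_P] by (simp add: pos_semidef_def)

lemma P_sym: "(P *v x) \<bullet> y = x \<bullet> (P *v y)"
  using pos_def_P by (simp add: pos_def_def inner_matrix_mult_transpose)

lemma Q_P: "Q *v (P *v x) = x"
  by (simp add: ridge_inv_def matrix_inv_mult_vector invertible_Q)

lemma Q_P_matrix: "Q ** P = mat 1"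
  by (simp add: ridge_inv_def matrix_inv_inverse invertible_Q)

lemma P_Cauchy_Schwarz: "(x \<bullet> (P *v y))\<^sup>2 \<le> (x \<bullet> (P *v x)) * (y \<bullet> (P *v y))"
  by (rule pos_semidef_Cauchy_Schwarz[OF pos_def_imp_pos_semidef[OF pos_def_P]])

lemma S_Cauchy_Schwarz: "(x \<bullet> (S *v y))\<^sup>2 \<le> (x \<bullet> (S *v x)) * (y \<bullet> (S *v y))"
  by (rule pos_semidef_Cauchy_Schwarz[OF S])

lemma P_form_le:
  assumes "\<And>y. (x \<bullet> y)\<^sup>2 \<le> K * (y \<bullet> (Q *v y))" "0 \<le> K"
  shows "x \<bullet> (P *v x) \<le> K"
  unfolding ridge_inv_def by (rule inverse_form_bound[OF pos_def_Q assms])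

lemma S_le_Q: "y \<bullet> (S *v y) \<le> y \<bullet> (Q *v y)"
  unfolding ridge_matrix_form using t eps_nonneg by simp

text \<open>Here \<open>(X\<^sup>T v \<bullet> y)\<^sup>2 = (v \<bullet> X y)\<^sup>2 \<le> |v|\<^sup>2 |X y|\<^sup>2\<close>, and \<open>t |X y|\<^sup>2\<close> is one of the summands of \<open>y \<bullet> Q y\<close>. The
bound does not involve \<open>eps\<close>, \<open>S\<close> or \<open>X\<close>.\<close>

lemma P_form_design: "(v v* X) \<bullet> (P *v (v v* X)) \<le> (norm v)\<^sup>2 / t"
proof (rule P_form_le)
  fix y
  have "((v v* X) \<bullet> y)\<^sup>2 = (v \<bullet> (X *v y))\<^sup>2" by (simp add: dot_lmul_matrix)
  also have "\<dots> \<le> (norm v)\<^sup>2 * (norm (X *v y))\<^sup>2"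
    using Cauchy_Schwarz_ineq[of v "X *v y"] by (simp add: power2_norm_eq_inner)
  also have "\<dots> = (norm v)\<^sup>2 / t * (t * (norm (X *v y))\<^sup>2)" using t by simp
  also have "\<dots> \<le> (norm v)\<^sup>2 / t * (y \<bullet> (Q *v y))"
    unfolding ridge_matrix_form using t eps_nonneg S_nonneg[of y] by (intro mult_left_mono) auto
  finally show "((v v* X) \<bullet> y)\<^sup>2 \<le> (norm v)\<^sup>2 / t * (y \<bullet> (Q *v y))" .
qed (use t in auto)

lemma P_form_norm:
  assumes "0 < eps" shows "x \<bullet> (P *v x) \<le> (norm x)\<^sup>2 / eps"
proof (rule P_form_le)
  fix y
  have "(x \<bullet> y)\<^sup>2 \<le> (norm x)\<^sup>2 * (norm y)\<^sup>2"
    using Cauchy_Schwarz_ineq[of x y] by (simp add: power2_norm_eq_inner)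
  also have "\<dots> = (norm x)\<^sup>2 / eps * (eps * (norm y)\<^sup>2)" using assms by simp
  also have "\<dots> \<le> (norm x)\<^sup>2 / eps * (y \<bullet> (Q *v y))"
    unfolding ridge_matrix_form using t eps_nonneg S_nonneg[of y] by (intro mult_left_mono) auto
  finally show "(x \<bullet> y)\<^sup>2 \<le> (norm x)\<^sup>2 / eps * (y \<bullet> (Q *v y))" .
qed (use assms in auto)

text \<open>This is \<open>S P S \<le> S\<close>, from the Cauchy-Schwarz inequality for \<open>S\<close> and \<open>S \<le> Q\<close>.\<close>

lemma P_form_S: "(S *v w) \<bullet> (P *v (S *v w)) \<le> w \<bullet> (S *v w)"
proof (rule P_form_le)
  fix y
  have "((S *v w) \<bullet> y)\<^sup>2 \<le> (w \<bullet> (S *v w)) * (y \<bullet> (S *v y))"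
    using S_Cauchy_Schwarz[of w y] by (simp add: S_sym)
  also have "\<dots> \<le> (w \<bullet> (S *v w)) * (y \<bullet> (Q *v y))"
    by (intro mult_left_mono S_le_Q S_nonneg)
  finally show "((S *v w) \<bullet> y)\<^sup>2 \<le> (w \<bullet> (S *v w)) * (y \<bullet> (Q *v y))" .
qed (rule S_nonneg)

lemma P_form_row:
  assumes "\<And>y. (z \<bullet> y)\<^sup>2 \<le> y \<bullet> (S *v y)"
  shows "z \<bullet> (P *v z) \<le> 1"
  by (rule P_form_le) (simp_all add: order_trans[OF assms S_le_Q])

lemma PSP_le_P: "(P *v w) \<bullet> (S *v (P *v w)) \<le> w \<bullet> (P *v w)"
  using S_le_Q[of "P *v w"] by (simp add: Q_P P_sym)

end

text \<open>The field in the row \<open>z\<close> to which Stein's identity is applied is \<open>z \<mapsto> (z \<bullet> y) S y\<close> with \<open>y = P u\<close>; this is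
the derivative of its component along \<open>e\<close> in the direction \<open>e\<close>. A change of \<open>z\<close> along \<open>e\<close> changes \<open>S\<close> by
\<open>e z\<^sup>T + z e\<^sup>T\<close>, hence \<open>y\<close> by \<open>dy\<close>. The matrix \<open>R\<close> collects the other rows and \<open>D\<close> the terms of \<open>Q\<close> in which
\<open>z\<close> does not occur.\<close>

lemma row_field_derivative:
  fixes R D :: "real^'p^'p" and z e u :: "real^'p"
  defines "S \<equiv> \<lambda>z. R + outer z z"
  defines "P \<equiv> \<lambda>z. matrix_inv (S z + D)"
  defines "y \<equiv> P z *v u"
  defines "dy \<equiv> - ((z \<bullet> y) *\<^sub>R (P z *v e)) - (e \<bullet> y) *\<^sub>R (P z *v z)"
  assumes inv: "invertible (S z + D)"
  shows "((\<lambda>s. ((z + s *\<^sub>R e) \<bullet> (P (z + s *\<^sub>R e) *v u)) * (e \<bullet> (S (z + s *\<^sub>R e) *v (P (z + s *\<^sub>R e) *v u)))) has_real_derivative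
     (e \<bullet> y + z \<bullet> dy) * (e \<bullet> (S z *v y))
     + (z \<bullet> y) * (e \<bullet> ((z \<bullet> y) *\<^sub>R e + (e \<bullet> y) *\<^sub>R z + S z *v dy))) (at 0)"
proof -
  let ?z = "\<lambda>s. z + s *\<^sub>R e"
  let ?H = "outer z e + outer e z"
  have dz: "((\<lambda>s. z + s *\<^sub>R e) has_vector_derivative e) (at 0)"
    by (auto intro!: derivative_eq_intros)
  have dS: "((\<lambda>s. S (?z s)) has_vector_derivative ?H) (at 0)"
    unfolding S_def
    using has_vector_derivative_add[OF has_vector_derivative_const
        bounded_bilinear.has_vector_derivative[OF bounded_bilinear_outer dz dz], of R]
    by simp
  have dQ: "((\<lambda>s. S (?z s) + D) has_vector_derivative ?H) (at 0)"
    using has_vector_derivative_add[OF dS has_vector_derivative_const] by simp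
  have "((\<lambda>s. P (?z s)) has_vector_derivative - (P z ** ?H ** P z)) (at 0)"
    using has_vector_derivative_matrix_inv[OF dQ] inv by (simp add: P_def)
  then have "((\<lambda>s. P (?z s) *v u) has_vector_derivative - (P z ** ?H ** P z) *v u) (at 0)"
    by (rule bounded_linear.has_vector_derivative[OF
        bounded_bilinear.bounded_linear_left[OF bounded_bilinear_matrix_vector_mult]])
  moreover have "- (P z ** ?H ** P z) *v u = dy"
    by (simp add: dy_def y_def matrix_vector_minus_left
        matrix_vector_add_left
        outer_mult_vector matrix_vector_right_distrib matrix_vector_mult_scaleR flip: matrix_vector_mul_assoc)
  ultimately have dPu: "((\<lambda>s. P (?z s) *v u) has_vector_derivative dy) (at 0)" by simp
  have dSPu: "((\<lambda>s. S (?z s) *v (P (?z s) *v u)) has_vector_derivative S z *v dy + ?H *v y) (at 0)"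
    using bounded_bilinear.has_vector_derivative[OF bounded_bilinear_matrix_vector_mult dS dPu]
    by (simp add: y_def)
  have 1: "((\<lambda>s. (z + s *\<^sub>R e) \<bullet> (P (?z s) *v u)) has_real_derivative z \<bullet> dy + e \<bullet> y) (at 0)"
    using bounded_bilinear.has_vector_derivative[OF bounded_bilinear_inner dz dPu]
    by (simp add: has_real_derivative_iff_has_vector_derivative y_def)
  have 2: "((\<lambda>s. e \<bullet> (S (?z s) *v (P (?z s) *v u))) has_real_derivative e \<bullet> (S z *v dy + ?H *v y)) (at 0)"
    using bounded_linear.has_vector_derivative[OF bounded_linear_inner_right dSPu, of e]
    by (simp add: has_real_derivative_iff_has_vector_derivative)
  have "?H *v y = (z \<bullet> y) *\<^sub>R e + (e \<bullet> y) *\<^sub>R z"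
    by (simp add: matrix_vector_add_left outer_mult_vector)
  then show ?thesis
    using DERIV_mult[OF 1 2] by (simp add: y_def[symmetric] algebra_simps inner_add_right)
qed

text \<open>Along the direction \<open>v e\<^sup>T\<close> the vector \<open>u = X\<^sup>T v\<close> moves by \<open>|v|\<^sup>2 e\<close> and \<open>X\<^sup>T X\<close> by \<open>u e\<^sup>T + e u\<^sup>T\<close>, so
everything stays expressible through \<open>u\<close> and \<open>P\<close>.\<close>

lemma design_field_derivative:
  fixes X :: "real^'p^'m" and S :: "real^'p^'p" and t eps :: real and v :: "real^'m" and e :: "real^'p"
  defines "P \<equiv> \<lambda>X. ridge_inv t eps X S"
  defines "u \<equiv> v v* X"
  defines "y \<equiv> P X *v u"
  assumes inv: "invertible (ridge_matrix t eps X S)"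
  shows "((\<lambda>s. e \<bullet> (S *v (P (X + s *\<^sub>R outer v e) *v (v v* (X + s *\<^sub>R outer v e)))))
    has_real_derivative
     ((norm v)\<^sup>2 - t * (u \<bullet> y)) * (e \<bullet> (S *v (P X *v e))) - t * (e \<bullet> y) * (e \<bullet> (S *v y))) (at 0)"
proof -
  let ?X = "\<lambda>s. X + s *\<^sub>R outer v e"
  let ?H = "t *\<^sub>R (outer u e + outer e u)"
  have dX: "(?X has_vector_derivative outer v e) (at 0)"
    by (auto intro!: derivative_eq_intros)
  have vX: "v v* ?X s = u + (s * (norm v)\<^sup>2) *\<^sub>R e" for s
  proof -
    have "v v* ?X s = transpose (?X s) *v v" by simp
    also have "\<dots> = transpose X *v v + s *\<^sub>R (outer e v *v v)"
      by (simp only: linear_add[OF linear_transpose] linear_cmul[OF linear_transpose] transpose_outer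
          matrix_vector_add_left
          matrix_vector_scaleR_left)
    finally show ?thesis by (simp add: outer_mult_vector u_def power2_norm_eq_inner)
  qed
  have du: "((\<lambda>s. v v* ?X s) has_vector_derivative (norm v)\<^sup>2 *\<^sub>R e) (at 0)"
    unfolding vX by (auto intro!: derivative_eq_intros)
  have o1: "transpose X ** outer v e = outer u e"
  proof -
    have "(transpose X ** outer v e) *v w = outer u e *v w" for w
      by (simp add: outer_mult_vector u_def matrix_vector_mult_scaleR flip: matrix_vector_mul_assoc)
    then show ?thesis by (simp add: matrix_eq)
  qed
  have o2: "transpose (outer v e) ** X = outer e u"
  proof -
    have "(outer e v ** X) *v w = outer e u *v w" for w
      by (simp add: outer_mult_vector u_def dot_lmul_matrix flip: matrix_vector_mul_assoc)
    then show ?thesis by (simp add: matrix_eq transpose_outer)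
  qed
  have dtX: "((\<lambda>s. transpose (?X s)) has_vector_derivative transpose (outer v e)) (at 0)"
    by (rule bounded_linear.has_vector_derivative[OF linear_conv_bounded_linear[THEN iffD1, OF linear_transpose] dX])
  have dW: "((\<lambda>s. transpose (?X s) ** ?X s) has_vector_derivative outer u e + outer e u) (at 0)"
    using bounded_bilinear.has_vector_derivative[OF bounded_bilinear_matrix_mult dtX dX]
    by (simp add: o1 o2)
  have dQ: "((\<lambda>s. ridge_matrix t eps (?X s) S) has_vector_derivative ?H) (at 0)"
    unfolding ridge_matrix_def using dW by (auto intro!: derivative_eq_intros)
  have "((\<lambda>s. P (?X s)) has_vector_derivative - (P X ** ?H ** P X)) (at 0)"
    using has_vector_derivative_matrix_inv[OF dQ] inv by (simp add: P_def ridge_inv_def)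
  from bounded_bilinear.has_vector_derivative[OF bounded_bilinear_matrix_vector_mult this du]
  have "((\<lambda>s. P (?X s) *v (v v* ?X s)) has_vector_derivative
      P X *v ((norm v)\<^sup>2 *\<^sub>R e) + (- (P X ** ?H ** P X)) *v u) (at 0)"
    by (simp add: u_def)
  moreover have "P X *v ((norm v)\<^sup>2 *\<^sub>R e) + (- (P X ** ?H ** P X)) *v u
      = ((norm v)\<^sup>2 - t * (u \<bullet> y)) *\<^sub>R (P X *v e) - (t * (e \<bullet> y)) *\<^sub>R y"
    by (simp add: y_def matrix_vector_minus_left
        matrix_vector_add_left
        matrix_vector_scaleR_left
        outer_mult_vector matrix_vector_right_distrib matrix_vector_mult_scaleR algebra_simps
        flip: matrix_vector_mul_assoc)
  ultimately have "((\<lambda>s. P (?X s) *v (v v* ?X s)) has_vector_derivative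
      ((norm v)\<^sup>2 - t * (u \<bullet> y)) *\<^sub>R (P X *v e) - (t * (e \<bullet> y)) *\<^sub>R y) (at 0)" by simp
  from bounded_linear.has_vector_derivative[OF bounded_linear_inner_right
      bounded_linear.has_vector_derivative[OF bounded_bilinear.bounded_linear_right[OF bounded_bilinear_matrix_vector_mult, of S] this], of e]
  show ?thesis
    by (simp add: has_real_derivative_iff_has_vector_derivative matrix_vector_mult_diff_distrib
        matrix_vector_mult_scaleR inner_diff_right)
qed

text \<open>The summands are the derivatives of \<open>row_field_derivative\<close> along the coordinate vectors.
Summation over the coordinates turns products of components into inner products and
\<open>e \<bullet> S P e\<close> into a trace.\<close>

lemma row_field_divergence:
  fixes S P :: "real^'p^'p" and z y :: "real^'p"
  assumes S: "transpose S = S" and P: "transpose P = P"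
  shows "(\<Sum>l\<in>UNIV. let e = axis l 1; dy = - ((z \<bullet> y) *\<^sub>R (P *v e)) - (e \<bullet> y) *\<^sub>R (P *v z) in
     (e \<bullet> y + z \<bullet> dy) * (e \<bullet> (S *v y))
     + (z \<bullet> y) * (e \<bullet> ((z \<bullet> y) *\<^sub>R e + (e \<bullet> y) *\<^sub>R z + S *v dy)))
   = (y \<bullet> (S *v y)) * (1 - z \<bullet> (P *v z)) + (z \<bullet> y)\<^sup>2 * (real CARD('p) + 1 - trace (S ** P))
     - 2 * (z \<bullet> y) * ((S *v y) \<bullet> (P *v z))" (is "(\<Sum>l\<in>UNIV. ?f l) = ?rhs")
proof -
  let ?e = "\<lambda>l. axis l 1 :: real^'p"
  have zPe: "z \<bullet> (P *v e) = e \<bullet> (P *v z)" for e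
    using inner_matrix_mult_transpose[OF P, of e z] by (simp add: inner_commute)
  have f: "?f l = (?e l \<bullet> y) * (?e l \<bullet> (S *v y)) * (1 - z \<bullet> (P *v z))
      - (z \<bullet> y) * ((?e l \<bullet> (P *v z)) * (?e l \<bullet> (S *v y)))
      + (z \<bullet> y)\<^sup>2 + (z \<bullet> y) * ((?e l \<bullet> y) * (?e l \<bullet> z))
      - (z \<bullet> y)\<^sup>2 * (?e l \<bullet> ((S ** P) *v ?e l))
      - (z \<bullet> y) * ((?e l \<bullet> y) * (?e l \<bullet> (S *v (P *v z))))" for l
  proof -
    let ?dy = "- ((z \<bullet> y) *\<^sub>R (P *v ?e l)) - (?e l \<bullet> y) *\<^sub>R (P *v z)"
    have 1: "z \<bullet> ?dy = - ((z \<bullet> y) * (?e l \<bullet> (P *v z))) - (?e l \<bullet> y) * (z \<bullet> (P *v z))"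
      by (simp only: inner_diff_right inner_minus_right inner_scaleR_right zPe[of "?e l"])
    have "?e l \<bullet> (S *v ?dy) = - ((z \<bullet> y) * (?e l \<bullet> ((S ** P) *v ?e l)))
        - (?e l \<bullet> y) * (?e l \<bullet> (S *v (P *v z)))"
      by (simp only: matrix_vector_mult_diff_distrib matrix_vector_mult_scaleR
          matrix_vector_minus_right
          matrix_vector_mul_assoc inner_diff_right inner_minus_right inner_scaleR_right)
    then have 2: "?e l \<bullet> ((z \<bullet> y) *\<^sub>R ?e l + (?e l \<bullet> y) *\<^sub>R z + S *v ?dy)
        = (z \<bullet> y) + (?e l \<bullet> y) * (?e l \<bullet> z) - (z \<bullet> y) * (?e l \<bullet> ((S ** P) *v ?e l))
        - (?e l \<bullet> y) * (?e l \<bullet> (S *v (P *v z)))"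
      by (simp add: inner_add_right inner_axis_axis)
    show ?thesis unfolding Let_def 1 2 by (simp add: power2_eq_square algebra_simps)
  qed
  have "(\<Sum>l\<in>UNIV. ?f l) = (y \<bullet> (S *v y)) * (1 - z \<bullet> (P *v z)) - (z \<bullet> y) * ((P *v z) \<bullet> (S *v y))
      + real CARD('p) * (z \<bullet> y)\<^sup>2 + (z \<bullet> y) * (y \<bullet> z) - (z \<bullet> y)\<^sup>2 * trace (S ** P)
      - (z \<bullet> y) * (y \<bullet> (S *v (P *v z)))"
    unfolding f sum.distrib sum_subtractf
    by (simp only: sum_distrib_left[symmetric] sum_distrib_right[symmetric] sum_axis_inner trace_eq_sum_axis)
      simp
  also have "\<dots> = ?rhs"
    using inner_matrix_mult_transpose[OF S, of y "P *v z"]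
    by (simp add: inner_commute power2_eq_square algebra_simps)
  finally show ?thesis .
qed

text \<open>Summation over the rows reassembles \<open>S\<close>: the \<open>(z\<^sub>a \<bullet> y)\<^sup>2\<close> add up to \<open>y \<bullet> S y\<close> and the
\<open>z\<^sub>a \<bullet> P z\<^sub>a\<close> to the trace of \<open>S P\<close>.\<close>

lemma row_divergence_sum:
  fixes I :: "'i set" and z :: "'i \<Rightarrow> real^'p" and P :: "real^'p^'p"
  assumes P: "transpose P = P"
  defines "S \<equiv> gram I z"
  shows "(\<Sum>a\<in>I. (y \<bullet> (S *v y)) * (1 - z a \<bullet> (P *v z a))
      + (z a \<bullet> y)\<^sup>2 * (real CARD('p) + 1 - trace (S ** P)) - 2 * (z a \<bullet> y) * ((S *v y) \<bullet> (P *v z a)))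
   = (real (card I) + real CARD('p) + 1 - 2 * trace (S ** P)) * (y \<bullet> (S *v y))
     - 2 * ((S *v y) \<bullet> (P *v (S *v y)))"
proof -
  have b: "(\<Sum>a\<in>I. (z a \<bullet> y)\<^sup>2) = y \<bullet> (S *v y)"
    by (simp add: S_def gram_form power2_eq_square)
  have t: "(\<Sum>a\<in>I. z a \<bullet> (P *v z a)) = trace (S ** P)"
    by (simp add: S_def trace_gram_mult)
  have g: "(\<Sum>a\<in>I. (z a \<bullet> y) * ((S *v y) \<bullet> (P *v z a))) = (S *v y) \<bullet> (P *v (S *v y))"
  proof -
    have "(S *v y) \<bullet> (P *v z a) = z a \<bullet> (P *v (S *v y))" for a
      using inner_matrix_mult_transpose[OF P, of "z a" "S *v y"] by (simp add: inner_commute)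
    then have "(\<Sum>a\<in>I. (z a \<bullet> y) * ((S *v y) \<bullet> (P *v z a))) = y \<bullet> (S *v (P *v (S *v y)))"
      by (simp add: S_def gram_form)
    then show ?thesis
      using inner_matrix_mult_transpose[OF transpose_gram, of I z y "P *v (S *v y)"]
      by (simp add: S_def)
  qed
  have "(\<Sum>a\<in>I. (y \<bullet> (S *v y)) * (1 - z a \<bullet> (P *v z a))
      + (z a \<bullet> y)\<^sup>2 * (real CARD('p) + 1 - trace (S ** P)) - 2 * (z a \<bullet> y) * ((S *v y) \<bullet> (P *v z a)))
    = (y \<bullet> (S *v y)) * (real (card I) - (\<Sum>a\<in>I. z a \<bullet> (P *v z a)))
      + (\<Sum>a\<in>I. (z a \<bullet> y)\<^sup>2) * (real CARD('p) + 1 - trace (S ** P))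
      - 2 * (\<Sum>a\<in>I. (z a \<bullet> y) * ((S *v y) \<bullet> (P *v z a)))"
    by (simp add: sum.distrib sum_subtractf sum_distrib_left sum_distrib_right right_diff_distrib mult.assoc)
  then show ?thesis unfolding b t g by (simp add: algebra_simps)
qed

section \<open>Measurability of matrix functions\<close>

lemma borel_measurable_bilinear:
  fixes h :: "'b::euclidean_space \<Rightarrow> 'c::euclidean_space \<Rightarrow> 'd::euclidean_space"
  assumes "bounded_bilinear h" "f \<in> borel_measurable M" "g \<in> borel_measurable M"
  shows "(\<lambda>x. h (f x) (g x)) \<in> borel_measurable M"
  by (rule borel_measurable_continuous_Pair[OF assms(2,3)])
    (intro bounded_bilinear.continuous_on[OF assms(1)] continuous_intros)

lemma borel_measurable_linear:
  fixes h :: "'b::euclidean_space \<Rightarrow> 'c::euclidean_space"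
  assumes "linear h" "f \<in> borel_measurable M"
  shows "(\<lambda>x. h (f x)) \<in> borel_measurable M"
  using measurable_compose[OF assms(2) borel_measurable_continuous_onI[OF linear_continuous_on]] assms(1)
  by (simp add: linear_linear)

lemmas [measurable] =
  borel_measurable_bilinear[OF bounded_bilinear_matrix_mult]
  borel_measurable_bilinear[OF bounded_bilinear_matrix_vector_mult]
  borel_measurable_bilinear[OF bounded_bilinear_outer]
  borel_measurable_linear[OF linear_transpose]
  borel_measurable_linear[OF linear_trace]

lemma borel_measurable_vec_nth[measurable]:
  "f \<in> borel_measurable M \<Longrightarrow> (\<lambda>x. f x $ i) \<in> borel_measurable M" for f :: "_ \<Rightarrow> 'b::euclidean_space^'n"
  by (rule borel_measurable_linear) (auto intro: linearI)

lemma borel_measurable_vector_matrix[measurable]: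
  fixes f :: "_ \<Rightarrow> real^'p^'m"
  shows "f \<in> borel_measurable M \<Longrightarrow> (\<lambda>x. v v* f x) \<in> borel_measurable M"
  unfolding transpose_matrix_vector[symmetric] by measurable

lemma borel_measurable_gram[measurable]:
  "(\<And>a. a \<in> I \<Longrightarrow> (\<lambda>x. z x a) \<in> borel_measurable M) \<Longrightarrow> (\<lambda>x. gram I (z x)) \<in> borel_measurable M"
  unfolding gram_def by (intro borel_measurable_sum borel_measurable_bilinear[OF bounded_bilinear_outer])

lemma borel_measurable_ridge_inv[measurable]:
  fixes f :: "_ \<Rightarrow> real^'p^'m"
  assumes [measurable]: "f \<in> borel_measurable M" "g \<in> borel_measurable M"
  shows "(\<lambda>x. ridge_inv t eps (f x) (g x)) \<in> borel_measurable M"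
  unfolding ridge_inv_def ridge_matrix_def by measurable

section \<open>The matrix normal law\<close>

lemma trace_mult_transpose: "trace (A ** transpose B) = A \<bullet> B" for A B :: "real^'p^'m"
  by (simp add: trace_def matrix_matrix_mult_def transpose_def inner_vec_def)

lemma inner_matrix_mult_right:
  fixes X Y :: "real^'p^'m"
  shows "(X ** K) \<bullet> Y = (\<Sum>i\<in>UNIV. X $ i \<bullet> (K *v Y $ i))"
proof -
  have "(X ** K) $ i = X $ i v* K" for i
    by (simp add: vec_eq_iff matrix_matrix_mult_def vector_matrix_mult_def mult.commute)
  then show ?thesis by (simp add: inner_vec_def[of "X ** K"] dot_lmul_matrix)
qed

lemma inner_outer: "A \<bullet> outer v e = v \<bullet> (A *v e)"
  by (simp add: inner_vec_def outer_def matrix_vector_mult_def sum_distrib_left mult_ac)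

lemma gaussian_right_mult:
  assumes "pos_def K"
  shows "gaussian (\<lambda>X :: real^'p^'m. X ** K)"
proof (rule gaussian.intro)
  have K: "transpose K = K" "x \<noteq> 0 \<Longrightarrow> 0 < x \<bullet> (K *v x)" for x using assms by (auto simp: pos_def_def)
  show "linear (\<lambda>X :: real^'p^'m. X ** K)"
    using bounded_bilinear.bounded_linear_left[OF bounded_bilinear_matrix_mult]
    by (simp add: linear_conv_bounded_linear)
  show "(X ** K) \<bullet> Y = X \<bullet> (Y ** K)" for X Y :: "real^'p^'m"
    unfolding inner_commute[of X] inner_matrix_mult_right
    by (intro sum.cong refl) (metis K(1) inner_commute inner_matrix_mult_transpose)
  show "0 < (X ** K) \<bullet> X" if "X \<noteq> 0" for X :: "real^'p^'m"
  proof -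
    obtain i where i: "X $ i \<noteq> 0" using \<open>X \<noteq> 0\<close> by (metis vec_eq_iff zero_index)
    show ?thesis unfolding inner_matrix_mult_right
    proof (rule sum_pos2[of _ i])
      show "0 \<le> X $ j \<bullet> (K *v X $ j)" for j
        using K(2)[of "X $ j"] by (cases "X $ j = 0") auto
    qed (use i K in auto)
  qed
qed

text \<open>The precision operator of \<open>N(M, I \<otimes> \<Sigma>)\<close> is multiplication by the inverse of \<open>\<Sigma>\<close> from the right.\<close>

lemma matrix_normal_eq_gaussian_law:
  fixes M :: "real^'p^'m"
  assumes "pos_def \<Sigma>"
  shows "matrix_normal M (mat 1) \<Sigma> = gaussian.law M (\<lambda>X. X ** matrix_inv \<Sigma>)"
proof -
  interpret gaussian M "\<lambda>X. X ** matrix_inv \<Sigma>"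
    by (rule gaussian_right_mult[OF pos_def_matrix_inv[OF assms]])
  have "matrix_inv (mat 1 :: real^'m^'m) = mat 1"
    by (rule matrix_inv_eqI) simp
  then have "matrix_normal_kernel M (mat 1) \<Sigma> = kernel"
    by (simp add: fun_eq_iff matrix_normal_kernel_def kernel_def trace_mult_transpose)
  then show ?thesis by (simp add: matrix_normal_def law_def mass_def)
qed

text \<open>The vector \<open>y = P X\<^sup>T v\<close>: the \<open>v\<close>-combination of the rows of the shrinkage term \<open>X P S\<close> is \<open>S y\<close>.\<close>

definition fit :: "real \<Rightarrow> real \<Rightarrow> real^'m \<Rightarrow> real^'p^'m \<Rightarrow> real^'p^'p \<Rightarrow> real^'p" where
  "fit t eps v X S = ridge_inv t eps X S *v (v v* X)"

text \<open>The divergence in \<open>X\<close> that replaces \<open>(X - \<Theta>)\<^sup>T v \<bullet> K S y\<close> under the expectation.\<close>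

definition cross_term :: "real \<Rightarrow> real \<Rightarrow> real^'m \<Rightarrow> real^'p^'m \<Rightarrow> real^'p^'p \<Rightarrow> real" where
  "cross_term t eps v X S =
     trace (S ** ridge_inv t eps X S) * ((norm v)\<^sup>2 - t * ((v v* X) \<bullet> fit t eps v X S))
     - t * (fit t eps v X S \<bullet> (S *v fit t eps v X S))"

text \<open>The divergence in the rows of the sample that replaces \<open>S y \<bullet> K S y\<close> under the expectation.\<close>

definition energy_term :: "nat \<Rightarrow> real \<Rightarrow> real \<Rightarrow> real^'m \<Rightarrow> real^'p^'m \<Rightarrow> real^'p^'p \<Rightarrow> real" where
  "energy_term n t eps v X S =
     (real n + real CARD('p) + 1 - 2 * trace (S ** ridge_inv t eps X S))
       * (fit t eps v X S \<bullet> (S *v fit t eps v X S))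
     - 2 * ((S *v fit t eps v X S) \<bullet> (ridge_inv t eps X S *v (S *v fit t eps v X S)))"

lemma borel_measurable_stein_terms[measurable]:
  fixes f :: "_ \<Rightarrow> real^'p^'m"
  assumes [measurable]: "f \<in> borel_measurable M" "g \<in> borel_measurable M"
  shows "(\<lambda>x. fit t eps v (f x) (g x)) \<in> borel_measurable M"
    and "(\<lambda>x. cross_term t eps v (f x) (g x)) \<in> borel_measurable M"
    and "(\<lambda>x. energy_term n t eps v (f x) (g x)) \<in> borel_measurable M"
  unfolding cross_term_def energy_term_def fit_def by measurable

section \<open>Bounds uniform in the regularisation\<close>

lemma abs_le_sqrtI: "x\<^sup>2 \<le> c \<Longrightarrow> \<bar>x\<bar> \<le> sqrt c" for x c :: real
  by (metis real_sqrt_abs real_sqrt_le_mono)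

context ridge begin

lemma fit_form_bounds:
  shows "0 \<le> (v v* X) \<bullet> fit t eps v X S" "(v v* X) \<bullet> fit t eps v X S \<le> (norm v)\<^sup>2 / t"
    and "fit t eps v X S \<bullet> (S *v fit t eps v X S) \<le> (v v* X) \<bullet> fit t eps v X S"
    and "(S *v fit t eps v X S) \<bullet> (P *v (S *v fit t eps v X S)) \<le> fit t eps v X S \<bullet> (S *v fit t eps v X S)"
  by (simp_all add: fit_def P_nonneg P_form_design PSP_le_P P_form_S)

lemma fit_S_fit_le: "fit t eps v X S \<bullet> (S *v fit t eps v X S) \<le> (norm v)\<^sup>2 / t"
  using fit_form_bounds(2,3) by (rule order_trans[rotated])

text \<open>Cauchy-Schwarz for the form \<open>S\<close>, for which \<open>y\<close> has length at most \<open>|v| / \<surd>t\<close> whatever \<open>X\<close> is.\<close>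

lemma abs_inner_S_fit: "\<bar>x \<bullet> (S *v fit t eps v X S)\<bar> \<le> sqrt (x \<bullet> (S *v x)) * sqrt ((norm v)\<^sup>2 / t)"
proof -
  have "(x \<bullet> (S *v fit t eps v X S))\<^sup>2 \<le> (x \<bullet> (S *v x)) * ((norm v)\<^sup>2 / t)"
    using S_Cauchy_Schwarz fit_S_fit_le S_nonneg by (meson mult_left_mono order_trans)
  then show ?thesis by (metis abs_le_sqrtI real_sqrt_mult)
qed

lemma abs_inner_fit:
  assumes "x \<bullet> (P *v x) \<le> c"
  shows "\<bar>x \<bullet> fit t eps v X S\<bar> \<le> sqrt c * sqrt ((norm v)\<^sup>2 / t)"
proof -
  have "(x \<bullet> fit t eps v X S)\<^sup>2 \<le> (x \<bullet> (P *v x)) * ((v v* X) \<bullet> (P *v (v v* X)))"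
    unfolding fit_def by (rule P_Cauchy_Schwarz)
  also have "\<dots> \<le> c * ((norm v)\<^sup>2 / t)"
    by (intro mult_mono assms P_form_design P_nonneg order_trans[OF P_nonneg assms])
  finally show ?thesis by (metis abs_le_sqrtI real_sqrt_mult)
qed

lemma abs_inner_SP:
  assumes "x \<bullet> (P *v x) \<le> c"
  shows "\<bar>w \<bullet> (S *v (P *v x))\<bar> \<le> sqrt (w \<bullet> (S *v w)) * sqrt c"
proof -
  have "(w \<bullet> (S *v (P *v x)))\<^sup>2 \<le> (w \<bullet> (S *v w)) * ((P *v x) \<bullet> (S *v (P *v x)))"
    by (rule S_Cauchy_Schwarz)
  also have "\<dots> \<le> (w \<bullet> (S *v w)) * c"
    by (intro mult_left_mono order_trans[OF PSP_le_P assms] S_nonneg)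
  finally show ?thesis by (metis abs_le_sqrtI real_sqrt_mult)
qed

end

section \<open>The model and the identity in the design matrix\<close>

text \<open>The Wishart matrix is represented by the independent rows that generate it, because integration by
parts takes place in the rows.\<close>

locale normal_model =
  fixes \<Theta> :: "real^'p^'m" and \<Sigma> :: "real^'p^'p" and n :: nat
  assumes pos_def_\<Sigma>: "pos_def \<Sigma>"
begin

definition K where "K = matrix_inv \<Sigma>"

abbreviation "design_law \<equiv> matrix_normal \<Theta> (mat 1) \<Sigma>"
abbreviation "row_law \<equiv> matrix_normal (0 :: real^'p^1) (mat 1) \<Sigma>"
abbreviation "rows_law \<equiv> PiM {..<n} (\<lambda>_. row_law)"

definition scatter :: "(nat \<Rightarrow> real^'p^1) \<Rightarrow> real^'p^'p" where
  "scatter \<omega> = gram {..<n} (\<lambda>a. \<omega> a $ 1)"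

lemma pos_def_K: "pos_def K"
  unfolding K_def by (rule pos_def_matrix_inv[OF pos_def_\<Sigma>])

sublocale design: gaussian \<Theta> "\<lambda>X :: real^'p^'m. X ** K"
  by (rule gaussian_right_mult[OF pos_def_K])

sublocale row: gaussian 0 "\<lambda>X :: real^'p^1. X ** K"
  by (rule gaussian_right_mult[OF pos_def_K])

lemma design_law_eq: "design_law = design.law" and row_law_eq: "row_law = row.law"
  by (simp_all add: K_def matrix_normal_eq_gaussian_law pos_def_\<Sigma>)

lemma sets_laws[simp, measurable_cong]:
  "sets design_law = sets borel" "sets row_law = sets borel"
  by (simp_all add: design_law_eq row_law_eq)

lemma prob_space_row_law: "prob_space row_law"
  by (simp add: row_law_eq row.prob_space_law)

sublocale rows: product_prob_space "\<lambda>_::nat. row_law" "{..<n}"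
  by (intro product_prob_spaceI prob_space_row_law)

lemma prob_space_design_law: "prob_space design_law"
  by (simp add: design_law_eq design.prob_space_law)

end

lemma abs_le_mult_sqrt: "x\<^sup>2 \<le> a * b \<Longrightarrow> \<bar>x\<bar> \<le> sqrt a * sqrt b" for x a b :: real
  by (metis abs_le_sqrtI real_sqrt_mult)

lemma trace_gram_ridge_bounds:
  assumes "ridge (gram I z) t eps" "finite I"
  shows "0 \<le> trace (gram I z ** ridge_inv t eps X (gram I z))"
    and "trace (gram I z ** ridge_inv t eps X (gram I z)) \<le> real (card I)"
proof -
  interpret ridge "gram I z" X t eps by fact
  show "0 \<le> trace (gram I z ** P)"
    unfolding trace_gram_mult by (intro sum_nonneg P_nonneg)
  have "trace (gram I z ** P) \<le> (\<Sum>a\<in>I. 1)"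
    unfolding trace_gram_mult by (intro sum_mono P_form_row row_le_gram assms)
  then show "trace (gram I z ** P) \<le> real (card I)" by simp
qed

text \<open>For \<open>w = S y\<close> the Cauchy-Schwarz inequality for \<open>S\<close> gives \<open>|w|\<^sup>4 \<le> (w \<bullet> S w) (y \<bullet> S y)\<close>, and \<open>w \<bullet> S w\<close> is at
most the trace of \<open>S\<close> times \<open>|w|\<^sup>2\<close>. The right side is integrable and free of \<open>eps\<close>, so it also serves as
the dominating function when \<open>eps\<close> tends to \<open>0\<close>.\<close>

lemma norm_S_fit_le:
  assumes "ridge (gram I z) t eps"
  shows "(norm (gram I z *v fit t eps v X (gram I z)))\<^sup>2 \<le> trace (gram I z) * ((norm v)\<^sup>2 / t)"
proof -
  interpret ridge "gram I z" X t eps by fact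
  let ?w = "gram I z *v fit t eps v X (gram I z)"
  have tr: "0 \<le> trace (gram I z)" unfolding trace_gram by (intro sum_nonneg) auto
  have "((norm ?w)\<^sup>2)\<^sup>2 = (?w \<bullet> ?w)\<^sup>2" by (simp add: power2_norm_eq_inner)
  also have "\<dots> \<le> (?w \<bullet> (gram I z *v ?w)) * (fit t eps v X (gram I z) \<bullet> ?w)"
    by (rule S_Cauchy_Schwarz)
  also have "\<dots> \<le> (trace (gram I z) * (norm ?w)\<^sup>2) * ((norm v)\<^sup>2 / t)"
    using tr by (intro mult_mono gram_form_le_trace fit_S_fit_le S_nonneg) auto
  finally have le: "(norm ?w)\<^sup>2 * (norm ?w)\<^sup>2 \<le> (trace (gram I z) * ((norm v)\<^sup>2 / t)) * (norm ?w)\<^sup>2"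
    by (simp add: power2_eq_square mult_ac)
  show ?thesis
  proof (cases "norm ?w = 0")
    case True
    then show ?thesis using tr t by (simp only: True) simp
  next
    case False
    then have "0 < (norm ?w)\<^sup>2" by simp
    then show ?thesis using le by (rule mult_right_le_imp_le[rotated])
  qed
qed

context normal_model begin

lemma K_sym: "transpose K = K"
  using pos_def_K by (simp add: pos_def_def)

text \<open>Stein's identity in the directions \<open>v e\<^sub>l\<^sup>T\<close> for the components of \<open>S y\<close>, at a fixed scatter matrix. The sum
of the resulting derivatives over \<open>l\<close> is \<^const>\<open>cross_term\<close>.\<close>

lemma expectation_cross:
  fixes S :: "real^'p^'p"
  assumes psd: "pos_semidef S" and t0: "0 < t" and eps0: "0 < eps"
  shows "(\<integral>X. (v v* (X - \<Theta>)) \<bullet> (K *v (S *v fit t eps v X S)) \<partial>design_law)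
       = (\<integral>X. cross_term t eps v X S \<partial>design_law)"
proof -
  have ridge: "ridge S t eps" using assms by unfold_locales auto
  let ?e = "\<lambda>l. axis l 1 :: real^'p"
  let ?f = "\<lambda>l X. ?e l \<bullet> (S *v fit t eps v X S)"
  let ?f' = "\<lambda>l X. ((norm v)\<^sup>2 - t * ((v v* X) \<bullet> fit t eps v X S)) * (?e l \<bullet> (S *v (ridge_inv t eps X S *v ?e l)))
      - t * (?e l \<bullet> fit t eps v X S) * (?e l \<bullet> (S *v fit t eps v X S))"
  let ?c = "(norm v)\<^sup>2 / t"
  have c0: "0 \<le> ?c" using t0 by simp
  have steinl: "integrable design_law (\<lambda>X. (((X - \<Theta>) ** K) \<bullet> outer v (?e l)) * ?f l X) \<and> integrable design_law (?f' l)
     \<and> (\<integral>X. (((X - \<Theta>) ** K) \<bullet> outer v (?e l)) * ?f l X \<partial>design_law) = (\<integral>X. ?f' l X \<partial>design_law)" for l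
  proof -
    define s where "s = sqrt (?e l \<bullet> (S *v ?e l))"
    have s0: "0 \<le> s" using psd by (simp add: s_def pos_semidef_def)
    \<comment> \<open>The components of the field and their derivatives are bounded in \<open>X\<close>, so one constant gives the growth condition.\<close>
    let ?B = "(norm v)\<^sup>2 * (s * sqrt (1 / eps)) + t * (sqrt (1 / eps) * sqrt ?c) * (s * sqrt ?c)"
    define C where "C = s * sqrt ?c + ?B"
    have C0: "0 \<le> C" using s0 t0 eps0 c0 by (simp add: C_def)
    have grow: "x \<le> C \<Longrightarrow> x \<le> C * (1 + norm (X - \<Theta>))" for x and X :: "real^'p^'m"
      using C0 by (simp add: distrib_left add_increasing2)
    have b: "\<bar>?f l X\<bar> \<le> s * sqrt ?c"
      "\<bar>?f' l X\<bar> \<le> ?B" for X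
    proof -
      interpret ridge S X t eps by (fact ridge)
      have ePe: "?e l \<bullet> (P *v ?e l) \<le> 1 / eps" using P_form_norm[OF eps0, of "?e l"] by simp
      show f: "\<bar>?f l X\<bar> \<le> s * sqrt ?c" unfolding s_def by (rule abs_inner_S_fit)
      have 1: "\<bar>(norm v)\<^sup>2 - t * ((v v* X) \<bullet> fit t eps v X S)\<bar> \<le> (norm v)\<^sup>2"
      proof -
        have "0 \<le> t * ((v v* X) \<bullet> fit t eps v X S)" using t fit_form_bounds(1) by simp
        moreover have "t * ((v v* X) \<bullet> fit t eps v X S) \<le> (norm v)\<^sup>2"
          using fit_form_bounds(2) t by (simp add: field_simps)
        ultimately show ?thesis by simp
      qed
      have 2: "\<bar>?e l \<bullet> (S *v (P *v ?e l))\<bar> \<le> s * sqrt (1 / eps)"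
        unfolding s_def by (rule abs_inner_SP[OF ePe])
      have 3: "\<bar>?e l \<bullet> fit t eps v X S\<bar> \<le> sqrt (1 / eps) * sqrt ?c" by (rule abs_inner_fit[OF ePe])
      have "\<bar>?f' l X\<bar> \<le> \<bar>(norm v)\<^sup>2 - t * ((v v* X) \<bullet> fit t eps v X S)\<bar> * \<bar>?e l \<bullet> (S *v (P *v ?e l))\<bar>
          + t * \<bar>?e l \<bullet> fit t eps v X S\<bar> * \<bar>?e l \<bullet> (S *v fit t eps v X S)\<bar>"
        using t by (simp add: abs_mult flip: abs_mult) (rule order_trans[OF abs_triangle_ineq4], simp add: abs_mult)
      also have "\<dots> \<le> ?B"
        using 1 2 3 f t0 s0 c0 eps0 by (intro add_mono mult_mono) auto
      finally show "\<bar>?f' l X\<bar> \<le> ?B" .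
    qed
    have C1: "s * sqrt ?c \<le> C" "?B \<le> C"
      using s0 t0 eps0 c0 by (auto simp: C_def)
    have meas: "?f l \<in> borel_measurable borel" "?f' l \<in> borel_measurable borel" by measurable
    have der: "((\<lambda>s. ?f l (X + s *\<^sub>R outer v (?e l))) has_real_derivative ?f' l X) (at 0)" for X
    proof -
      interpret ridge S X t eps by (fact ridge)
      show ?thesis
        using design_field_derivative[OF invertible_Q, where e="?e l" and v=v] by (simp add: fit_def)
    qed
    note st = design.stein[where f="?f l" and f'="?f' l" and v="outer v (?e l)" and C=C, OF meas der
        grow[OF order_trans[OF b(1) C1(1)]] grow[OF order_trans[OF b(2) C1(2)]]]
    show ?thesis unfolding design_law_eq using st by blast
  qed
  have "(v v* (X - \<Theta>)) \<bullet> (K *v (S *v fit t eps v X S)) = (\<Sum>l\<in>UNIV. (((X - \<Theta>) ** K) \<bullet> outer v (?e l)) * ?f l X)" for X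
  proof -
    have "(v v* (X - \<Theta>)) \<bullet> (K *v x) = (\<Sum>l\<in>UNIV. (((X - \<Theta>) ** K) \<bullet> outer v (?e l)) * (?e l \<bullet> x))" for x
    proof -
      have "((X - \<Theta>) ** K) \<bullet> outer v (?e l) = ?e l \<bullet> (v v* ((X - \<Theta>) ** K))" for l
        by (simp add: inner_outer inner_commute[of "?e l"] dot_lmul_matrix)
      then have "(\<Sum>l\<in>UNIV. (((X - \<Theta>) ** K) \<bullet> outer v (?e l)) * (?e l \<bullet> x)) = (v v* ((X - \<Theta>) ** K)) \<bullet> x"
        by (simp add: sum_axis_inner)
      then show ?thesis by (simp add: dot_lmul_matrix matrix_vector_mul_assoc)
    qed
    then show ?thesis .
  qed
  then have "(\<integral>X. (v v* (X - \<Theta>)) \<bullet> (K *v (S *v fit t eps v X S)) \<partial>design_law)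
      = (\<Sum>l\<in>UNIV. \<integral>X. (((X - \<Theta>) ** K) \<bullet> outer v (?e l)) * ?f l X \<partial>design_law)"
    using steinl by (simp add: Bochner_Integration.integral_sum)
  also have "\<dots> = (\<Sum>l\<in>UNIV. \<integral>X. ?f' l X \<partial>design_law)"
    using steinl by simp
  also have "\<dots> = (\<integral>X. (\<Sum>l\<in>UNIV. ?f' l X) \<partial>design_law)"
    using steinl by (intro Bochner_Integration.integral_sum[symmetric]) auto
  also have "\<dots> = (\<integral>X. cross_term t eps v X S \<partial>design_law)"
  proof (intro Bochner_Integration.integral_cong refl)
    fix X
    have "(\<Sum>l\<in>UNIV. ?f' l X) = ((norm v)\<^sup>2 - t * ((v v* X) \<bullet> fit t eps v X S)) * (\<Sum>l\<in>UNIV. ?e l \<bullet> ((S ** ridge_inv t eps X S) *v ?e l))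
      - t * (\<Sum>l\<in>UNIV. (?e l \<bullet> fit t eps v X S) * (?e l \<bullet> (S *v fit t eps v X S)))"
      by (simp add: sum_subtractf sum_distrib_left matrix_vector_mul_assoc mult.assoc)
    then show "(\<Sum>l\<in>UNIV. ?f' l X) = cross_term t eps v X S"
      by (simp add: sum_axis_inner cross_term_def mult.commute flip: trace_eq_sum_axis)
  qed
  finally show ?thesis .
qed

section \<open>Stein's identity in the rows of the sample\<close>

text \<open>Stein's identity in one row with the other rows frozen, followed by Fubini. A family of directions is
treated at once because it is the sums over \<open>J\<close> that are integrable over all rows.\<close>

lemma stein_rows:
  fixes V :: "'l \<Rightarrow> real^'p^1" and f f' :: "'l \<Rightarrow> (nat \<Rightarrow> real^'p^1) \<Rightarrow> real"
  assumes a: "a < n" and J: "finite J"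
    and meas: "\<And>l. f l \<in> borel_measurable rows_law" "\<And>l. f' l \<in> borel_measurable rows_law"
    and der: "\<And>l w. ((\<lambda>s. f l (w(a := w a + s *\<^sub>R V l))) has_real_derivative f' l w) (at 0)"
    and growth: "\<And>l w. \<exists>C. \<forall>z. \<bar>f l (w(a := z))\<bar> \<le> C * (1 + norm z) \<and> \<bar>f' l (w(a := z))\<bar> \<le> C * (1 + norm z)"
    and int: "integrable rows_law (\<lambda>w. \<Sum>l\<in>J. ((w a ** K) \<bullet> V l) * f l w)"
      "integrable rows_law (\<lambda>w. \<Sum>l\<in>J. f' l w)"
  shows "(\<integral>w. (\<Sum>l\<in>J. ((w a ** K) \<bullet> V l) * f l w) \<partial>rows_law) = (\<integral>w. (\<Sum>l\<in>J. f' l w) \<partial>rows_law)"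
proof -
  define I where "I = {..<n} - {a}"
  have I: "finite I" "a \<notin> I" "{..<n} = insert a I" using a by (auto simp: I_def)
  have "(\<integral>w. (\<Sum>l\<in>J. ((w a ** K) \<bullet> V l) * f l w) \<partial>rows_law)
    = (\<integral>w. (\<integral>z. (\<Sum>l\<in>J. ((z ** K) \<bullet> V l) * f l (w(a := z))) \<partial>row_law) \<partial>PiM I (\<lambda>_. row_law))"
    using rows.product_integral_insert[OF I(1,2) int(1)[unfolded I(3)]] by (simp add: I(3))
  also have "\<dots> = (\<integral>w. (\<integral>z. (\<Sum>l\<in>J. f' l (w(a := z))) \<partial>row_law) \<partial>PiM I (\<lambda>_. row_law))"
  proof (rule Bochner_Integration.integral_cong[OF refl])
    fix w assume w: "w \<in> space (PiM I (\<lambda>_. row_law))"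
    have upd: "(\<lambda>z. w(a := z)) \<in> measurable borel rows_law"
      using measurable_component_update[OF w I(2)] by (simp add: I(3) cong: measurable_cong_sets)
    have st: "integrable row_law (\<lambda>z. ((z ** K) \<bullet> V l) * f l (w(a := z))) \<and> integrable row_law (\<lambda>z. f' l (w(a := z)))
       \<and> (\<integral>z. ((z ** K) \<bullet> V l) * f l (w(a := z)) \<partial>row_law) = (\<integral>z. f' l (w(a := z)) \<partial>row_law)" for l
    proof -
      obtain C where C: "\<And>z. \<bar>f l (w(a := z))\<bar> \<le> C * (1 + norm (z - 0))" "\<And>z. \<bar>f' l (w(a := z))\<bar> \<le> C * (1 + norm (z - 0))"
        using growth[of l w] by auto
      have d: "((\<lambda>s. f l (w(a := z + s *\<^sub>R V l))) has_real_derivative f' l (w(a := z))) (at 0)" for z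
        using der[of l "w(a := z)"] by simp
      note row.stein[where f="\<lambda>z. f l (w(a := z))" and f'="\<lambda>z. f' l (w(a := z))" and v="V l" and C=C,
          OF measurable_compose[OF upd meas(1)] measurable_compose[OF upd meas(2)] d C]
      then show ?thesis unfolding row_law_eq by simp
    qed
    then show "(\<integral>z. (\<Sum>l\<in>J. ((z ** K) \<bullet> V l) * f l (w(a := z))) \<partial>row_law) = (\<integral>z. (\<Sum>l\<in>J. f' l (w(a := z))) \<partial>row_law)"
      by (simp add: Bochner_Integration.integral_sum)
  qed
  also have "\<dots> = (\<integral>w. (\<Sum>l\<in>J. f' l w) \<partial>rows_law)"
    using rows.product_integral_insert[OF I(1,2) int(2)[unfolded I(3)]] by (simp add: I(3))
  finally show ?thesis .
qed

lemma measurable_row[measurable]: "a < n \<Longrightarrow> (\<lambda>w. w a) \<in> borel_measurable rows_law"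
  using measurable_component_singleton[of a "{..<n}" "\<lambda>_. row_law"] by (simp cong: measurable_cong_sets)

lemma measurable_scatter[measurable]: "scatter \<in> borel_measurable rows_law"
  unfolding scatter_def by measurable

lemma integrable_row_norm: assumes "a < n" shows "integrable rows_law (\<lambda>w. (norm (w a $ 1))\<^sup>2)"
proof -
  have "integrable row.law (\<lambda>z. (norm (z $ 1))\<^sup>2)"
  proof (rule row.integrable_law_quadratic_growth)
    show "\<bar>(norm (z $ 1))\<^sup>2\<bar> \<le> 1 * (1 + (norm (z - 0))\<^sup>2)" for z :: "real^'p^1"
      using Finite_Cartesian_Product.norm_nth_le[of z 1] by (simp add: power_mono add_increasing)
  qed simp
  then have "integrable (distr rows_law row_law (\<lambda>w. w a)) (\<lambda>z. (norm (z $ 1))\<^sup>2)"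
    using rows.PiM_component[of a] assms by (simp add: row_law_eq)
  then show ?thesis
    by (rule integrable_distr[rotated]) (use assms in simp)
qed

lemma integrable_trace_scatter: "integrable rows_law (\<lambda>w. trace (scatter w))"
  unfolding scatter_def trace_gram by (intro Bochner_Integration.integrable_sum integrable_row_norm) simp

end

context ridge begin

text \<open>Growth of the field and of its derivatives in the row \<open>z\<close>: both are at most linear in \<open>\<rho>\<close>, which below is
\<open>|z|\<close> plus a constant. The coefficients may depend on \<open>eps\<close>.\<close>

lemma row_field_bounds:
  fixes v :: "real^'m" and z e :: "real^'p"
  assumes row: "\<And>y. (z \<bullet> y)\<^sup>2 \<le> y \<bullet> (S *v y)" and e: "e \<bullet> e = 1" and eps0: "0 < eps"
    and \<rho>: "0 \<le> \<rho>" "\<bar>e \<bullet> z\<bar> \<le> \<rho>" "e \<bullet> (S *v e) \<le> \<rho>\<^sup>2"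
  defines "y \<equiv> fit t eps v X S"
  defines "dy \<equiv> - ((z \<bullet> y) *\<^sub>R (P *v e)) - (e \<bullet> y) *\<^sub>R (P *v z)"
  defines "b \<equiv> sqrt ((norm v)\<^sup>2 / t)" and "g \<equiv> sqrt (1 / eps)"
  shows "\<bar>(z \<bullet> y) * (e \<bullet> (S *v y))\<bar> \<le> b * (\<rho> * b)"
    and "\<bar>(e \<bullet> y + z \<bullet> dy) * (e \<bullet> (S *v y))
      + (z \<bullet> y) * (e \<bullet> ((z \<bullet> y) *\<^sub>R e + (e \<bullet> y) *\<^sub>R z + S *v dy))\<bar> \<le> 6 * b\<^sup>2 * g * \<rho> + b\<^sup>2"
proof -
  let ?g = "(z \<bullet> y) *\<^sub>R e + (e \<bullet> y) *\<^sub>R z + S *v dy"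
  have b0: "0 \<le> b" using t by (simp add: b_def)
  have g0: "0 \<le> g" using eps0 by (simp add: g_def)
  have zPz: "z \<bullet> (P *v z) \<le> 1" by (rule P_form_row[OF row])
  have ePe: "e \<bullet> (P *v e) \<le> 1 / eps" using P_form_norm[OF eps0, of e] e by (simp add: power2_norm_eq_inner)
  have se: "sqrt (e \<bullet> (S *v e)) \<le> \<rho>"
    using \<rho> real_sqrt_le_mono by fastforce
  have 1: "\<bar>z \<bullet> y\<bar> \<le> b" using abs_inner_fit[OF zPz] by (simp add: y_def b_def)
  have 2: "\<bar>e \<bullet> y\<bar> \<le> g * b" using abs_inner_fit[OF ePe] by (simp add: y_def b_def g_def)
  have 3: "\<bar>e \<bullet> (S *v y)\<bar> \<le> \<rho> * b"
    using abs_inner_S_fit[of e] mult_right_mono[OF se b0] unfolding y_def b_def by (rule order_trans)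
  have 4: "\<bar>z \<bullet> (P *v e)\<bar> \<le> g"
  proof -
    have "(z \<bullet> (P *v e))\<^sup>2 \<le> 1 * (1 / eps)"
      using P_Cauchy_Schwarz[of z e] zPz ePe P_nonneg eps0
      by (intro order_trans[OF P_Cauchy_Schwarz] mult_mono) auto
    then show ?thesis unfolding g_def by (intro abs_le_sqrtI) simp
  qed
  have 5: "\<bar>e \<bullet> (S *v (P *v e))\<bar> \<le> \<rho> * g"
    using abs_inner_SP[OF ePe, of e] mult_right_mono[OF se g0] unfolding g_def by (rule order_trans)
  have 6: "\<bar>e \<bullet> (S *v (P *v z))\<bar> \<le> \<rho>"
    using abs_inner_SP[OF zPz, of e] se by simp
  show "\<bar>(z \<bullet> y) * (e \<bullet> (S *v y))\<bar> \<le> b * (\<rho> * b)"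
    unfolding abs_mult using b0 by (intro mult_mono 1 3) auto
  have dz: "z \<bullet> dy = - ((z \<bullet> y) * (z \<bullet> (P *v e))) - (e \<bullet> y) * (z \<bullet> (P *v z))"
    by (simp only: dy_def inner_diff_right inner_minus_right inner_scaleR_right)
  have "e \<bullet> (S *v dy) = - ((z \<bullet> y) * (e \<bullet> (S *v (P *v e)))) - (e \<bullet> y) * (e \<bullet> (S *v (P *v z)))"
    by (simp only: dy_def matrix_vector_mult_diff_distrib matrix_vector_mult_scaleR
        matrix_vector_minus_right
        inner_diff_right inner_minus_right inner_scaleR_right)
  then have de: "e \<bullet> ?g
      = (z \<bullet> y) + (e \<bullet> y) * (e \<bullet> z) - (z \<bullet> y) * (e \<bullet> (S *v (P *v e))) - (e \<bullet> y) * (e \<bullet> (S *v (P *v z)))"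
    by (simp add: inner_add_right e)
  have "\<bar>e \<bullet> y + z \<bullet> dy\<bar> \<le> \<bar>e \<bullet> y\<bar> + \<bar>z \<bullet> y\<bar> * \<bar>z \<bullet> (P *v e)\<bar> + \<bar>e \<bullet> y\<bar> * \<bar>z \<bullet> (P *v z)\<bar>"
    unfolding dz abs_mult[symmetric] by linarith
  also have "\<dots> \<le> g * b + b * g + (g * b) * 1"
    using b0 g0 zPz P_nonneg[of z] by (intro add_mono mult_mono 1 2 4) auto
  finally have A: "\<bar>e \<bullet> y + z \<bullet> dy\<bar> \<le> 3 * (b * g)" by (simp add: mult.commute)
  have "\<bar>e \<bullet> ?g\<bar>
      \<le> \<bar>z \<bullet> y\<bar> + \<bar>e \<bullet> y\<bar> * \<bar>e \<bullet> z\<bar> + \<bar>z \<bullet> y\<bar> * \<bar>e \<bullet> (S *v (P *v e))\<bar> + \<bar>e \<bullet> y\<bar> * \<bar>e \<bullet> (S *v (P *v z))\<bar>"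
    unfolding de abs_mult[symmetric] by linarith
  also have "\<dots> \<le> b + (g * b) * \<rho> + b * (\<rho> * g) + (g * b) * \<rho>"
    using b0 g0 \<rho> by (intro add_mono mult_mono 1 2 5 6) auto
  finally have B: "\<bar>e \<bullet> ?g\<bar> \<le> b + 3 * (b * g * \<rho>)"
    by (simp add: mult_ac)
  have "\<bar>(e \<bullet> y + z \<bullet> dy) * (e \<bullet> (S *v y)) + (z \<bullet> y) * (e \<bullet> ?g)\<bar>
      \<le> \<bar>e \<bullet> y + z \<bullet> dy\<bar> * \<bar>e \<bullet> (S *v y)\<bar> + \<bar>z \<bullet> y\<bar> * \<bar>e \<bullet> ?g\<bar>"
    unfolding abs_mult[symmetric] by (rule abs_triangle_ineq)
  also have "\<dots> \<le> (3 * (b * g)) * (\<rho> * b) + b * (b + 3 * (b * g * \<rho>))"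
    using b0 g0 \<rho> by (intro add_mono mult_mono 1 3 A B) auto
  also have "\<dots> = 6 * b\<^sup>2 * g * \<rho> + b\<^sup>2" by (simp add: power2_eq_square algebra_simps)
  finally show "\<bar>(e \<bullet> y + z \<bullet> dy) * (e \<bullet> (S *v y)) + (z \<bullet> y) * (e \<bullet> ?g)\<bar> \<le> 6 * b\<^sup>2 * g * \<rho> + b\<^sup>2" .
qed

text \<open>The derivatives along single coordinates grow with \<open>z\<close>, but in the divergence only forms occur that are
bounded by multiples of \<open>|v|\<^sup>2 / t\<close>.\<close>

lemma row_divergence_bound:
  fixes v :: "real^'m" and z :: "real^'p"
  assumes row: "\<And>y. (z \<bullet> y)\<^sup>2 \<le> y \<bullet> (S *v y)"
    and tr: "0 \<le> trace (S ** P)" "trace (S ** P) \<le> N"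
  defines "y \<equiv> fit t eps v X S" and "c \<equiv> (norm v)\<^sup>2 / t"
  shows "\<bar>(y \<bullet> (S *v y)) * (1 - z \<bullet> (P *v z)) + (z \<bullet> y)\<^sup>2 * (real CARD('p) + 1 - trace (S ** P))
     - 2 * (z \<bullet> y) * ((S *v y) \<bullet> (P *v z))\<bar> \<le> c * (real CARD('p) + 4 + N)"
proof -
  have c0: "0 \<le> c" using t by (simp add: c_def)
  have zPz: "z \<bullet> (P *v z) \<le> 1" by (rule P_form_row[OF row])
  have ySy: "0 \<le> y \<bullet> (S *v y)" "y \<bullet> (S *v y) \<le> c"
    using S_nonneg fit_S_fit_le by (auto simp: y_def c_def)
  have zy: "\<bar>z \<bullet> y\<bar> \<le> sqrt c" using abs_inner_fit[OF zPz] by (simp add: y_def c_def)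
  then have zy2: "(z \<bullet> y)\<^sup>2 \<le> c" using c0 by (metis abs_ge_zero power2_abs power_mono real_sqrt_pow2)
  have "((S *v y) \<bullet> (P *v z))\<^sup>2 \<le> c * 1"
  proof -
    have "(S *v y) \<bullet> (P *v (S *v y)) \<le> c"
      using fit_form_bounds(4) ySy(2) unfolding y_def by (rule order_trans)
    then show ?thesis using zPz P_nonneg c0
      by (intro order_trans[OF P_Cauchy_Schwarz] mult_mono) auto
  qed
  then have s: "\<bar>(S *v y) \<bullet> (P *v z)\<bar> \<le> sqrt c" by (intro abs_le_sqrtI) simp
  have 1: "\<bar>(y \<bullet> (S *v y)) * (1 - z \<bullet> (P *v z))\<bar> \<le> c * 1"
    unfolding abs_mult using ySy zPz P_nonneg[of z] by (intro mult_mono) auto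
  have 2: "\<bar>(z \<bullet> y)\<^sup>2 * (real CARD('p) + 1 - trace (S ** P))\<bar> \<le> c * (real CARD('p) + 1 + N)"
    unfolding abs_mult using zy2 c0 tr by (intro mult_mono) auto
  have "\<bar>z \<bullet> y\<bar> * \<bar>(S *v y) \<bullet> (P *v z)\<bar> \<le> sqrt c * sqrt c"
    using c0 by (intro mult_mono zy s) auto
  then have 3: "\<bar>2 * (z \<bullet> y) * ((S *v y) \<bullet> (P *v z))\<bar> \<le> 2 * c"
    using c0 by (simp add: abs_mult)
  have "c * (real CARD('p) + 4 + N) = c * 1 + c * (real CARD('p) + 1 + N) + 2 * c" by (simp add: algebra_simps)
  then show ?thesis using 1 2 3 by linarith
qed

end

lemma gram_remove:
  assumes "finite I" "a \<in> I"
  shows "gram I z = gram (I - {a}) z + outer (z a) (z a)"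
  unfolding gram_def using assms by (simp add: sum.remove add.commute)

lemma ridge_gram: "0 < t \<Longrightarrow> 0 < eps \<Longrightarrow> ridge (gram I z) t eps"
  by unfold_locales (auto simp: pos_semidef_gram)

context normal_model begin

lemma scatter_upd:
  assumes "a < n"
  shows "scatter (w(a := z)) = gram ({..<n} - {a}) (\<lambda>b. w b $ 1) + outer (z $ 1) (z $ 1)"
proof -
  have "gram ({..<n} - {a}) (\<lambda>b. (w(a := z)) b $ 1) = gram ({..<n} - {a}) (\<lambda>b. w b $ 1)"
    unfolding gram_def by (intro sum.cong) auto
  then show ?thesis unfolding scatter_def using assms by (subst gram_remove[of _ a]) auto
qed

lemma K_bound: obtains \<kappa> where "0 \<le> \<kappa>" "\<And>x y. \<bar>x \<bullet> (K *v y)\<bar> \<le> \<kappa> * (norm x * norm y)"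
proof -
  have "bounded_linear ((*v) K)"
    using bounded_bilinear.bounded_linear_right[OF bounded_bilinear_matrix_vector_mult] by simp
  then obtain \<kappa> where k: "0 \<le> \<kappa>" "\<And>y. norm (K *v y) \<le> norm y * \<kappa>"
    using bounded_linear.nonneg_bounded by blast
  have "\<bar>x \<bullet> (K *v y)\<bar> \<le> \<kappa> * (norm x * norm y)" for x y
  proof -
    have "\<bar>x \<bullet> (K *v y)\<bar> \<le> norm x * norm (K *v y)" by (rule Cauchy_Schwarz_ineq2)
    also have "\<dots> \<le> norm x * (norm y * \<kappa>)" by (intro mult_left_mono k) simp
    finally show ?thesis by (simp add: mult_ac)
  qed
  then show ?thesis using that k by blast
qed

lemma row_sum_inner: "(\<Sum>l\<in>UNIV. ((A ** K) \<bullet> (\<chi> i. axis l 1)) * (c * (axis l 1 \<bullet> y))) = c * ((A $ 1) \<bullet> (K *v y))"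
  for A :: "real^'p^1"
proof -
  have "(A ** K) \<bullet> (\<chi> i. axis l 1) = axis l 1 \<bullet> (K *v A $ 1)" for l
    using inner_matrix_mult_transpose[OF K_sym, of "A $ 1" "axis l 1"]
    by (simp add: inner_matrix_mult_right inner_commute)
  then have "(\<Sum>l\<in>UNIV. ((A ** K) \<bullet> (\<chi> i. axis l 1)) * (c * (axis l 1 \<bullet> y)))
      = c * (\<Sum>l\<in>UNIV. (axis l 1 \<bullet> (K *v A $ 1)) * (axis l 1 \<bullet> y))"
    by (simp add: sum_distrib_left mult_ac)
  then show ?thesis
    using inner_matrix_mult_transpose[OF K_sym, of "A $ 1" y] by (simp add: sum_axis_inner)
qed

text \<open>Stein's identity for the field \<open>z\<^sub>a \<mapsto> (z\<^sub>a \<bullet> y) S y\<close> in the row with index \<open>a\<close>.\<close>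

lemma expectation_row:
  fixes X :: "real^'p^'k" and v :: "real^'k"
  assumes a: "a < n" and t0: "0 < t" and eps0: "0 < eps"
  defines "y \<equiv> \<lambda>w. fit t eps v X (scatter w)" and "P \<equiv> \<lambda>w. ridge_inv t eps X (scatter w)"
  defines "h \<equiv> \<lambda>w. (w a $ 1 \<bullet> y w) * (w a $ 1 \<bullet> (K *v (scatter w *v y w)))"
  defines "d \<equiv> \<lambda>w. (y w \<bullet> (scatter w *v y w)) * (1 - w a $ 1 \<bullet> (P w *v w a $ 1))
      + (w a $ 1 \<bullet> y w)\<^sup>2 * (real CARD('p) + 1 - trace (scatter w ** P w))
      - 2 * (w a $ 1 \<bullet> y w) * ((scatter w *v y w) \<bullet> (P w *v w a $ 1))"
  shows "integrable rows_law h" "integrable rows_law d" "(\<integral>w. h w \<partial>rows_law) = (\<integral>w. d w \<partial>rows_law)"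
proof -
  let ?e = "\<lambda>l. axis l 1 :: real^'p"
  let ?c = "(norm v)\<^sup>2 / t"
  have c0: "0 \<le> ?c" using t0 by simp
  have ridge: "ridge (scatter w) t eps" for w
    unfolding scatter_def by (rule ridge_gram[OF t0 eps0])
  have row: "(w a $ 1 \<bullet> x)\<^sup>2 \<le> x \<bullet> (scatter w *v x)" for w x
    unfolding scatter_def using row_le_gram[of "{..<n}" a "\<lambda>a. w a $ 1"] a by simp
  have meas[measurable]: "y \<in> borel_measurable rows_law" "P \<in> borel_measurable rows_law"
    unfolding y_def P_def by measurable
  have meas_a[measurable]: "(\<lambda>w. w a) \<in> borel_measurable rows_law" using a by measurable
  have hm: "h \<in> borel_measurable rows_law" unfolding h_def by measurable
  have dm: "d \<in> borel_measurable rows_law" unfolding d_def by measurable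
  obtain \<kappa> where \<kappa>: "0 \<le> \<kappa>" "\<And>x y. \<bar>x \<bullet> (K *v y)\<bar> \<le> \<kappa> * (norm x * norm y)" by (rule K_bound) blast
  have hb: "\<bar>h w\<bar> \<le> \<kappa> * ?c * trace (scatter w)" for w
  proof -
    interpret ridge "scatter w" X t eps by (rule ridge)
    have tr: "0 \<le> trace (scatter w)" unfolding scatter_def trace_gram by (intro sum_nonneg) auto
    have 1: "\<bar>w a $ 1 \<bullet> y w\<bar> \<le> sqrt ?c"
      using abs_inner_fit[OF P_form_row[OF row]] by (simp add: y_def)
    have 2: "norm (w a $ 1) \<le> sqrt (trace (scatter w))"
      unfolding scatter_def trace_gram
      by (intro real_le_rsqrt member_le_sum[of a _ "\<lambda>a. (norm (w a $ 1))\<^sup>2"]) (use a in auto)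
    have 3: "norm (scatter w *v y w) \<le> sqrt (trace (scatter w)) * sqrt ?c"
      using abs_le_mult_sqrt[OF norm_S_fit_le[OF ridge[unfolded scatter_def]]] by (simp add: y_def scatter_def)
    have "\<bar>h w\<bar> \<le> sqrt ?c * (\<kappa> * (sqrt (trace (scatter w)) * (sqrt (trace (scatter w)) * sqrt ?c)))"
      unfolding h_def abs_mult
      using \<kappa>(1) tr c0 by (intro mult_mono 1 order_trans[OF \<kappa>(2)] 2 3) auto
    also have "\<dots> = \<kappa> * (sqrt ?c * sqrt ?c) * (sqrt (trace (scatter w)) * sqrt (trace (scatter w)))" by (simp only: mult_ac)
    finally show ?thesis using tr c0 t0 by simp
  qed
  show hi: "integrable rows_law h"
  proof (rule Bochner_Integration.integrable_bound[OF _ hm])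
    show "integrable rows_law (\<lambda>w. \<kappa> * ?c * trace (scatter w))"
      by (intro integrable_mult_right integrable_trace_scatter)
    show "AE w in rows_law. norm (h w) \<le> norm (\<kappa> * ?c * trace (scatter w))"
    proof (rule AE_I2)
      fix w show "norm (h w) \<le> norm (\<kappa> * ?c * trace (scatter w))" unfolding real_norm_def using hb abs_ge_self by (rule order_trans)
    qed
  qed
  have db: "\<bar>d w\<bar> \<le> ?c * (real CARD('p) + 4 + real n)" for w
  proof -
    interpret ridge "scatter w" X t eps by (rule ridge)
    show ?thesis
      unfolding d_def P_def y_def
      using trace_gram_ridge_bounds[OF ridge[unfolded scatter_def]]
      by (intro row_divergence_bound row) (simp_all add: scatter_def)
  qed
  show di: "integrable rows_law d"
    by (rule rows.P.integrable_const_bound[OF AE_I2 dm]) (use db in auto)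
  let ?f = "\<lambda>l w. (w a $ 1 \<bullet> y w) * (?e l \<bullet> (scatter w *v y w))"
  let ?f' = "\<lambda>l w. let e = axis l 1; dy = - ((w a $ 1 \<bullet> y w) *\<^sub>R (P w *v e)) - (e \<bullet> y w) *\<^sub>R (P w *v w a $ 1) in
     (e \<bullet> y w + w a $ 1 \<bullet> dy) * (e \<bullet> (scatter w *v y w))
     + (w a $ 1 \<bullet> y w) * (e \<bullet> ((w a $ 1 \<bullet> y w) *\<^sub>R e + (e \<bullet> y w) *\<^sub>R w a $ 1 + scatter w *v dy))"
  have hs: "(\<Sum>l\<in>UNIV. ((w a ** K) \<bullet> (\<chi> i. ?e l)) * ?f l w) = h w" for w
    unfolding h_def by (rule row_sum_inner)
  have ds: "(\<Sum>l\<in>UNIV. ?f' l w) = d w" for w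
  proof -
    interpret ridge "scatter w" X t eps by (rule ridge)
    show ?thesis unfolding d_def
      by (rule row_field_divergence) (use pos_def_P S in \<open>auto simp: P_def pos_def_def pos_semidef_def\<close>)
  qed
  have "(\<integral>w. (\<Sum>l\<in>UNIV. ((w a ** K) \<bullet> (\<chi> i. ?e l)) * ?f l w) \<partial>rows_law) = (\<integral>w. (\<Sum>l\<in>UNIV. ?f' l w) \<partial>rows_law)"
  proof (rule stein_rows[OF a])
    show "?f l \<in> borel_measurable rows_law" for l by measurable
    show "?f' l \<in> borel_measurable rows_law" for l unfolding Let_def by measurable
    show "integrable rows_law (\<lambda>w. \<Sum>l\<in>UNIV. ((w a ** K) \<bullet> (\<chi> i. ?e l)) * ?f l w)"
      unfolding hs by (rule hi)
    show "integrable rows_law (\<lambda>w. \<Sum>l\<in>UNIV. ?f' l w)"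
      unfolding ds by (rule di)
    show "((\<lambda>s. ?f l (w(a := w a + s *\<^sub>R (\<chi> i. ?e l)))) has_real_derivative ?f' l w) (at 0)" for l w
    proof -
      interpret ridge "scatter w" X t eps by (rule ridge)
      let ?R = "gram ({..<n} - {a}) (\<lambda>b. w b $ 1)" and ?D = "t *\<^sub>R (transpose X ** X) + eps *\<^sub>R mat 1"
      have sc: "scatter w = ?R + outer (w a $ 1) (w a $ 1)"
        using scatter_upd[OF a, of w "w a"] by simp
      have rm: "ridge_inv t eps X T = matrix_inv (T + ?D)" for T
        by (simp add: ridge_inv_def ridge_matrix_def add.assoc)
      have inv: "invertible (?R + outer (w a $ 1) (w a $ 1) + ?D)"
        using invertible_Q by (simp add: sc ridge_matrix_def add.assoc)
      show ?thesis
        using row_field_derivative[OF inv, of "?e l" "v v* X"]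
        by (simp add: y_def P_def fit_def rm scatter_upd[OF a] sc Let_def)
    qed
    show "\<exists>C. \<forall>z. \<bar>?f l (w(a := z))\<bar> \<le> C * (1 + norm z) \<and> \<bar>?f' l (w(a := z))\<bar> \<le> C * (1 + norm z)" for l w
    proof -
      let ?R = "gram ({..<n} - {a}) (\<lambda>b. w b $ 1)"
      define r where "r = sqrt (?e l \<bullet> (?R *v ?e l))"
      define b where "b = sqrt ?c"
      define g where "g = sqrt (1 / eps)"
      define C where "C = (6 * b\<^sup>2 * g + b\<^sup>2) * (1 + r)"
      have r0: "0 \<le> r" and g0: "0 \<le> g"
        using pos_semidef_gram[of "{..<n} - {a}" "\<lambda>b. w b $ 1"] eps0 by (auto simp: r_def g_def pos_semidef_def)
      have r2: "?e l \<bullet> (?R *v ?e l) = r\<^sup>2"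
        using pos_semidef_gram[of "{..<n} - {a}" "\<lambda>b. w b $ 1"] by (simp add: r_def pos_semidef_def)
      have "\<bar>?f l (w(a := z))\<bar> \<le> C * (1 + norm z) \<and> \<bar>?f' l (w(a := z))\<bar> \<le> C * (1 + norm z)" for z
      proof -
        let ?w = "w(a := z)"
        interpret ridge "scatter ?w" X t eps by (rule ridge)
        \<comment> \<open>\<open>e\<^sub>l \<bullet> S e\<^sub>l\<close> is \<open>r\<^sup>2\<close> from the other rows plus the squared component of \<open>z\<close>.\<close>
        define \<rho> where "\<rho> = r + norm z"
        have \<rho>0: "0 \<le> \<rho>" using r0 by (simp add: \<rho>_def)
        have ez: "\<bar>?e l \<bullet> z $ 1\<bar> \<le> norm z"
          using Cauchy_Schwarz_ineq2[of "?e l" "z $ 1"] Finite_Cartesian_Product.norm_nth_le[of z 1] by simp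
        then have \<rho>1: "\<bar>?e l \<bullet> ?w a $ 1\<bar> \<le> \<rho>" using r0 by (simp add: \<rho>_def)
        have "?e l \<bullet> (scatter ?w *v ?e l) = r\<^sup>2 + (?e l \<bullet> z $ 1)\<^sup>2"
          unfolding scatter_upd[OF a]
          by (simp add: matrix_vector_add_left outer_mult_vector
              inner_add_right r2 power2_eq_square inner_commute)
        also have "\<dots> \<le> r\<^sup>2 + (norm z)\<^sup>2" using ez by (simp add: abs_le_square_iff[symmetric])
        also have "\<dots> \<le> \<rho>\<^sup>2" using r0 by (simp add: \<rho>_def power2_sum)
        finally have \<rho>2: "?e l \<bullet> (scatter ?w *v ?e l) \<le> \<rho>\<^sup>2" .
        note B = row_field_bounds[where z="?w a $ 1" and e="?e l" and v=v, OF row _ eps0 \<rho>0 \<rho>1 \<rho>2]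
        have 1: "\<bar>?f l ?w\<bar> \<le> b * (\<rho> * b)"
          using B(1) by (simp add: y_def b_def inner_axis_axis)
        have 2: "\<bar>?f' l ?w\<bar> \<le> 6 * b\<^sup>2 * g * \<rho> + b\<^sup>2"
          using B(2) unfolding y_def b_def P_def g_def Let_def by (simp add: inner_axis_axis)
        have \<rho>le: "\<rho> \<le> (1 + r) * (1 + norm z)" "1 \<le> (1 + r) * (1 + norm z)"
          using r0 by (auto simp: \<rho>_def algebra_simps add_increasing)
        have "b * (\<rho> * b) \<le> b\<^sup>2 * ((1 + r) * (1 + norm z))"
          using mult_left_mono[OF \<rho>le(1), of "b\<^sup>2"] by (simp add: power2_eq_square mult_ac)
        also have "\<dots> \<le> C * (1 + norm z)"
          unfolding C_def mult.assoc[of _ "1 + r"] using r0 g0 by (intro mult_right_mono) auto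
        finally have 1: "\<bar>?f l ?w\<bar> \<le> C * (1 + norm z)" using 1 by linarith
        have "6 * b\<^sup>2 * g * \<rho> + b\<^sup>2 * 1 \<le> 6 * b\<^sup>2 * g * ((1 + r) * (1 + norm z)) + b\<^sup>2 * ((1 + r) * (1 + norm z))"
          using g0 by (intro add_mono mult_left_mono \<rho>le) auto
        also have "\<dots> = C * (1 + norm z)" by (simp add: C_def distrib_right mult.assoc)
        finally show ?thesis using 1 2 by simp
      qed
      then show ?thesis by blast
    qed
  qed simp
  then show "(\<integral>w. h w \<partial>rows_law) = (\<integral>w. d w \<partial>rows_law)" unfolding hs ds .
qed

text \<open>Since \<open>S y\<close> is the sum of the \<open>(z\<^sub>a \<bullet> y) z\<^sub>a\<close>, the form \<open>S y \<bullet> K S y\<close> is the sum over \<open>a\<close> of the functions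
that \<open>expectation_row\<close> integrates.\<close>

lemma expectation_energy:
  fixes X :: "real^'p^'k" and v :: "real^'k"
  assumes t0: "0 < t" and eps0: "0 < eps"
  shows "(\<integral>w. (scatter w *v fit t eps v X (scatter w)) \<bullet> (K *v (scatter w *v fit t eps v X (scatter w))) \<partial>rows_law)
    = (\<integral>w. energy_term n t eps v X (scatter w) \<partial>rows_law)"
proof -
  note er = expectation_row[OF _ t0 eps0, where v=v and X=X]
  let ?y = "\<lambda>w. fit t eps v X (scatter w)" and ?P = "\<lambda>w. ridge_inv t eps X (scatter w)"
  have "(scatter w *v ?y w) \<bullet> x = (\<Sum>a<n. (w a $ 1 \<bullet> ?y w) * (w a $ 1 \<bullet> x))" for w x
    unfolding scatter_def gram_mult_vector by (simp add: inner_sum_left)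
  then have 1: "(scatter w *v ?y w) \<bullet> (K *v (scatter w *v ?y w))
      = (\<Sum>a<n. (w a $ 1 \<bullet> ?y w) * (w a $ 1 \<bullet> (K *v (scatter w *v ?y w))))" for w .
  have 2: "energy_term n t eps v X (scatter w) = (\<Sum>a<n. (?y w \<bullet> (scatter w *v ?y w)) * (1 - w a $ 1 \<bullet> (?P w *v w a $ 1))
      + (w a $ 1 \<bullet> ?y w)\<^sup>2 * (real CARD('p) + 1 - trace (scatter w ** ?P w))
      - 2 * (w a $ 1 \<bullet> ?y w) * ((scatter w *v ?y w) \<bullet> (?P w *v w a $ 1)))" for w
  proof -
    interpret ridge "scatter w" X t eps
      unfolding scatter_def by (rule ridge_gram[OF t0 eps0])
    have "transpose (?P w) = ?P w" using pos_def_P by (simp add: pos_def_def)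
    from row_divergence_sum[OF this, where I="{..<n}" and z="\<lambda>a. w a $ 1" and y="?y w"]
    show ?thesis by (simp add: energy_term_def scatter_def)
  qed
  show ?thesis
    unfolding 1 2
    by (subst (1 2) Bochner_Integration.integral_sum)
      (use er in \<open>auto simp only: lessThan_iff intro!: sum.cong\<close>)
qed

end

section \<open>Almost sure invertibility of the scatter matrix\<close>

lemma pos_semidef_eq_0:
  assumes "pos_semidef A" "x \<bullet> (A *v x) = 0"
  shows "A *v x = 0"
proof -
  have "((A *v x) \<bullet> (A *v x))\<^sup>2 \<le> 0"
    using pos_semidef_Cauchy_Schwarz[OF assms(1), of "A *v x" x] assms(2) by simp
  then show ?thesis by simp
qed

lemma pos_semidef_invertible:
  assumes "pos_semidef A" "invertible A"
  shows "pos_def A"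
proof -
  have "x \<bullet> (A *v x) \<noteq> 0" if "x \<noteq> 0" for x
  proof
    assume "x \<bullet> (A *v x) = 0"
    then have "A *v x = 0" by (rule pos_semidef_eq_0[OF assms(1)])
    then show False using matrix_inv_mult_vector(2)[OF assms(2), of x] that by simp
  qed
  then show ?thesis
    using assms(1) unfolding pos_def_def pos_semidef_def by (metis less_le)
qed

lemma pos_semidef_add: "pos_semidef A \<Longrightarrow> pos_semidef B \<Longrightarrow> pos_semidef (A + B)"
  by (simp add: pos_semidef_def linear_add[OF linear_transpose]
      matrix_vector_add_left inner_add_right)

lemma pos_def_add: "pos_def A \<Longrightarrow> pos_semidef B \<Longrightarrow> pos_def (A + B)"
  by (simp add: pos_semidef_def pos_def_def linear_add[OF linear_transpose] add_pos_nonneg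
      matrix_vector_add_left inner_add_right)

lemma pos_semidef_outer: "pos_semidef (outer x x)"
  using pos_semidef_gram[of "{()}" "\<lambda>_. x"] by (simp add: gram_def)

lemma gram_axis_UNIV: "gram UNIV (\<lambda>l. axis l 1) = (mat 1 :: real^'p^'p)"
proof -
  have "gram UNIV (\<lambda>l. axis l 1) *v x = mat 1 *v x" for x :: "real^'p"
  proof -
    have "gram UNIV (\<lambda>l. axis l 1) *v x = (\<Sum>l\<in>UNIV. x $ l *\<^sub>R axis l 1)"
      by (simp add: gram_mult_vector inner_axis')
    also have "\<dots> = x" by (simp add: vec_eq_iff axis_def if_distrib cong: if_cong)
    finally show ?thesis by simp
  qed
  then show ?thesis by (simp add: matrix_eq)
qed

text \<open>As \<open>M + e e\<^sup>T\<close> is invertible, the kernel of \<open>M\<close> is at most one-dimensional. If it is spanned by \<open>x\<^sub>0\<close>, then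
\<open>M + z z\<^sup>T\<close> is singular only for \<open>z\<close> in the hyperplane orthogonal to \<open>x\<^sub>0\<close>.\<close>

lemma AE_rank_one_update_invertible:
  fixes M :: "real^'p^'p"
  assumes M: "pos_semidef M" and inv: "invertible (M + outer e e)"
  shows "AE z in (lborel :: (real^'p^1) measure). invertible (M + outer (z $ 1) (z $ 1))"
proof (cases "invertible M")
  case True
  have "invertible (M + outer (z $ 1) (z $ 1))" for z :: "real^'p^1"
    by (rule pos_def_invertible[OF pos_def_add[OF pos_semidef_invertible[OF M True] pos_semidef_outer]])
  then show ?thesis by simp
next
  case False
  then obtain x0 where x0: "x0 \<noteq> 0" "M *v x0 = 0"
    unfolding invertible_left_inverse matrix_left_invertible_ker by blast
  have ker: "x = 0" if "M *v x = 0" "e \<bullet> x = 0" for x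
  proof -
    have "(M + outer e e) *v x = 0"
      by (simp add: matrix_vector_add_left outer_mult_vector that)
    then show ?thesis using matrix_inv_mult_vector(2)[OF inv, of x] by simp
  qed
  have ex0: "e \<bullet> x0 \<noteq> 0" using ker[OF x0(2)] x0(1) by blast
  let ?V = "(\<chi> i. x0) :: real^'p^1"
  have bad: "?V \<bullet> z = 0" if "\<not> invertible (M + outer (z $ 1) (z $ 1))" for z :: "real^'p^1"
  proof -
    from that obtain x where x: "x \<noteq> 0" "(M + outer (z $ 1) (z $ 1)) *v x = 0"
      unfolding invertible_left_inverse matrix_left_invertible_ker by blast
    then have "x \<bullet> ((M + outer (z $ 1) (z $ 1)) *v x) = 0" by simp
    then have "x \<bullet> (M *v x) + (z $ 1 \<bullet> x)\<^sup>2 = 0"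
      by (simp add: matrix_vector_add_left outer_mult_vector
          inner_add_right power2_eq_square inner_commute)
    moreover have "0 \<le> x \<bullet> (M *v x)" using M by (simp add: pos_semidef_def)
    ultimately have 1: "x \<bullet> (M *v x) = 0" and 2: "z $ 1 \<bullet> x = 0"
      by (auto simp: add_nonneg_eq_0_iff)
    have Mx: "M *v x = 0" by (rule pos_semidef_eq_0[OF M 1])
    have "(e \<bullet> x0) *\<^sub>R x - (e \<bullet> x) *\<^sub>R x0 = 0"
      by (rule ker) (simp_all add: matrix_vector_mult_diff_distrib matrix_vector_mult_scaleR Mx x0 inner_diff_right)
    then have "(e \<bullet> x0) * (z $ 1 \<bullet> x) = (e \<bullet> x) * (z $ 1 \<bullet> x0)"
      by (metis eq_iff_diff_eq_0 inner_scaleR_right)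
    moreover have "e \<bullet> x \<noteq> 0" using ker[OF Mx] x(1) by blast
    ultimately have "z $ 1 \<bullet> x0 = 0" using 2 by simp
    moreover have "?V \<bullet> z = x0 \<bullet> z $ 1" by (simp add: inner_vec_def[of ?V])
    ultimately show ?thesis by (simp add: inner_commute)
  qed
  have "?V \<noteq> 0" using x0(1) by (simp add: vec_eq_iff)
  then have "negligible {z. ?V \<bullet> z = 0}" by (intro negligible_hyperplane) simp
  then have "{z. ?V \<bullet> z = 0} \<in> null_sets lborel"
    by (simp add: negligible_iff_null_sets null_sets_completion_iff)
  then show ?thesis by (rule AE_I') (use bad in auto)
qed

context normal_model begin

text \<open>The coordinate vectors in \<open>L\<close> make the induction work: when a row is split off, one further coordinate
vector takes its place and the count stays the same. The case of interest is \<open>L = {}\<close>.\<close>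

lemma AE_gram_invertible:
  fixes I :: "nat set" and L :: "'p set"
  assumes "finite I" "CARD('p) \<le> card I + card L"
  shows "AE w in PiM I (\<lambda>_. row_law). invertible (gram I (\<lambda>a. w a $ 1) + gram L (\<lambda>l. axis l 1 :: real^'p))"
  using assms
proof (induction I arbitrary: L rule: finite_induct)
  case empty
  then have "L = UNIV" by (simp add: card_eq_UNIV_imp_eq_UNIV card_mono le_antisym)
  then show ?case
    using gram_axis_UNIV[where 'p='p] by (simp add: gram_def[of "{}"] invertible_def)
next
  case (insert i I)
  show ?case
  proof (cases "L = UNIV")
    case True
    have "pos_def (mat 1 :: real^'p^'p)" by (simp add: pos_def_def)
    then have "invertible (gram (insert i I) (\<lambda>a. w a $ 1) + gram L (\<lambda>l. axis l 1 :: real^'p))" for w :: "nat \<Rightarrow> real^'p^1"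
      unfolding True gram_axis_UNIV
      by (subst add.commute) (rule pos_def_invertible[OF pos_def_add[OF _ pos_semidef_gram]])
    then show ?thesis by simp
  next
    case False
    \<comment> \<open>Use the induction hypothesis with \<open>l\<close> added to \<open>L\<close>, then exchange \<open>e\<^sub>l e\<^sub>l\<^sup>T\<close> for the new row.\<close>
    then obtain l where l: "l \<notin> L" by auto
    let ?g = "\<lambda>w. gram (insert i I) (\<lambda>a. w a $ 1) + gram L (\<lambda>l. axis l 1 :: real^'p)"
    have "AE w in PiM I (\<lambda>_. row_law). invertible (gram I (\<lambda>a. w a $ 1) + gram (insert l L) (\<lambda>l. axis l 1 :: real^'p))"
      using insert l by (intro insert.IH) simp
    then have ae: "AE w in PiM I (\<lambda>_. row_law). AE z in row_law. invertible (?g (w(i := z)))"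
    proof eventually_elim
      case (elim w)
      let ?M = "gram I (\<lambda>a. w a $ 1) + gram L (\<lambda>l. axis l 1 :: real^'p)"
      have upd: "gram I (\<lambda>a. (w(i := z)) a $ 1) = gram I (\<lambda>a. w a $ 1)" for z :: "real^'p^1"
        unfolding gram_def using insert(2) by (intro sum.cong) auto
      have "gram I (\<lambda>a. w a $ 1) + gram (insert l L) (\<lambda>l. axis l 1 :: real^'p)
          = ?M + outer (axis l 1) (axis l 1)"
        using l by (simp add: gram_def)
      with elim have "invertible (?M + outer (axis l 1) (axis l 1 :: real^'p))"
        by simp
      from AE_rank_one_update_invertible[OF _ this]
      have "AE z :: real^'p^1 in lborel. invertible (?M + outer (z $ 1) (z $ 1))"
        by (simp add: pos_semidef_add pos_semidef_gram)
      moreover have "?g (w(i := z)) = ?M + outer (z $ 1) (z $ 1)" for z :: "real^'p^1"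
      proof -
        have "gram (insert i I) (\<lambda>a. (w(i := z)) a $ 1) = gram I (\<lambda>a. w a $ 1) + outer (z $ 1) (z $ 1)"
        proof -
          have "gram (insert i I) h = gram I h + outer (h i) (h i)" for h :: "nat \<Rightarrow> real^'p"
            using gram_remove[of "insert i I" i] insert(1,2) by simp
          then show ?thesis by (simp only: upd fun_upd_same)
        qed
        then show ?thesis by simp
      qed
      ultimately show ?case unfolding row_law_eq by (intro row.AE_lawI) (simp only:)
    qed
    have [measurable]: "(\<lambda>w. w a) \<in> borel_measurable (PiM (insert i I) (\<lambda>_. row_law))" if "a \<in> insert i I" for a
      using measurable_component_singleton[OF that, of "\<lambda>_. row_law"] by (simp cong: measurable_cong_sets)
    have gm[measurable]: "?g \<in> borel_measurable (PiM (insert i I) (\<lambda>_. row_law))"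
      by measurable
    have pr: "Measurable.pred (PiM (insert i I) (\<lambda>_. row_law)) (\<lambda>w. invertible (?g w))"
    proof -
      have "{A :: real^'p^'p. invertible A} \<in> sets borel" by (intro borel_open open_invertible)
      from measurable_sets[OF gm this] show ?thesis
        by (simp add: pred_def vimage_def Int_def conj_commute)
    qed
    \<comment> \<open>The null set is assembled from its sections by Tonelli.\<close>
    let ?bad = "\<lambda>w. of_bool (\<not> invertible (?g w)) :: ennreal"
    have bm: "?bad \<in> borel_measurable (PiM (insert i I) (\<lambda>_. row_law))"
      using pr by measurable
    have "(\<integral>\<^sup>+w. ?bad w \<partial>PiM (insert i I) (\<lambda>_. row_law))
        = (\<integral>\<^sup>+w. (\<integral>\<^sup>+z. ?bad (w(i := z)) \<partial>row_law) \<partial>PiM I (\<lambda>_. row_law))"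
      by (rule rows.product_nn_integral_insert[OF insert(1,2) bm])
    also have "\<dots> = (\<integral>\<^sup>+w. 0 \<partial>PiM I (\<lambda>_. row_law))"
    proof (rule nn_integral_cong_AE)
      show "AE w in PiM I (\<lambda>_. row_law). (\<integral>\<^sup>+z. ?bad (w(i := z)) \<partial>row_law) = 0"
        using ae
      proof eventually_elim
        case (elim w)
        have "(\<integral>\<^sup>+z. ?bad (w(i := z)) \<partial>row_law) = (\<integral>\<^sup>+z. 0 \<partial>row_law)"
          by (rule nn_integral_cong_AE) (use elim in eventually_elim, simp)
        then show ?case by simp
      qed
    qed
    finally have "AE w in PiM (insert i I) (\<lambda>_. row_law). ?bad w = 0"
      using nn_integral_0_iff_AE[OF bm] by simp
    then show ?thesis by eventually_elim simp
  qed
qed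

lemma AE_scatter_pos_def:
  assumes "CARD('p) \<le> n"
  shows "AE w in rows_law. pos_def (scatter w)"
proof -
  have "AE w in rows_law. invertible (gram {..<n} (\<lambda>a. w a $ 1) + gram {} (\<lambda>l. axis l 1 :: real^'p))"
    using assms by (intro AE_gram_invertible) auto
  then show ?thesis
    by eventually_elim (simp add: gram_def[of "{}"] scatter_def pos_semidef_invertible pos_semidef_gram)
qed

section \<open>The joint law of the data\<close>

sublocale joint: pair_prob_space design_law rows_law
  unfolding pair_prob_space_def pair_sigma_finite_def
  using prob_space_design_law rows.P.prob_space_axioms by (simp add: prob_space_imp_sigma_finite)

abbreviation "joint_law \<equiv> design_law \<Otimes>\<^sub>M rows_law"

lemma wishart_eq: "wishart n \<Sigma> = distr rows_law borel scatter"
proof -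
  have "transpose Z ** Z = outer (Z $ 1) (Z $ 1)" for Z :: "real^'p^1"
    by (simp add: vec_eq_iff matrix_matrix_mult_def transpose_def outer_def)
  then have "scatter = (\<lambda>Z. \<Sum>i<n. transpose (Z i) ** Z i)"
    by (simp add: fun_eq_iff scatter_def gram_def)
  then show ?thesis by (simp add: wishart_def)
qed

lemma measurable_data[measurable]:
  "(\<lambda>(X, w). (X, scatter w)) \<in> joint_law \<rightarrow>\<^sub>M borel \<Otimes>\<^sub>M borel"
  by measurable

lemma model_eq: "model n \<Theta> \<Sigma> = distr joint_law (borel \<Otimes>\<^sub>M borel) (\<lambda>(X, w). (X, scatter w))"
proof -
  have 1: "distr design_law borel (\<lambda>X. X) = design_law"
    by (rule distr_id2) simp
  have sf: "sigma_finite_measure (distr rows_law borel scatter)"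
    by (rule prob_space_imp_sigma_finite[OF rows.P.prob_space_distr[OF measurable_scatter]])
  have "(\<lambda>X. X) \<in> design_law \<rightarrow>\<^sub>M borel" by (simp cong: measurable_cong_sets)
  from pair_measure_distr[OF this measurable_scatter sf]
  show ?thesis unfolding 1 model_def wishart_eq .
qed

lemma integrable_fst_law:
  fixes f :: "_ \<Rightarrow> real"
  assumes "integrable design_law f" shows "integrable joint_law (\<lambda>(X, w). f X)"
proof -
  have [measurable]: "f \<in> borel_measurable design_law" using assms by simp
  show ?thesis
  proof (rule joint.Fubini_integrable)
    show "(\<lambda>(X, w). f X) \<in> borel_measurable joint_law" by measurable
  qed (use assms in \<open>auto simp: rows.P.prob_space\<close>)
qed

lemma integrable_snd_law:
  fixes f :: "_ \<Rightarrow> real"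
  assumes [measurable]: "integrable rows_law f" shows "integrable joint_law (\<lambda>(X, w). f w)"
proof (rule joint.Fubini_integrable)
  show "(\<lambda>(X, w). f w) \<in> borel_measurable joint_law" by measurable
qed (use assms in auto)

lemma AE_joint_pos_def:
  assumes "CARD('p) \<le> n"
  shows "AE x in joint_law. pos_def (scatter (snd x))"
proof -
  have "{A :: real^'p^'p. invertible A} \<in> sets borel" by (intro borel_open open_invertible)
  moreover have "(\<lambda>x. scatter (snd x)) \<in> borel_measurable joint_law" by measurable
  ultimately have "{x \<in> space joint_law. invertible (scatter (snd x))} \<in> sets joint_law"
    using measurable_sets[of "\<lambda>x. scatter (snd x)" joint_law borel "{A. invertible A}"]
    by (simp add: vimage_def Int_def conj_commute)
  moreover have "AE X in design_law. AE w in rows_law. invertible (scatter (snd (X, w)))"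
    using AE_scatter_pos_def[OF assms] by (auto elim!: eventually_mono simp: pos_def_invertible)
  ultimately have "AE x in joint_law. invertible (scatter (snd x))"
    by (rule joint.AE_pair_measure)
  then show ?thesis
    by eventually_elim (simp add: pos_semidef_invertible scatter_def pos_semidef_gram)
qed

end

section \<open>The risk of the shrinkage estimator\<close>

lemma cross_term_bound:
  assumes "ridge (gram I z) t eps" "finite I"
  shows "\<bar>cross_term t eps v X (gram I z)\<bar> \<le> (real (card I) + 1) * (norm v)\<^sup>2"
proof -
  interpret ridge "gram I z" X t eps by fact
  let ?y = "fit t eps v X (gram I z)"
  note tr = trace_gram_ridge_bounds[OF assms, of X]
  have a: "0 \<le> t * ((v v* X) \<bullet> ?y)" "t * ((v v* X) \<bullet> ?y) \<le> (norm v)\<^sup>2"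
    using fit_form_bounds(1,2)[of v] t by (simp_all add: field_simps)
  have b: "0 \<le> t * (?y \<bullet> (gram I z *v ?y))" "t * (?y \<bullet> (gram I z *v ?y)) \<le> (norm v)\<^sup>2"
    using S_nonneg[of ?y] fit_S_fit_le[of v] t by (simp_all add: field_simps)
  have "\<bar>trace (gram I z ** P) * ((norm v)\<^sup>2 - t * ((v v* X) \<bullet> ?y))\<bar> \<le> real (card I) * (norm v)\<^sup>2"
    unfolding abs_mult using tr a by (intro mult_mono) auto
  then show ?thesis using b unfolding cross_term_def distrib_right by linarith
qed

lemma energy_term_bound:
  fixes z :: "'i \<Rightarrow> real^'p"
  assumes "ridge (gram I z) t eps" "finite I"
  shows "\<bar>energy_term n t eps v X (gram I z)\<bar> \<le> (real n + real CARD('p) + 3 + 2 * real (card I)) * ((norm v)\<^sup>2 / t)"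
proof -
  interpret ridge "gram I z" X t eps by fact
  let ?y = "fit t eps v X (gram I z)" and ?c = "(norm v)\<^sup>2 / t"
  note tr = trace_gram_ridge_bounds[OF assms, of X]
  have b: "0 \<le> ?y \<bullet> (gram I z *v ?y)" "?y \<bullet> (gram I z *v ?y) \<le> ?c"
    by (rule S_nonneg, rule fit_S_fit_le)
  have g: "0 \<le> (gram I z *v ?y) \<bullet> (P *v (gram I z *v ?y))" "(gram I z *v ?y) \<bullet> (P *v (gram I z *v ?y)) \<le> ?c"
    using P_nonneg fit_form_bounds(4)[of v] b(2) by auto
  have "\<bar>(real n + real CARD('p) + 1 - 2 * trace (gram I z ** P)) * (?y \<bullet> (gram I z *v ?y))\<bar>
      \<le> (real n + real CARD('p) + 1 + 2 * real (card I)) * ?c"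
    unfolding abs_mult using tr b by (intro mult_mono) auto
  moreover have "(real n + real CARD('p) + 3 + 2 * real (card I)) * ?c
      = (real n + real CARD('p) + 1 + 2 * real (card I)) * ?c + 2 * ?c" by (simp add: algebra_simps)
  ultimately show ?thesis using g unfolding energy_term_def by linarith
qed

lemma tendsto_ridge_inv:
  fixes S :: "real^'p^'p" and X :: "real^'p^'m"
  assumes "pos_def S" "0 < t" "eps \<longlonglongrightarrow> 0"
  shows "(\<lambda>j. ridge_inv t (eps j) X S) \<longlonglongrightarrow> ridge_inv t 0 X S"
proof -
  interpret ridge S X t 0
    using assms by unfold_locales (auto intro: pos_def_imp_pos_semidef)
  have "(\<lambda>j. ridge_matrix t (eps j) X S) \<longlonglongrightarrow> ridge_matrix t 0 X S"
    unfolding ridge_matrix_def using assms(3) by (intro tendsto_intros)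
  then show ?thesis
    unfolding ridge_inv_def by (rule isCont_tendsto_compose[OF isCont_matrix_inv[OF invertible_Q]])
qed

lemmas tendsto_matrix_vector_mult = bounded_bilinear.tendsto[OF bounded_bilinear_matrix_vector_mult]

lemma tendsto_stein_terms:
  fixes S :: "real^'p^'p" and X :: "real^'p^'m"
  assumes "pos_def S" "0 < t" "eps \<longlonglongrightarrow> 0"
  shows "(\<lambda>j. fit t (eps j) v X S) \<longlonglongrightarrow> fit t 0 v X S"
    and "(\<lambda>j. cross_term t (eps j) v X S) \<longlonglongrightarrow> cross_term t 0 v X S"
    and "(\<lambda>j. energy_term n t (eps j) v X S) \<longlonglongrightarrow> energy_term n t 0 v X S"
  unfolding cross_term_def energy_term_def fit_def
  by (intro tendsto_diff tendsto_mult tendsto_inner tendsto_const tendsto_matrix_vector_mult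
      bounded_linear.tendsto[OF linear_conv_bounded_linear[THEN iffD1, OF linear_trace]]
      bounded_bilinear.tendsto[OF bounded_bilinear_matrix_mult] tendsto_ridge_inv assms)+

context normal_model begin

definition residual :: "real^'m \<Rightarrow> real^'p^'m \<Rightarrow> real^'p" where
  "residual v X = v v* (X - \<Theta>)"

text \<open>The form at \<open>v\<close> of the matrix loss of \<open>X - k X P S\<close>.\<close>

definition shrunk_form :: "real \<Rightarrow> real \<Rightarrow> real \<Rightarrow> real^'m \<Rightarrow> real^'p^'m \<Rightarrow> real^'p^'p \<Rightarrow> real" where
  "shrunk_form t eps k v X S =
     (residual v X - k *\<^sub>R (S *v fit t eps v X S)) \<bullet> (K *v (residual v X - k *\<^sub>R (S *v fit t eps v X S)))"

lemma measurable_residual[measurable]: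
  assumes "f \<in> borel_measurable M"
  shows "(\<lambda>x. residual v (f x)) \<in> borel_measurable M"
  unfolding residual_def
  by (intro borel_measurable_vector_matrix borel_measurable_diff assms borel_measurable_const)

lemma integrable_residual: "integrable design_law (\<lambda>X. (norm (residual v X))\<^sup>2)"
proof -
  have "linear (\<lambda>Y :: real^'p^'m. v v* Y)"
    by (rule linearI) (simp_all add: vec_eq_iff vector_matrix_mult_def sum.distrib sum_distrib_left algebra_simps)
  then obtain c where c: "0 \<le> c" "\<And>Y :: real^'p^'m. norm (v v* Y) \<le> norm Y * c"
    using bounded_linear.nonneg_bounded linear_conv_bounded_linear by blast
  have "integrable design.law (\<lambda>X. (norm (residual v X))\<^sup>2)"
  proof (rule design.integrable_law_quadratic_growth)
    show "\<bar>(norm (residual v X))\<^sup>2\<bar> \<le> c\<^sup>2 * (1 + (norm (X - \<Theta>))\<^sup>2)" for X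
    proof -
      have "(norm (residual v X))\<^sup>2 \<le> (norm (X - \<Theta>) * c)\<^sup>2"
        unfolding residual_def by (intro power_mono c) auto
      then show ?thesis by (simp add: power_mult_distrib algebra_simps add_increasing)
    qed
  qed measurable
  then show ?thesis by (simp add: design_law_eq)
qed

lemma measurable_design_ident: "(\<lambda>X. X) \<in> borel_measurable design_law"
  by (simp cong: measurable_cong_sets)

lemma integrable_residual_form: "integrable joint_law (\<lambda>(X, w). residual v X \<bullet> (K *v residual v X))"
proof -
  obtain \<kappa> where \<kappa>: "0 \<le> \<kappa>" "\<And>x y. \<bar>x \<bullet> (K *v y)\<bar> \<le> \<kappa> * (norm x * norm y)" by (rule K_bound) blast
  have "integrable design_law (\<lambda>X. residual v X \<bullet> (K *v residual v X))"
  proof (rule Bochner_Integration.integrable_bound)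
    show "integrable design_law (\<lambda>X. \<kappa> * (norm (residual v X))\<^sup>2)"
      by (intro integrable_mult_right integrable_residual)
    show "AE X in design_law. norm (residual v X \<bullet> (K *v residual v X)) \<le> norm (\<kappa> * (norm (residual v X))\<^sup>2)"
      using \<kappa> by (simp add: power2_eq_square)
  qed (intro borel_measurable_inner borel_measurable_bilinear[OF bounded_bilinear_matrix_vector_mult]
      measurable_residual borel_measurable_const measurable_design_ident)
  then show ?thesis by (rule integrable_fst_law)
qed

text \<open>Up to a constant factor this bounds every term of the loss form, uniformly in \<open>eps\<close>.\<close>

definition dominating :: "real^'m \<Rightarrow> (real^'p^'m) \<times> (nat \<Rightarrow> real^'p^1) \<Rightarrow> real" where
  "dominating v = (\<lambda>(X, w). (norm (residual v X))\<^sup>2 + trace (scatter w))"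

lemma integrable_dominating: "integrable joint_law (dominating v)"
  using Bochner_Integration.integrable_add[OF integrable_fst_law[OF integrable_residual[of v]]
      integrable_snd_law[OF integrable_trace_scatter]]
  by (simp add: dominating_def case_prod_beta')

lemma ridge_scatter: "0 < t \<Longrightarrow> 0 \<le> eps \<Longrightarrow> 0 < eps \<or> pos_def (scatter w) \<Longrightarrow> ridge (scatter w) t eps"
  unfolding scatter_def by unfold_locales (auto simp: pos_semidef_gram)

lemma trace_scatter_nonneg: "0 \<le> trace (scatter w)"
  unfolding scatter_def trace_gram by (intro sum_nonneg) auto

lemma form_bounds:
  assumes "0 < t"
  obtains C where "0 \<le> C"
    "\<And>eps X w. ridge (scatter w) t eps \<Longrightarrow> \<bar>residual v X \<bullet> (K *v (scatter w *v fit t eps v X (scatter w)))\<bar> \<le> C * dominating v (X, w)"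
    "\<And>eps X w. ridge (scatter w) t eps \<Longrightarrow> \<bar>(scatter w *v fit t eps v X (scatter w)) \<bullet> (K *v (scatter w *v fit t eps v X (scatter w)))\<bar> \<le> C * dominating v (X, w)"
    "\<And>eps X w. ridge (scatter w) t eps \<Longrightarrow> \<bar>shrunk_form t eps k v X (scatter w)\<bar> \<le> C * dominating v (X, w)"
proof -
  obtain \<kappa> where \<kappa>: "0 \<le> \<kappa>" "\<And>x y. \<bar>x \<bullet> (K *v y)\<bar> \<le> \<kappa> * (norm x * norm y)" by (rule K_bound) blast
  define c where "c = (norm v)\<^sup>2 / t"
  have c0: "0 \<le> c" using assms by (simp add: c_def)
  define C where "C = \<kappa> * (1 + c) + \<kappa> * (2 + 2 * k\<^sup>2 * c)"
  have C0: "0 \<le> C" using \<kappa> c0 by (simp add: C_def)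
  have le: "\<kappa> * (1 + c) \<le> C" "\<kappa> * (2 + 2 * k\<^sup>2 * c) \<le> C" using \<kappa> c0 by (auto simp: C_def)
  {
    fix eps X w assume r: "ridge (scatter w) t eps"
    let ?x = "residual v X" and ?s = "scatter w *v fit t eps v X (scatter w)"
    have tr: "0 \<le> trace (scatter w)" by (rule trace_scatter_nonneg)
    have D0: "0 \<le> dominating v (X, w)" using tr by (simp add: dominating_def)
    have s: "(norm ?s)\<^sup>2 \<le> trace (scatter w) * c"
      using norm_S_fit_le[OF r[unfolded scatter_def]] by (simp add: scatter_def c_def)
    have s1: "(norm ?x)\<^sup>2 + (norm ?s)\<^sup>2 \<le> (1 + c) * dominating v (X, w)"
      using s tr mult_nonneg_nonneg[OF c0 zero_le_power2[of "norm ?x"]]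
      by (simp add: dominating_def algebra_simps)
    have up: "a \<le> C * dominating v (X, w)" if "a \<le> \<kappa> * b" "b \<le> d * dominating v (X, w)" "\<kappa> * d \<le> C" for a b d
    proof -
      have "a \<le> \<kappa> * (d * dominating v (X, w))" using that \<kappa>(1) by (meson mult_left_mono order_trans)
      also have "\<dots> \<le> C * dominating v (X, w)" using mult_right_mono[OF that(3) D0] by (simp add: mult.assoc)
      finally show ?thesis .
    qed
    have "0 \<le> (norm ?x - norm ?s)\<^sup>2" by simp
    moreover have "0 \<le> norm ?x * norm ?s" by simp
    ultimately have am: "norm ?x * norm ?s \<le> (norm ?x)\<^sup>2 + (norm ?s)\<^sup>2"
      unfolding power2_diff by linarith
    have 1: "\<bar>?x \<bullet> (K *v ?s)\<bar> \<le> C * dominating v (X, w)"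
      by (rule up[OF \<kappa>(2) order_trans[OF am s1] le(1)])
    have "norm ?s * norm ?s \<le> (norm ?x)\<^sup>2 + (norm ?s)\<^sup>2" by (simp add: power2_eq_square)
    then have 2: "\<bar>?s \<bullet> (K *v ?s)\<bar> \<le> C * dominating v (X, w)"
      by (rule up[OF \<kappa>(2) order_trans[OF _ s1] le(1)])
    have "norm (?x - k *\<^sub>R ?s) \<le> norm ?x + \<bar>k\<bar> * norm ?s"
      using norm_triangle_ineq4[of ?x "k *\<^sub>R ?s"] by simp
    then have "(norm (?x - k *\<^sub>R ?s))\<^sup>2 \<le> (norm ?x + \<bar>k\<bar> * norm ?s)\<^sup>2" by (intro power_mono) auto
    also have "\<dots> \<le> 2 * (norm ?x)\<^sup>2 + 2 * (\<bar>k\<bar> * norm ?s)\<^sup>2"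
      using zero_le_power2[of "norm ?x - \<bar>k\<bar> * norm ?s"] by (simp add: power2_sum power2_diff)
    also have "\<dots> = 2 * (norm ?x)\<^sup>2 + 2 * k\<^sup>2 * (norm ?s)\<^sup>2" by (simp add: power_mult_distrib)
    also have "\<dots> \<le> 2 * (norm ?x)\<^sup>2 + 2 * k\<^sup>2 * (trace (scatter w) * c)"
      by (intro add_left_mono mult_left_mono s) auto
    also have "\<dots> \<le> (2 + 2 * k\<^sup>2 * c) * dominating v (X, w)"
      using tr c0 by (simp add: dominating_def algebra_simps add_increasing)
    finally have "norm (?x - k *\<^sub>R ?s) * norm (?x - k *\<^sub>R ?s) \<le> (2 + 2 * k\<^sup>2 * c) * dominating v (X, w)"
      by (simp only: power2_eq_square[of "norm (?x - k *\<^sub>R ?s)"])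
    then have 3: "\<bar>shrunk_form t eps k v X (scatter w)\<bar> \<le> C * dominating v (X, w)"
      unfolding shrunk_form_def by (rule up[OF \<kappa>(2) _ le(2)])
    note 1 2 3
  }
  then show ?thesis using that C0 by blast
qed

lemma cross_scatter_bound:
  assumes "ridge (scatter w) t eps"
  shows "\<bar>cross_term t eps v X (scatter w)\<bar> \<le> (real n + 1) * (norm v)\<^sup>2"
  using cross_term_bound[OF assms[unfolded scatter_def]] by (simp add: scatter_def)

lemma energy_scatter_bound:
  assumes "ridge (scatter w) t eps"
  shows "\<bar>energy_term n t eps v X (scatter w)\<bar> \<le> (real n + real CARD('p) + 3 + 2 * real n) * ((norm v)\<^sup>2 / t)"
  using energy_term_bound[OF assms[unfolded scatter_def], of n v X] by (simp add: scatter_def)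

lemma integrable_by_dominating:
  fixes f :: "_ \<Rightarrow> real"
  assumes "f \<in> borel_measurable joint_law" "\<And>X w. \<bar>f (X, w)\<bar> \<le> C * dominating v (X, w)"
  shows "integrable joint_law f"
proof (rule Bochner_Integration.integrable_bound[OF integrable_mult_right[OF integrable_dominating, of C v]])
  show "AE x in joint_law. norm (f x) \<le> norm (C * dominating v x)"
  proof (rule AE_I2)
    fix x show "norm (f x) \<le> norm (C * dominating v x)"
      using assms(2)[of "fst x" "snd x"] by simp
  qed
qed fact

text \<open>The integrand of the risk difference between \<open>X\<close> and the shrinkage estimator, at \<open>v\<close>.\<close>

definition gain :: "real \<Rightarrow> real \<Rightarrow> real \<Rightarrow> real^'m \<Rightarrow> real^'p^'m \<Rightarrow> real^'p^'p \<Rightarrow> real" where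
  "gain t eps k v X S = 2 * k * cross_term t eps v X S - k\<^sup>2 * energy_term n t eps v X S"

text \<open>The loss form is expanded into three terms; Stein's identity in \<open>X\<close> treats the mixed one and Stein's
identity in the rows the last one.\<close>

lemma regularised_risk:
  assumes t0: "0 < t" and eps0: "0 < eps"
  shows "(\<integral>(X, w). shrunk_form t eps k v X (scatter w) \<partial>joint_law)
    = (\<integral>(X, w). residual v X \<bullet> (K *v residual v X) \<partial>joint_law)
      - (\<integral>(X, w). gain t eps k v X (scatter w) \<partial>joint_law)"
proof -
  let ?s = "\<lambda>X w. scatter w *v fit t eps v X (scatter w)"
  have r: "ridge (scatter w) t eps" for w using ridge_scatter t0 eps0 by simp
  obtain C where C:
    "\<And>X w. \<bar>residual v X \<bullet> (K *v ?s X w)\<bar> \<le> C * dominating v (X, w)"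
    "\<And>X w. \<bar>?s X w \<bullet> (K *v ?s X w)\<bar> \<le> C * dominating v (X, w)"
    by (rule form_bounds[OF t0, where v=v and k=k]) (use r in blast)
  have i1: "integrable joint_law (\<lambda>(X, w). residual v X \<bullet> (K *v ?s X w))"
    by (rule integrable_by_dominating[where C=C and v=v]) (measurable, use C in simp)
  have i2: "integrable joint_law (\<lambda>(X, w). ?s X w \<bullet> (K *v ?s X w))"
    by (rule integrable_by_dominating[where C=C and v=v]) (measurable, use C in simp)
  have i3: "integrable joint_law (\<lambda>(X, w). cross_term t eps v X (scatter w))"
  proof (rule joint.integrable_const_bound[of _ "(real n + 1) * (norm v)\<^sup>2"])
    show "AE x in joint_law. norm (case x of (X, w) \<Rightarrow> cross_term t eps v X (scatter w)) \<le> (real n + 1) * (norm v)\<^sup>2"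
      unfolding real_norm_def case_prod_beta by (rule AE_I2) (rule cross_scatter_bound[OF r])
  qed measurable
  have i4: "integrable joint_law (\<lambda>(X, w). energy_term n t eps v X (scatter w))"
  proof (rule joint.integrable_const_bound[of _ "(real n + real CARD('p) + 3 + 2 * real n) * ((norm v)\<^sup>2 / t)"])
    show "AE x in joint_law. norm (case x of (X, w) \<Rightarrow> energy_term n t eps v X (scatter w))
        \<le> (real n + real CARD('p) + 3 + 2 * real n) * ((norm v)\<^sup>2 / t)"
      unfolding real_norm_def case_prod_beta by (rule AE_I2) (rule energy_scatter_bound[OF r])
  qed measurable
  have e1: "(\<integral>(X, w). residual v X \<bullet> (K *v ?s X w) \<partial>joint_law) = (\<integral>(X, w). cross_term t eps v X (scatter w) \<partial>joint_law)"
    unfolding joint.integral_snd[OF i1, symmetric] joint.integral_snd[OF i3, symmetric]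
    unfolding residual_def
    by (intro Bochner_Integration.integral_cong refl expectation_cross t0 eps0)
      (simp add: scatter_def pos_semidef_gram)
  have e2: "(\<integral>(X, w). ?s X w \<bullet> (K *v ?s X w) \<partial>joint_law) = (\<integral>(X, w). energy_term n t eps v X (scatter w) \<partial>joint_law)"
    unfolding joint.integral_fst[OF i2, symmetric] joint.integral_fst[OF i4, symmetric]
    by (intro Bochner_Integration.integral_cong refl expectation_energy t0 eps0)
  have "shrunk_form t eps k v X (scatter w) = residual v X \<bullet> (K *v residual v X)
      - 2 * k * (residual v X \<bullet> (K *v ?s X w)) + k\<^sup>2 * (?s X w \<bullet> (K *v ?s X w))" for X w
  proof -
    have "?s X w \<bullet> (K *v residual v X) = residual v X \<bullet> (K *v ?s X w)"
      using inner_matrix_mult_transpose[OF K_sym, of "residual v X" "?s X w"] by (simp add: inner_commute)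
    then show ?thesis
      by (simp add: shrunk_form_def matrix_vector_mult_diff_distrib matrix_vector_mult_scaleR
          inner_diff_left inner_diff_right power2_eq_square algebra_simps)
  qed
  then have "(\<integral>(X, w). shrunk_form t eps k v X (scatter w) \<partial>joint_law)
    = (\<integral>x. (case x of (X, w) \<Rightarrow> residual v X \<bullet> (K *v residual v X))
      - 2 * k * (case x of (X, w) \<Rightarrow> residual v X \<bullet> (K *v ?s X w))
      + k\<^sup>2 * (case x of (X, w) \<Rightarrow> ?s X w \<bullet> (K *v ?s X w)) \<partial>joint_law)"
    by (intro Bochner_Integration.integral_cong refl) (auto split: prod.split)
  also have "\<dots> = (\<integral>(X, w). residual v X \<bullet> (K *v residual v X) \<partial>joint_law)
      - 2 * k * (\<integral>(X, w). cross_term t eps v X (scatter w) \<partial>joint_law)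
      + k\<^sup>2 * (\<integral>(X, w). energy_term n t eps v X (scatter w) \<partial>joint_law)"
    unfolding e1[symmetric] e2[symmetric] using integrable_residual_form[of v] i1 i2 by simp
  also have "\<dots> = (\<integral>(X, w). residual v X \<bullet> (K *v residual v X) \<partial>joint_law)
      - (\<integral>x. 2 * k * (case x of (X, w) \<Rightarrow> cross_term t eps v X (scatter w))
          - k\<^sup>2 * (case x of (X, w) \<Rightarrow> energy_term n t eps v X (scatter w)) \<partial>joint_law)"
    using i3 i4 by simp
  also have "(\<integral>x. 2 * k * (case x of (X, w) \<Rightarrow> cross_term t eps v X (scatter w))
          - k\<^sup>2 * (case x of (X, w) \<Rightarrow> energy_term n t eps v X (scatter w)) \<partial>joint_law)
      = (\<integral>(X, w). gain t eps k v X (scatter w) \<partial>joint_law)"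
    by (intro Bochner_Integration.integral_cong refl) (auto simp: gain_def split: prod.split)
  finally show ?thesis .
qed

lemma measurable_shrunk_form_gain[measurable]:
  "(\<lambda>(X, w). shrunk_form t eps k v X (scatter w)) \<in> borel_measurable joint_law"
  "(\<lambda>(X, w). gain t eps k v X (scatter w)) \<in> borel_measurable joint_law"
  unfolding shrunk_form_def gain_def by measurable

text \<open>Limit of \<open>regularised_risk\<close> along \<open>eps = 1 / (j + 1)\<close>. On the almost sure event that \<open>S\<close> is positive definite
all integrands converge; the loss forms have a common integrable bound and the gains a common
constant one.\<close>

lemma risk_formula:
  assumes n: "CARD('p) \<le> n" and t0: "0 < t"
  shows "integrable joint_law (\<lambda>(X, w). shrunk_form t 0 k v X (scatter w))"
    and "integrable joint_law (\<lambda>(X, w). gain t 0 k v X (scatter w))"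
    and "(\<integral>(X, w). shrunk_form t 0 k v X (scatter w) \<partial>joint_law)
      = (\<integral>(X, w). residual v X \<bullet> (K *v residual v X) \<partial>joint_law)
        - (\<integral>(X, w). gain t 0 k v X (scatter w) \<partial>joint_law)"
proof -
  define eps where "eps = (\<lambda>j. inverse (real (Suc j)))"
  have e: "eps \<longlonglongrightarrow> 0" unfolding eps_def by (rule LIMSEQ_inverse_real_of_nat)
  have epos: "0 < eps j" for j by (simp add: eps_def)
  have r: "ridge (scatter w) t (eps j)" for w j using ridge_scatter t0 epos by (simp add: less_imp_le)
  obtain C where C: "\<And>j X w. \<bar>shrunk_form t (eps j) k v X (scatter w)\<bar> \<le> C * dominating v (X, w)"
    by (rule form_bounds[OF t0, where v=v and k=k]) (use r in blast)
  define B where "B = \<bar>2 * k\<bar> * ((real n + 1) * (norm v)\<^sup>2)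
      + k\<^sup>2 * ((real n + real CARD('p) + 3 + 2 * real n) * ((norm v)\<^sup>2 / t))"
  have gb: "\<bar>gain t (eps j) k v X (scatter w)\<bar> \<le> B" for j X w
  proof -
    have "\<bar>gain t (eps j) k v X (scatter w)\<bar>
        \<le> \<bar>2 * k\<bar> * \<bar>cross_term t (eps j) v X (scatter w)\<bar> + k\<^sup>2 * \<bar>energy_term n t (eps j) v X (scatter w)\<bar>"
      unfolding gain_def abs_mult[symmetric] using abs_triangle_ineq4 by (metis abs_mult abs_power2)
    also have "\<dots> \<le> B"
      unfolding B_def
      by (intro add_mono mult_left_mono cross_scatter_bound energy_scatter_bound r) auto
    finally show ?thesis .
  qed
  have ae: "AE x in joint_law. pos_def (scatter (snd x))" by (rule AE_joint_pos_def[OF n])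
  have lim1: "AE x in joint_law. (\<lambda>j. case x of (X, w) \<Rightarrow> shrunk_form t (eps j) k v X (scatter w))
      \<longlonglongrightarrow> (case x of (X, w) \<Rightarrow> shrunk_form t 0 k v X (scatter w))"
    using ae
  proof eventually_elim
    case (elim x)
    then show ?case
      unfolding shrunk_form_def case_prod_beta
      by (intro tendsto_inner tendsto_diff tendsto_scaleR tendsto_const tendsto_matrix_vector_mult tendsto_stein_terms(1) t0 e)
  qed
  have lim2: "AE x in joint_law. (\<lambda>j. case x of (X, w) \<Rightarrow> gain t (eps j) k v X (scatter w))
      \<longlonglongrightarrow> (case x of (X, w) \<Rightarrow> gain t 0 k v X (scatter w))"
    using ae
  proof eventually_elim
    case (elim x)
    then show ?case
      unfolding gain_def case_prod_beta
      by (intro tendsto_diff tendsto_mult tendsto_const tendsto_stein_terms(2,3) t0 e)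
  qed
  have dom1: "AE x in joint_law. norm (case x of (X, w) \<Rightarrow> shrunk_form t (eps j) k v X (scatter w)) \<le> C * dominating v x" for j
    using C by (auto intro!: AE_I2)
  have dom2: "AE x in joint_law. norm (case x of (X, w) \<Rightarrow> gain t (eps j) k v X (scatter w)) \<le> B" for j
    using gb by (auto intro!: AE_I2)
  have idom: "integrable joint_law (\<lambda>x. C * dominating v x)" by (intro integrable_mult_right integrable_dominating)
  have iB: "integrable joint_law (\<lambda>x. B)" by simp
  show "integrable joint_law (\<lambda>(X, w). shrunk_form t 0 k v X (scatter w))"
    by (rule integrable_dominated_convergence[OF _ _ idom lim1 dom1]) measurable
  show "integrable joint_law (\<lambda>(X, w). gain t 0 k v X (scatter w))"
    by (rule integrable_dominated_convergence[OF _ _ iB lim2 dom2]) measurable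
  have L1: "(\<lambda>j. \<integral>(X, w). shrunk_form t (eps j) k v X (scatter w) \<partial>joint_law)
      \<longlonglongrightarrow> (\<integral>(X, w). shrunk_form t 0 k v X (scatter w) \<partial>joint_law)"
    by (rule integral_dominated_convergence[OF _ _ idom lim1 dom1]) measurable
  have L2: "(\<lambda>j. \<integral>(X, w). gain t (eps j) k v X (scatter w) \<partial>joint_law)
      \<longlonglongrightarrow> (\<integral>(X, w). gain t 0 k v X (scatter w) \<partial>joint_law)"
    by (rule integral_dominated_convergence[OF _ _ iB lim2 dom2]) measurable
  have "(\<integral>(X, w). shrunk_form t (eps j) k v X (scatter w) \<partial>joint_law)
      = (\<integral>(X, w). residual v X \<bullet> (K *v residual v X) \<partial>joint_law)
        - (\<integral>(X, w). gain t (eps j) k v X (scatter w) \<partial>joint_law)" for j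
    by (rule regularised_risk[OF t0 epos])
  then have "(\<lambda>j. \<integral>(X, w). shrunk_form t (eps j) k v X (scatter w) \<partial>joint_law)
      \<longlonglongrightarrow> (\<integral>(X, w). residual v X \<bullet> (K *v residual v X) \<partial>joint_law)
        - (\<integral>(X, w). gain t 0 k v X (scatter w) \<partial>joint_law)"
    by (simp only:) (intro tendsto_diff tendsto_const L2)
  with L1 show "(\<integral>(X, w). shrunk_form t 0 k v X (scatter w) \<partial>joint_law)
      = (\<integral>(X, w). residual v X \<bullet> (K *v residual v X) \<partial>joint_law)
        - (\<integral>(X, w). gain t 0 k v X (scatter w) \<partial>joint_law)"
    by (rule LIMSEQ_unique)
qed

end

section \<open>Positivity of the gain\<close>

lemma design_gram: "transpose X ** X = gram UNIV (\<lambda>i. X $ i)" for X :: "real^'p^'m"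
proof -
  have "(\<Sum>i\<in>UNIV. outer (X $ i) (X $ i)) $ j $ l = (\<Sum>i\<in>UNIV. X $ i $ j * X $ i $ l)" for j l
    by (simp add: outer_def)
  then show ?thesis
    by (simp add: vec_eq_iff gram_def matrix_matrix_mult_def transpose_def)
qed

lemma axis_vector_matrix: "axis i 1 v* X = X $ i" for X :: "real^'p^'m"
proof -
  have "X $ j $ l * axis i 1 $ j = (if j = i then X $ j $ l else 0)" for j l
    by (simp add: axis_def)
  then show ?thesis
    by (simp add: vec_eq_iff vector_matrix_mult_def mult.commute)
qed

context ridge begin

lemma trace_S_P:
  assumes "eps = 0"
  shows "trace (S ** P) = real CARD('p) - t * (\<Sum>i\<in>UNIV. X $ i \<bullet> (P *v X $ i))"
proof -
  have "S = Q - t *\<^sub>R (transpose X ** X)" using assms by (simp add: ridge_matrix_def)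
  then have "S ** P = Q ** P - t *\<^sub>R ((transpose X ** X) ** P)"
    by (metis matrix_mult_diff_left matrix_mult_scaleR_left)
  then have "trace (S ** P) = trace (mat 1 :: real^'p^'p) - t * trace ((transpose X ** X) ** P)"
    by (simp add: Q_P_matrix trace_sub linear_cmul[OF linear_trace])
  then show ?thesis by (simp add: trace_I design_gram trace_gram_mult)
qed

text \<open>The trace is \<open>p\<close> minus the sum of the \<open>t (x\<^sub>i \<bullet> P x\<^sub>i)\<close>; each of these is at most \<open>1\<close>, and there are \<open>m\<close> rows \<open>x\<^sub>i\<close> of \<open>X\<close>.\<close>

lemma trace_S_P_ge:
  assumes "eps = 0"
  shows "real CARD('p) - real CARD('m) \<le> trace (S ** P)"
proof -
  have "(\<Sum>i\<in>UNIV. X $ i \<bullet> (P *v X $ i)) \<le> (\<Sum>i\<in>(UNIV :: 'm set). 1 / t)"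
    using P_form_design[of "axis _ 1"] by (intro sum_mono) (simp add: axis_vector_matrix)
  then have "t * (\<Sum>i\<in>UNIV. X $ i \<bullet> (P *v X $ i)) \<le> real CARD('m)"
    using t by (simp add: field_simps)
  then show ?thesis unfolding trace_S_P[OF assms] by simp
qed

text \<open>For the symmetric matrix \<open>H = I - t X P X\<^sup>T\<close> the equation says \<open>v \<bullet> H v - v \<bullet> (H - H\<^sup>2) v = |H v|\<^sup>2\<close>; the
second part says that \<open>H\<close> is injective.\<close>

lemma hat_complement_form:
  fixes v :: "real^'m"
  assumes "eps = 0"
  defines "y \<equiv> fit t 0 v X S"
  shows "((norm v)\<^sup>2 - t * ((v v* X) \<bullet> y)) - t * (y \<bullet> (S *v y)) = (norm (v - t *\<^sub>R (X *v y)))\<^sup>2"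
    and "pos_def S \<Longrightarrow> v \<noteq> 0 \<Longrightarrow> v - t *\<^sub>R (X *v y) \<noteq> 0"
proof -
  have y: "y = P *v (v v* X)" using assms by (simp add: fit_def)
  have u: "(v v* X) \<bullet> y = v \<bullet> (X *v y)" by (rule dot_lmul_matrix)
  have "y \<bullet> (Q *v y) = (v v* X) \<bullet> y" by (simp add: y Q_P inner_commute)
  then have "y \<bullet> (S *v y) + t * ((X *v y) \<bullet> (X *v y)) = v \<bullet> (X *v y)"
    unfolding ridge_matrix_form u using assms by (simp add: power2_norm_eq_inner)
  then have b: "y \<bullet> (S *v y) = v \<bullet> (X *v y) - t * ((X *v y) \<bullet> (X *v y))" by simp
  show "((norm v)\<^sup>2 - t * ((v v* X) \<bullet> y)) - t * (y \<bullet> (S *v y)) = (norm (v - t *\<^sub>R (X *v y)))\<^sup>2"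
    unfolding u b power2_norm_eq_inner
    by (simp add: inner_diff_left inner_diff_right inner_commute algebra_simps)
  show "v - t *\<^sub>R (X *v y) \<noteq> 0" if "pos_def S" "v \<noteq> 0"
  proof
    assume "v - t *\<^sub>R (X *v y) = 0"
    then have v: "v = t *\<^sub>R (X *v y)" by simp
    then have "v \<bullet> (X *v y) = t * ((X *v y) \<bullet> (X *v y))" by (metis inner_scaleR_left)
    then have "y \<bullet> (S *v y) = 0" using b by simp
    then have "y = 0" using that(1) unfolding pos_def_def by (metis less_irrefl)
    then show False using v that(2) by simp
  qed
qed

end

text \<open>With \<open>t = 1 - k\<close> and \<open>T = \<tau> - (p - m)\<close>, the expression is \<open>k\<close> times
\<open>2 (\<eta> - t \<beta>) + (2 (p - m - 1) \<eta> - k (n - p + 2 m + 1) \<beta>) + 2 T \<eta> + 2 k T \<beta> + 2 k \<gamma>\<close>. Hypothesis \<open>c\<close> is exactly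
\<open>k (n - p + 2 m + 1) \<le> 2 t (p - m - 1)\<close>, which together with \<open>t \<beta> < \<eta>\<close> makes the bracket nonnegative.\<close>

lemma wide_arithmetic:
  fixes k \<tau> \<eta> \<beta> \<gamma> n p m :: real
  assumes k: "0 < k" "k < 1" and \<beta>: "0 \<le> \<beta>" "(1 - k) * \<beta> < \<eta>" and \<gamma>: "0 \<le> \<gamma>"
    and \<tau>: "p - m \<le> \<tau>" and pm: "m + 1 \<le> p" and c: "k * (n + p - 1) \<le> 2 * (p - m - 1)"
  shows "0 < 2 * k * (\<tau> * \<eta> - (1 - k) * \<beta>) - k\<^sup>2 * ((n + p + 1 - 2 * \<tau>) * \<beta> - 2 * \<gamma>)"
proof -
  define t where "t = 1 - k"
  define T where "T = \<tau> - (p - m)"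
  have t: "0 < t" using k by (simp add: t_def)
  have \<eta>: "0 \<le> \<eta>"
    using mult_nonneg_nonneg[OF less_imp_le[OF t] \<beta>(1)] \<beta>(2) unfolding t_def by linarith
  have "k * (n - p + 2 * m + 1) \<le> 2 * t * (p - m - 1)"
    using c by (simp add: t_def algebra_simps)
  then have "k * (n - p + 2 * m + 1) * \<beta> \<le> 2 * t * (p - m - 1) * \<beta>" using \<beta>(1) by (rule mult_right_mono)
  also have "\<dots> = 2 * (p - m - 1) * (t * \<beta>)" by simp
  also have "\<dots> \<le> 2 * (p - m - 1) * \<eta>" using \<beta>(2) pm by (intro mult_left_mono) (auto simp: t_def)
  finally have 1: "k * (n - p + 2 * m + 1) * \<beta> \<le> 2 * (p - m - 1) * \<eta>" .
  have "0 \<le> T * \<eta>" "0 \<le> k * T * \<beta>" "0 \<le> k * \<gamma>"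
    using \<tau> \<eta> \<beta> \<gamma> k by (simp_all add: T_def)
  then have "0 < 2 * (\<eta> - t * \<beta>) + (2 * (p - m - 1) * \<eta> - k * (n - p + 2 * m + 1) * \<beta>) + 2 * (T * \<eta>) + 2 * (k * T * \<beta>) + 2 * (k * \<gamma>)"
    using 1 \<beta>(2) by (simp add: t_def)
  also have "\<dots> = 2 * (\<tau> * \<eta> - t * \<beta>) - k * ((n + p + 1 - 2 * \<tau>) * \<beta> - 2 * \<gamma>)"
    by (simp add: T_def algebra_simps)
  finally have "0 < k * (2 * (\<tau> * \<eta> - t * \<beta>) - k * ((n + p + 1 - 2 * \<tau>) * \<beta> - 2 * \<gamma>))"
    using k by simp
  then show ?thesis by (simp add: t_def power2_eq_square algebra_simps)
qed

text \<open>The counterpart of \<open>wide_arithmetic\<close> with \<open>\<tau>\<close> in the place of \<open>\<eta>\<close>: hypothesis \<open>c\<close> is exactly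
\<open>k (n + p + 1) \<le> 2 (1 - k) (m - p - 1)\<close>, and the square of \<open>\<tau>\<close> makes the inequality strict.\<close>

lemma tall_arithmetic:
  fixes k \<tau> \<beta> \<gamma> n p m :: real
  assumes k: "0 < k" "k < 1" and \<beta>: "0 \<le> \<beta>" "(1 - k) * \<beta> \<le> \<tau>" and \<gamma>: "0 \<le> \<gamma>"
    and \<tau>: "0 < \<tau>" and pm: "p + 1 \<le> m" and c: "k * (n - p + 2 * m - 1) \<le> 2 * (m - p - 1)"
  shows "0 < 2 * k * (\<tau> * (m - p + \<tau>) - (1 - k) * \<beta>) - k\<^sup>2 * ((n + p + 1 - 2 * \<tau>) * \<beta> - 2 * \<gamma>)"
proof -
  define t where "t = 1 - k"
  have t: "0 < t" using k by (simp add: t_def)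
  have "k * (n + p + 1) \<le> 2 * t * (m - p - 1)"
    using c by (simp add: t_def algebra_simps)
  then have "k * (n + p + 1) * \<beta> \<le> 2 * t * (m - p - 1) * \<beta>" using \<beta>(1) by (rule mult_right_mono)
  also have "\<dots> = 2 * (m - p - 1) * (t * \<beta>)" by simp
  also have "\<dots> \<le> 2 * (m - p - 1) * \<tau>" using \<beta>(2) pm by (intro mult_left_mono) (auto simp: t_def)
  finally have 1: "k * (n + p + 1) * \<beta> \<le> 2 * (m - p - 1) * \<tau>" .
  have "0 < \<tau> * \<tau>" "0 \<le> k * \<tau> * \<beta>" "0 \<le> k * \<gamma>"
    using \<tau> \<beta> \<gamma> k by simp_all
  then have "0 < 2 * (\<tau> - t * \<beta>) + (2 * (m - p - 1) * \<tau> - k * (n + p + 1) * \<beta>) + 2 * (\<tau> * \<tau>) + 2 * (k * \<tau> * \<beta>) + 2 * (k * \<gamma>)"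
    using 1 \<beta>(2) by (simp add: t_def)
  also have "\<dots> = 2 * (\<tau> * (m - p + \<tau>) - t * \<beta>) - k * ((n + p + 1 - 2 * \<tau>) * \<beta> - 2 * \<gamma>)"
    by (simp add: algebra_simps)
  finally have "0 < k * (2 * (\<tau> * (m - p + \<tau>) - t * \<beta>) - k * ((n + p + 1 - 2 * \<tau>) * \<beta> - 2 * \<gamma>))"
    using k by simp
  then show ?thesis by (simp add: t_def power2_eq_square algebra_simps)
qed

text \<open>Polarisation recovers the entries of a symmetric matrix from its quadratic form.\<close>

lemma integrable_symmetric_matrix:
  fixes f :: "'a \<Rightarrow> real^'n^'n"
  assumes sym: "\<And>x. transpose (f x) = f x" and int: "\<And>v. integrable M (\<lambda>x. v \<bullet> (f x *v v))"
  shows "integrable M f"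
proof -
  have entry: "f x $ i $ j = ((axis i 1 + axis j 1) \<bullet> (f x *v (axis i 1 + axis j 1))
      - axis i 1 \<bullet> (f x *v axis i 1) - axis j 1 \<bullet> (f x *v axis j 1)) / 2" for x i j
  proof -
    have "f x $ j $ i = f x $ i $ j"
      using arg_cong[OF sym[of x], of "\<lambda>A. A $ i $ j"] by (simp add: transpose_def)
    moreover have "axis a 1 \<bullet> (f x *v axis b 1) = f x $ a $ b" for a b
      by (simp add: inner_axis' matrix_vector_mult_basis column_def)
    ultimately show ?thesis
      by (simp add: matrix_vector_right_distrib inner_add_left inner_add_right)
  qed
  have "integrable M (\<lambda>x. f x $ i $ j)" for i j
    unfolding entry by (intro integrable_divide Bochner_Integration.integrable_diff int)
  then have "integrable M (\<lambda>x. \<Sum>i\<in>UNIV. \<Sum>j\<in>UNIV. f x $ i $ j *\<^sub>R (outer (axis i 1) (axis j 1) :: real^'n^'n))"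
    by (intro Bochner_Integration.integrable_sum integrable_scaleR_left)
  moreover have "(\<Sum>i\<in>UNIV. \<Sum>j\<in>UNIV. f x $ i $ j *\<^sub>R (outer (axis i 1) (axis j 1) :: real^'n^'n)) = f x" for x
  proof -
    have "c * (axis i 1 $ a * axis j 1 $ b) = (if j = b then (if i = a then c else 0) else 0)"
      for c :: real and i j a b :: 'n
      by (simp add: axis_def)
    then show ?thesis by (simp add: vec_eq_iff outer_def)
  qed
  ultimately show ?thesis by simp
qed

text \<open>The factor \<open>I + t S' X\<^sup>T X\<close>, with \<open>S'\<close> the inverse of \<open>S\<close>, equals \<open>S' Q\<close>, so its inverse is \<open>P S\<close>.\<close>

lemma gb_estimator_eq:
  fixes X :: "real^'p^'m"
  assumes "pos_def S" "0 < 1 - k"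
  shows "v v* (gb_estimator k X S) = v v* X - k *\<^sub>R (S *v fit (1 - k) 0 v X S)"
proof -
  let ?t = "1 - k"
  interpret ridge S X ?t 0
    using assms by unfold_locales (auto intro: pos_def_imp_pos_semidef)
  have S': "matrix_inv S ** S = mat 1" by (rule matrix_inv_inverse[OF pos_def_invertible[OF assms(1)]])
  have "mat 1 + ?t *\<^sub>R (matrix_inv S ** transpose X ** X) = matrix_inv S ** Q"
    by (simp add: ridge_matrix_def bounded_bilinear.add_right[OF bounded_bilinear_matrix_mult]
        matrix_mult_scaleR_right S' matrix_mul_assoc)
  moreover have "matrix_inv S ** Q ** (P ** S) = mat 1"
  proof -
    have "matrix_inv S ** Q ** (P ** S) = matrix_inv S ** (Q ** P) ** S" by (simp add: matrix_mul_assoc)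
    then show ?thesis by (simp add: Q_P_matrix S')
  qed
  ultimately have "matrix_inv (mat 1 + ?t *\<^sub>R (matrix_inv S ** transpose X ** X)) = P ** S"
    by (simp add: matrix_inv_eqI)
  then have gb: "gb_estimator k X S = X - k *\<^sub>R (X ** (P ** S))" by (simp add: gb_estimator_def)
  have "transpose (X ** (P ** S)) = S ** P ** transpose X"
    using S pos_def_P by (simp add: matrix_transpose_mul pos_semidef_def pos_def_def matrix_mul_assoc)
  then have "v v* (X ** (P ** S)) = S *v (P *v (v v* X))"
    by (metis matrix_vector_mul_assoc transpose_matrix_vector)
  moreover have "v v* (A - k *\<^sub>R B) = v v* A - k *\<^sub>R (v v* B)" for A B :: "real^'p^'m"
    by (simp add: vec_eq_iff vector_matrix_mult_def sum_subtractf sum_distrib_left algebra_simps)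
  ultimately show ?thesis by (simp add: gb fit_def)
qed

lemma matrix_loss_form:
  "v \<bullet> (matrix_loss \<Sigma> T \<Theta> *v v) = (v v* (T - \<Theta>)) \<bullet> (matrix_inv \<Sigma> *v (v v* (T - \<Theta>)))"
  unfolding matrix_loss_def by (simp add: dot_lmul_matrix flip: matrix_vector_mul_assoc)

context normal_model begin

lemma gain_pos_wide:
  assumes pd: "pos_def (scatter w)" and v: "v \<noteq> 0" and k: "0 < k" "k < 1"
    and pm: "real CARD('m) + 1 \<le> real CARD('p)"
    and c: "k * (real n + real CARD('p) - 1) \<le> 2 * (real CARD('p) - real CARD('m) - 1)"
  shows "0 < gain (1 - k) 0 k v X (scatter w)"
proof -
  interpret ridge "scatter w" X "1 - k" 0 using ridge_scatter pd k by simp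
  let ?y = "fit (1 - k) 0 v X (scatter w)"
  have "(1 - k) * (?y \<bullet> (scatter w *v ?y)) < (norm v)\<^sup>2 - (1 - k) * ((v v* X) \<bullet> ?y)"
    using hat_complement_form(1)[OF refl, of v] hat_complement_form(2)[OF refl pd v]
    by (smt (verit) zero_less_norm_iff zero_less_power)
  from wide_arithmetic[OF k S_nonneg this P_nonneg trace_S_P_ge[OF refl] pm c]
  show ?thesis unfolding gain_def cross_term_def energy_term_def .
qed

text \<open>Summed over the coordinate vectors, \<open>|v|\<^sup>2 - t u \<bullet> y\<close> gives \<open>m - p + \<tau>\<close>, and \<open>t y \<bullet> S y\<close> gives the trace of
\<open>S P - S P S P\<close>, which is at most \<open>\<tau>\<close> because \<open>S P S P\<close> has nonnegative trace.\<close>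

lemma gain_pos_tall:
  assumes pd: "pos_def (scatter w)" and k: "0 < k" "k < 1"
    and pm: "real CARD('p) + 1 \<le> real CARD('m)"
    and c: "k * (real n - real CARD('p) + 2 * real CARD('m) - 1) \<le> 2 * (real CARD('m) - real CARD('p) - 1)"
  shows "0 < (\<Sum>i\<in>UNIV. gain (1 - k) 0 k (axis i 1) X (scatter w))"
proof -
  interpret ridge "scatter w" X "1 - k" 0 using ridge_scatter pd k by simp
  let ?t = "1 - k" and ?S = "scatter w" and ?N = "real CARD('p)"
  let ?y = "\<lambda>i. P *v X $ i"
  let ?\<tau> = "trace (?S ** P)"
  have fit: "fit ?t 0 (axis i 1) X ?S = ?y i" for i by (simp add: fit_def axis_vector_matrix)
  define \<beta> where "\<beta> = (\<Sum>i\<in>UNIV. ?y i \<bullet> (?S *v ?y i))"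
  define \<gamma> where "\<gamma> = (\<Sum>i\<in>UNIV. (?S *v ?y i) \<bullet> (P *v (?S *v ?y i)))"
  have "(\<Sum>i\<in>UNIV. X $ i \<bullet> ?y i) * ?t = ?N - ?\<tau>" using trace_S_P[OF refl] by simp
  then have sum_fit: "(\<Sum>i\<in>UNIV. 1 - ?t * (X $ i \<bullet> ?y i)) = real CARD('m) - ?N + ?\<tau>"
    by (simp add: sum_subtractf mult.commute flip: sum_distrib_left)
  have \<tau>: "0 < ?\<tau>"
  proof -
    obtain x :: "real^'p" where x: "x \<noteq> 0" using axis_eq_0_iff[of _ "1::real"] by (metis zero_neq_one)
    have "gram {..<n} (\<lambda>a. w a $ 1) \<noteq> 0"
    proof
      assume "gram {..<n} (\<lambda>a. w a $ 1) = 0"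
      then have "x \<bullet> (?S *v x) = 0" by (simp add: scatter_def)
      then show False using pd x unfolding pos_def_def by (metis less_irrefl)
    qed
    then obtain a where a: "a < n" "outer (w a $ 1) (w a $ 1) \<noteq> 0"
      unfolding gram_def by (meson lessThan_iff sum.neutral)
    then have "w a $ 1 \<noteq> 0" by (auto simp: outer_def vec_eq_iff)
    then have "0 < w a $ 1 \<bullet> (P *v w a $ 1)" using pos_def_P by (simp add: pos_def_def)
    then show ?thesis
      unfolding scatter_def trace_gram_mult using a P_nonneg
      by (intro sum_pos2[of _ a]) (auto simp: scatter_def)
  qed
  have \<beta>0: "0 \<le> \<beta>" unfolding \<beta>_def by (intro sum_nonneg S_nonneg)
  have \<gamma>0: "0 \<le> \<gamma>" unfolding \<gamma>_def by (intro sum_nonneg P_nonneg)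
  have \<beta>\<tau>: "?t * \<beta> \<le> ?\<tau>"
  proof -
    let ?M = "P ** ?S ** P"
    have M: "x \<bullet> (?M *v x) = (P *v x) \<bullet> (?S *v (P *v x))" for x
      by (simp add: P_sym flip: matrix_vector_mul_assoc)
    have "t * trace ((transpose X ** X) ** ?M) = t * (\<Sum>i\<in>UNIV. X $ i \<bullet> (?M *v X $ i))" for t
      by (simp only: design_gram trace_gram_mult)
    then have 1: "?t * trace ((transpose X ** X) ** ?M) = ?t * \<beta>" by (simp only: M \<beta>_def)
    have 2: "0 \<le> trace (?S ** ?M)"
      using S_nonneg by (simp only: scatter_def trace_gram_mult M[unfolded scatter_def]) (intro sum_nonneg, simp add: scatter_def)
    have "?S + ?t *\<^sub>R (transpose X ** X) = Q" by (simp add: ridge_matrix_def)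
    then have "trace (?S ** ?M) + ?t * trace ((transpose X ** X) ** ?M) = trace (Q ** ?M)"
      by (metis bounded_bilinear.add_left[OF bounded_bilinear_matrix_mult] trace_add
          matrix_mult_scaleR_left linear_cmul[OF linear_trace] real_scaleR_def)
    also have "Q ** ?M = ?S ** P"
      using Q_P_matrix by (metis matrix_mul_assoc matrix_mul_lid)
    finally show ?thesis using 1 2 by simp
  qed
  have "(\<Sum>i\<in>UNIV. cross_term ?t 0 (axis i 1) X ?S) = ?\<tau> * (real CARD('m) - ?N + ?\<tau>) - ?t * \<beta>"
    unfolding cross_term_def fit axis_vector_matrix sum_fit[symmetric] \<beta>_def
    by (simp add: sum_subtractf sum_distrib_left right_diff_distrib)
  moreover have "(\<Sum>i\<in>UNIV. energy_term n ?t 0 (axis i 1) X ?S) = (real n + ?N + 1 - 2 * ?\<tau>) * \<beta> - 2 * \<gamma>"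
    unfolding energy_term_def fit \<beta>_def \<gamma>_def by (simp add: sum_subtractf sum_distrib_left)
  ultimately have "(\<Sum>i\<in>UNIV. gain ?t 0 k (axis i 1) X ?S)
      = 2 * k * (?\<tau> * (real CARD('m) - ?N + ?\<tau>) - ?t * \<beta>) - k\<^sup>2 * ((real n + ?N + 1 - 2 * ?\<tau>) * \<beta> - 2 * \<gamma>)"
    unfolding gain_def by (simp only: sum_subtractf sum_distrib_left[symmetric])
  then show ?thesis using tall_arithmetic[OF k \<beta>0 \<beta>\<tau> \<gamma>0 \<tau> pm c] by simp
qed

end

section \<open>Comparison of the risks\<close>

lemma borel_measurable_matrix_inv[measurable]:
  "f \<in> borel_measurable M \<Longrightarrow> (\<lambda>x. matrix_inv (f x) :: real^'n^'n) \<in> borel_measurable M"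
  by (rule measurable_compose[OF _ measurable_matrix_inv])

lemma borel_measurable_gb_estimator[measurable]:
  fixes f :: "_ \<Rightarrow> real^'p^'m"
  assumes [measurable]: "f \<in> borel_measurable M" "g \<in> borel_measurable M"
  shows "(\<lambda>x. gb_estimator k (f x) (g x)) \<in> borel_measurable M"
  unfolding gb_estimator_def by measurable

lemma borel_measurable_matrix_loss[measurable]:
  fixes f :: "_ \<Rightarrow> real^'p^'m"
  assumes [measurable]: "f \<in> borel_measurable M"
  shows "(\<lambda>x. matrix_loss \<Sigma> (f x) \<Theta>) \<in> borel_measurable M"
  unfolding matrix_loss_def by measurable

lemma transpose_matrix_loss:
  assumes "pos_def \<Sigma>"
  shows "transpose (matrix_loss \<Sigma> T \<Theta>) = matrix_loss \<Sigma> T \<Theta>"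
  using pos_def_matrix_inv[OF assms]
  by (simp add: matrix_loss_def matrix_transpose_mul pos_def_def matrix_mul_assoc)

lemma quadratic_loss_eq_sum:
  "quadratic_loss \<Sigma> T \<Theta> = (\<Sum>i\<in>UNIV. axis i 1 \<bullet> (matrix_loss \<Sigma> T \<Theta> *v axis i 1))"
  unfolding quadratic_loss_def matrix_loss_def by (rule trace_eq_sum_axis)

lemma matrix_loss_form_nonneg:
  assumes "pos_def \<Sigma>" shows "0 \<le> v \<bullet> (matrix_loss \<Sigma> T \<Theta> *v v)"
  unfolding matrix_loss_form
  using pos_def_imp_pos_semidef[OF pos_def_matrix_inv[OF assms]] by (simp add: pos_semidef_def)

context normal_model begin

definition mean_gain :: "real \<Rightarrow> real^'m \<Rightarrow> real" where
  "mean_gain k v = (\<integral>(X, w). gain (1 - k) 0 k v X (scatter w) \<partial>joint_law)"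

text \<open>Transfer of \<open>risk_formula\<close> to the law of \<open>(X, S)\<close>. The two expressions for the loss form agree
where \<open>S\<close> is positive definite, hence almost surely.\<close>

lemma gb_form_risk:
  assumes n: "CARD('p) \<le> n" and k: "k < 1"
  defines "L \<equiv> \<lambda>\<delta> :: ('m, 'p) estimator. \<lambda>v (X, S). v \<bullet> (matrix_loss \<Sigma> (\<delta> X S) \<Theta> *v v)"
  shows "integrable (model n \<Theta> \<Sigma>) (L (gb_estimator k) v)"
    and "integrable (model n \<Theta> \<Sigma>) (L (\<lambda>X S. X) v)"
    and "(\<integral>x. L (gb_estimator k) v x \<partial>model n \<Theta> \<Sigma>) = (\<integral>x. L (\<lambda>X S. X) v x \<partial>model n \<Theta> \<Sigma>) - mean_gain k v"
proof -
  let ?T = "\<lambda>(X, w). (X, scatter w)"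
  have meas: "L \<delta> v \<in> borel_measurable (borel \<Otimes>\<^sub>M borel)" if "\<delta> = gb_estimator k \<or> \<delta> = (\<lambda>X S. X)" for \<delta>
    using that unfolding L_def by (elim disjE) (simp_all only:, measurable)
  have ae: "AE x in joint_law. L (gb_estimator k) v (?T x) = (case x of (X, w) \<Rightarrow> shrunk_form (1 - k) 0 k v X (scatter w))"
    using AE_joint_pos_def[OF n]
  proof eventually_elim
    case (elim x)
    have "v v* (A - B) = v v* A - v v* B" for A B :: "real^'p^'m"
      by (simp add: vec_eq_iff vector_matrix_mult_def sum_subtractf algebra_simps)
    then have "v v* (gb_estimator k (fst x) (scatter (snd x)) - \<Theta>)
        = residual v (fst x) - k *\<^sub>R (scatter (snd x) *v fit (1 - k) 0 v (fst x) (scatter (snd x)))"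
      using gb_estimator_eq[OF elim, of k v "fst x"] k by (simp add: residual_def)
    then show ?case
      unfolding L_def case_prod_beta fst_conv snd_conv matrix_loss_form shrunk_form_def K_def by simp
  qed
  have eq: "L (\<lambda>X S. X) v (?T x) = (case x of (X, w) \<Rightarrow> residual v X \<bullet> (K *v residual v X))" for x
    unfolding L_def case_prod_beta fst_conv snd_conv matrix_loss_form residual_def K_def by simp
  have t: "0 < 1 - k" using k by simp
  note rf = risk_formula[OF n t, of k v]
  have m1: "(\<lambda>x. L (gb_estimator k) v (?T x)) \<in> borel_measurable joint_law"
    and m2: "(\<lambda>(X, w). shrunk_form (1 - k) 0 k v X (scatter w)) \<in> borel_measurable joint_law"
    using measurable_compose[OF measurable_data meas] by (auto simp: measurable_shrunk_form_gain)
  show "integrable (model n \<Theta> \<Sigma>) (L (gb_estimator k) v)"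
    unfolding model_eq integrable_distr_eq[OF measurable_data meas[OF disjI1[OF refl]]]
    by (subst integrable_cong_AE[OF m1 m2 ae]) (rule rf)
  show "integrable (model n \<Theta> \<Sigma>) (L (\<lambda>X S. X) v)"
    unfolding model_eq integrable_distr_eq[OF measurable_data meas[OF disjI2[OF refl]]] eq
    by (rule integrable_residual_form)
  show "(\<integral>x. L (gb_estimator k) v x \<partial>model n \<Theta> \<Sigma>) = (\<integral>x. L (\<lambda>X S. X) v x \<partial>model n \<Theta> \<Sigma>) - mean_gain k v"
    unfolding model_eq integral_distr[OF measurable_data meas[OF disjI1[OF refl]]]
      integral_distr[OF measurable_data meas[OF disjI2[OF refl]]] eq mean_gain_def
      integral_cong_AE[OF m1 m2 ae]
    by (rule rf)
qed

lemma expectation_pos: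
  fixes f :: "_ \<Rightarrow> real"
  assumes "integrable joint_law f" "AE x in joint_law. 0 < f x"
  shows "0 < (\<integral>x. f x \<partial>joint_law)"
proof -
  have nn: "AE x in joint_law. 0 \<le> f x" using assms(2) by eventually_elim simp
  have "(\<integral>x. f x \<partial>joint_law) \<noteq> 0"
  proof
    assume "(\<integral>x. f x \<partial>joint_law) = 0"
    then have "AE x in joint_law. f x = 0"
      using integral_nonneg_eq_0_iff_AE[OF assms(1) nn] by simp
    with assms(2) have "AE x in joint_law. False" by eventually_elim simp
    then show False by simp
  qed
  moreover have "0 \<le> (\<integral>x. f x \<partial>joint_law)" by (rule integral_nonneg_AE[OF nn])
  ultimately show ?thesis by simp
qed

lemma mean_gain_pos_wide:
  assumes "CARD('p) \<le> n" "v \<noteq> 0" "0 < k" "k < 1" "real CARD('m) + 1 \<le> real CARD('p)"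
    and "k * (real n + real CARD('p) - 1) \<le> 2 * (real CARD('p) - real CARD('m) - 1)"
  shows "0 < mean_gain k v"
  unfolding mean_gain_def
proof (rule expectation_pos)
  show "AE x in joint_law. 0 < (case x of (X, w) \<Rightarrow> gain (1 - k) 0 k v X (scatter w))"
    using AE_joint_pos_def[OF assms(1)]
    by eventually_elim (unfold case_prod_beta, rule gain_pos_wide[OF _ assms(2-6)])
qed (rule risk_formula, use assms in auto)

lemma mean_gain_pos_tall:
  assumes "CARD('p) \<le> n" "0 < k" "k < 1" "real CARD('p) + 1 \<le> real CARD('m)"
    and "k * (real n - real CARD('p) + 2 * real CARD('m) - 1) \<le> 2 * (real CARD('m) - real CARD('p) - 1)"
  shows "0 < (\<Sum>i\<in>UNIV. mean_gain k (axis i 1))"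
proof -
  have int: "integrable joint_law (\<lambda>(X, w). gain (1 - k) 0 k v X (scatter w))" for v
    by (rule risk_formula) (use assms in auto)
  have "0 < (\<integral>x. (\<Sum>i\<in>UNIV. (case x of (X, w) \<Rightarrow> gain (1 - k) 0 k (axis i 1) X (scatter w))) \<partial>joint_law)"
  proof (rule expectation_pos)
    show "AE x in joint_law. 0 < (\<Sum>i\<in>UNIV. (case x of (X, w) \<Rightarrow> gain (1 - k) 0 k (axis i 1) X (scatter w)))"
      using AE_joint_pos_def[OF assms(1)]
      by eventually_elim (unfold case_prod_beta, rule gain_pos_tall[OF _ assms(2-5)])
  qed (intro Bochner_Integration.integrable_sum int)
  then show ?thesis
    unfolding mean_gain_def by (subst (asm) Bochner_Integration.integral_sum) (rule int)
qed

abbreviation risk_gap :: "real \<Rightarrow> real^'m^'m" where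
  "risk_gap k \<equiv> matrix_risk n (\<lambda>X S. X) \<Theta> \<Sigma> - matrix_risk n (gb_estimator k) \<Theta> \<Sigma>"

lemma matrix_risk_comparison:
  assumes n: "CARD('p) \<le> n" and k: "k < 1"
  shows "has_matrix_risk n (gb_estimator k :: ('m, 'p) estimator) \<Theta> \<Sigma>"
    and "has_matrix_risk n (\<lambda>X S. X :: real^'p^'m) \<Theta> \<Sigma>"
    and "v \<bullet> (risk_gap k *v v) = mean_gain k v"
    and "transpose (risk_gap k) = risk_gap k"
proof -
  note form = gb_form_risk[OF n k, unfolded case_prod_beta']
  show 1: "has_matrix_risk n (gb_estimator k :: ('m, 'p) estimator) \<Theta> \<Sigma>"
    unfolding has_matrix_risk_def case_prod_beta'
    by (rule integrable_symmetric_matrix[OF transpose_matrix_loss[OF pos_def_\<Sigma>] form(1)])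
  show 2: "has_matrix_risk n (\<lambda>X S. X :: real^'p^'m) \<Theta> \<Sigma>"
    unfolding has_matrix_risk_def case_prod_beta'
    by (rule integrable_symmetric_matrix[OF transpose_matrix_loss[OF pos_def_\<Sigma>] form(2)])
  have lin: "bounded_linear (\<lambda>A :: real^'m^'m. v \<bullet> (A *v v))"
    by (rule bounded_linear_compose[OF bounded_linear_inner_right
        bounded_bilinear.bounded_linear_left[OF bounded_bilinear_matrix_vector_mult]])
  have f: "v \<bullet> (matrix_risk n \<delta> \<Theta> \<Sigma> *v v) = (\<integral>x. v \<bullet> (matrix_loss \<Sigma> (\<delta> (fst x) (snd x)) \<Theta> *v v) \<partial>model n \<Theta> \<Sigma>)"
    if "has_matrix_risk n \<delta> \<Theta> \<Sigma>" for \<delta> :: "('m, 'p) estimator"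
    unfolding matrix_risk_def case_prod_beta'
    by (rule integral_bounded_linear[OF lin, symmetric])
      (use that in \<open>simp add: has_matrix_risk_def case_prod_beta'\<close>)
  show "v \<bullet> (risk_gap k *v v) = mean_gain k v"
    using f[OF 1] f[OF 2] form(3)[of v]
    by (simp add: matrix_vector_mult_diff_rdistrib inner_diff_right)
  have tr: "transpose (matrix_risk n \<delta> \<Theta> \<Sigma>) = matrix_risk n \<delta> \<Theta> \<Sigma>"
    if "has_matrix_risk n \<delta> \<Theta> \<Sigma>" for \<delta> :: "('m, 'p) estimator"
  proof -
    have "transpose (matrix_risk n \<delta> \<Theta> \<Sigma>) = (\<integral>x. transpose (matrix_loss \<Sigma> (\<delta> (fst x) (snd x)) \<Theta>) \<partial>model n \<Theta> \<Sigma>)"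
      unfolding matrix_risk_def case_prod_beta'
      by (rule integral_bounded_linear[OF linear_conv_bounded_linear[THEN iffD1, OF linear_transpose], symmetric])
        (use that in \<open>simp add: has_matrix_risk_def case_prod_beta'\<close>)
    then show ?thesis
      by (simp add: transpose_matrix_loss pos_def_\<Sigma> matrix_risk_def case_prod_beta')
  qed
  show "transpose (risk_gap k) = risk_gap k"
    by (simp add: linear_diff[OF linear_transpose] tr 1 2)
qed

lemma quadratic_risk_less:
  assumes n: "CARD('p) \<le> n" and k: "k < 1" and pos: "0 < (\<Sum>i\<in>UNIV. mean_gain k (axis i 1))"
  shows "quadratic_risk n (gb_estimator k) \<Theta> \<Sigma> < quadratic_risk n (\<lambda>X S. X) \<Theta> \<Sigma>"
proof -
  note form = gb_form_risk[OF n k, unfolded case_prod_beta']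
  let ?L = "\<lambda>\<delta> :: ('m, 'p) estimator. \<lambda>i x. axis i 1 \<bullet> (matrix_loss \<Sigma> (\<delta> (fst x) (snd x)) \<Theta> *v axis i 1)"
  have q: "quadratic_risk n \<delta> \<Theta> \<Sigma> = ennreal (\<Sum>i\<in>UNIV. \<integral>x. ?L \<delta> i x \<partial>model n \<Theta> \<Sigma>)"
    if "\<And>i. integrable (model n \<Theta> \<Sigma>) (?L \<delta> i)" for \<delta>
  proof -
    have "quadratic_risk n \<delta> \<Theta> \<Sigma> = (\<integral>\<^sup>+x. ennreal (\<Sum>i\<in>UNIV. ?L \<delta> i x) \<partial>model n \<Theta> \<Sigma>)"
      unfolding quadratic_risk_def quadratic_loss_eq_sum case_prod_beta' ..
    also have "\<dots> = ennreal (\<integral>x. (\<Sum>i\<in>UNIV. ?L \<delta> i x) \<partial>model n \<Theta> \<Sigma>)"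
      using that by (intro nn_integral_eq_integral Bochner_Integration.integrable_sum AE_I2 sum_nonneg
          matrix_loss_form_nonneg[OF pos_def_\<Sigma>])
    also have "(\<integral>x. (\<Sum>i\<in>UNIV. ?L \<delta> i x) \<partial>model n \<Theta> \<Sigma>) = (\<Sum>i\<in>UNIV. \<integral>x. ?L \<delta> i x \<partial>model n \<Theta> \<Sigma>)"
      using that by (intro Bochner_Integration.integral_sum)
    finally show ?thesis .
  qed
  have "0 \<le> (\<Sum>i\<in>UNIV. \<integral>x. ?L (gb_estimator k) i x \<partial>model n \<Theta> \<Sigma>)"
    by (intro sum_nonneg integral_nonneg_AE AE_I2 matrix_loss_form_nonneg[OF pos_def_\<Sigma>])
  moreover have "(\<Sum>i\<in>UNIV. \<integral>x. ?L (gb_estimator k) i x \<partial>model n \<Theta> \<Sigma>)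
      < (\<Sum>i\<in>UNIV. \<integral>x. ?L (\<lambda>X S. X) i x \<partial>model n \<Theta> \<Sigma>)"
    unfolding form(3) sum_subtractf using pos by simp
  ultimately show ?thesis
    unfolding q[OF form(1)] q[OF form(2)] by (subst ennreal_less_iff)
qed

end

lemma improves_matrix_lossI:
  assumes n: "CARD('p::finite) \<le> n" and k: "0 < k" "k < 1" and pm: "real CARD('m::finite) + 1 \<le> real CARD('p)"
    and c: "k * (real n + real CARD('p) - 1) \<le> 2 * (real CARD('p) - real CARD('m) - 1)"
  shows "improves_matrix_loss n (gb_estimator k :: ('m, 'p) estimator) (\<lambda>X S. X)"
  unfolding improves_matrix_loss_def
proof (intro conjI allI impI)
  fix \<Theta> :: "real^'p^'m" and \<Sigma> :: "real^'p^'p"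
  assume "pos_def \<Sigma>"
  then interpret normal_model \<Theta> \<Sigma> n by unfold_locales
  note cmp = matrix_risk_comparison[OF n k(2)]
  show "has_matrix_risk n (gb_estimator k :: ('m, 'p) estimator) \<Theta> \<Sigma>" "has_matrix_risk n (\<lambda>X S. X :: real^'p^'m) \<Theta> \<Sigma>"
    by (rule cmp)+
  have "0 \<le> v \<bullet> ((matrix_risk n (\<lambda>X S. X) \<Theta> \<Sigma> - matrix_risk n (gb_estimator k) \<Theta> \<Sigma>) *v v)" for v
  proof (cases "v = 0")
    case False
    then show ?thesis unfolding cmp(3) using mean_gain_pos_wide[OF n False k pm c] by simp
  qed simp
  then show "pos_semidef (matrix_risk n (\<lambda>X S. X) \<Theta> \<Sigma> - matrix_risk n (gb_estimator k) \<Theta> \<Sigma>)"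
    using cmp(4) by (simp add: pos_semidef_def)
next
  have I: "pos_def (mat 1 :: real^'p^'p)" by (simp add: pos_def_def)
  interpret normal_model "0 :: real^'p^'m" "mat 1" n by unfold_locales (rule I)
  obtain v :: "real^'m" where v: "v \<noteq> 0" using axis_eq_0_iff[of _ "1::real"] by (metis zero_neq_one)
  have "v \<bullet> ((matrix_risk n (\<lambda>X S. X) (0 :: real^'p^'m) (mat 1) - matrix_risk n (gb_estimator k) (0 :: real^'p^'m) (mat 1)) *v v) \<noteq> 0"
    unfolding matrix_risk_comparison(3)[OF n k(2)] using mean_gain_pos_wide[OF n v k pm c] by simp
  then have "matrix_risk n (\<lambda>X S. X) (0 :: real^'p^'m) (mat 1) - matrix_risk n (gb_estimator k) (0 :: real^'p^'m) (mat 1) \<noteq> 0"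
    by auto
  then show "\<exists>(\<Theta> :: real^'p^'m) \<Sigma>. pos_def \<Sigma> \<and> matrix_risk n (\<lambda>X S. X) \<Theta> \<Sigma> - matrix_risk n (gb_estimator k) \<Theta> \<Sigma> \<noteq> 0"
    using I by blast
qed

lemma improves_quadratic_lossI:
  assumes n: "CARD('p::finite) \<le> n" and k: "k < 1"
    and pos: "\<And>(\<Theta> :: real^'p^'m::finite) \<Sigma>. pos_def \<Sigma> \<Longrightarrow> 0 < (\<Sum>i\<in>UNIV. normal_model.mean_gain \<Theta> \<Sigma> n k (axis i 1))"
  shows "improves_quadratic_loss n (gb_estimator k :: ('m, 'p) estimator) (\<lambda>X S. X)"
proof -
  have less: "quadratic_risk n (gb_estimator k) \<Theta> \<Sigma> < quadratic_risk n (\<lambda>X S. X) \<Theta> \<Sigma>" if "pos_def \<Sigma>" for \<Theta> :: "real^'p^'m" and \<Sigma>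
  proof -
    interpret normal_model \<Theta> \<Sigma> n by unfold_locales fact
    show ?thesis by (rule quadratic_risk_less[OF n k pos[OF that]])
  qed
  moreover have "pos_def (mat 1 :: real^'p^'p)" by (simp add: pos_def_def)
  ultimately show ?thesis
    unfolding improves_quadratic_loss_def by (blast intro: less_imp_le)
qed

theorem corollary4p1:
  fixes a b c m p k0 :: real and n :: nat
  assumes m: "m = real CARD('m::finite)"
    and p: "p = real CARD('p::finite)"
    and k0: "k0 = (a - c + p + min m p - 1) / (a + m + p + min m p)"
  shows
    "(p > m + 1 \<and> real n \<ge> p \<and> b = a + m - real n \<and> a > - 2 * m - 1 \<and> - 2 < c \<and> c < a + p \<and>
      k0 = (a - c + m + p - 1) / (a + 2 * m + p) \<and>
      k0 \<le> 2 * (p - m - 1) / (real n + p - 1)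
      \<longrightarrow> improves_matrix_loss n (gb_estimator k0 :: ('m, 'p) estimator) (\<lambda>X S. X))
   \<and> (real n \<ge> p \<and> b = a + min m p - real n \<and> a > - m - min m p - 1 \<and>
      min m p - m - 2 < c \<and> c < a + p \<and>
      k0 \<le> 2 * (\<bar>p - m\<bar> - 1) / (real n - p + 2 * min m p + 2 * \<bar>p - m\<bar> - 1)
      \<longrightarrow> improves_quadratic_loss n (gb_estimator k0 :: ('m, 'p) estimator) (\<lambda>X S. X))"
proof (intro conjI impI; elim conjE)
  assume h: "m + 1 < p" "p \<le> real n" "- 2 * m - 1 < a" "- 2 < c" "c < a + p"
    and k0': "k0 = (a - c + m + p - 1) / (a + 2 * m + p)"
    and bound: "k0 \<le> 2 * (p - m - 1) / (real n + p - 1)"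
  have m1: "1 \<le> m" unfolding m by (simp add: Suc_le_eq)
  have den: "0 < a + 2 * m + p" using h m1 by linarith
  have k: "0 < k0" "k0 < 1" unfolding k0' using h m1 den by (simp_all add: field_simps)
  have "0 < real n + p - 1" using h m1 by linarith
  then have "k0 * (real n + p - 1) \<le> 2 * (p - m - 1)" using bound by (simp add: pos_le_divide_eq)
  then show "improves_matrix_loss n (gb_estimator k0 :: ('m, 'p) estimator) (\<lambda>X S. X)"
    using h k by (intro improves_matrix_lossI) (simp_all add: m p)
next
  assume h: "p \<le> real n" "- m - min m p - 1 < a" "min m p - m - 2 < c" "c < a + p"
    and bound: "k0 \<le> 2 * (\<bar>p - m\<bar> - 1) / (real n - p + 2 * min m p + 2 * \<bar>p - m\<bar> - 1)"
  have m1: "1 \<le> m" and p1: "1 \<le> p" unfolding m p by (simp_all add: Suc_le_eq)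
  then have q1: "1 \<le> min m p" by simp
  have den: "0 < a + m + p + min m p" using h p1 by linarith
  have "0 < a - c + p + min m p - 1" "a - c + p + min m p - 1 < a + m + p + min m p"
    using h q1 by linarith+
  then have k: "0 < k0" "k0 < 1" unfolding k0 using den by simp_all
  have "0 < N - p + 2 * q + 2 * d - 1" if "p \<le> N" "1 \<le> q" "0 \<le> d" for N q d :: real
    using that by linarith
  then have den2: "0 < real n - p + 2 * min m p + 2 * \<bar>p - m\<bar> - 1"
    using h(1) q1 abs_ge_zero by blast
  have bound': "k0 * (real n - p + 2 * min m p + 2 * \<bar>p - m\<bar> - 1) \<le> 2 * (\<bar>p - m\<bar> - 1)"
    using bound den2 by (simp add: pos_le_divide_eq)
  have "0 < k0 * (real n - p + 2 * min m p + 2 * \<bar>p - m\<bar> - 1)" using k den2 by simp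
  \<comment> \<open>A positive \<open>k0\<close> can satisfy the bound only if \<open>|p - m| > 1\<close>.\<close>
  from less_le_trans[OF this bound'] have far: "1 < \<bar>p - m\<bar>" by simp
  have n: "CARD('p) \<le> n" using h(1) by (simp add: p)
  show "improves_quadratic_loss n (gb_estimator k0 :: ('m, 'p) estimator) (\<lambda>X S. X)"
  proof (rule improves_quadratic_lossI[OF n k(2)])
    fix \<Theta> :: "real^'p^'m" and \<Sigma> :: "real^'p^'p"
    assume "pos_def \<Sigma>"
    then interpret normal_model \<Theta> \<Sigma> n by unfold_locales
    show "0 < (\<Sum>i\<in>UNIV. mean_gain k0 (axis i 1))"
    proof (cases "m \<le> p")
      case True
      then have "k0 * (real n + p - 1) \<le> 2 * (p - m - 1)" and wide: "m + 1 \<le> p"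
        using bound' far by (simp_all add: algebra_simps)
      then have "0 < mean_gain k0 (axis i 1)" for i
        using k by (intro mean_gain_pos_wide n) (simp_all add: m p axis_eq_0_iff)
      then show ?thesis by (intro sum_pos) auto
    next
      case False
      then have "k0 * (real n - p + 2 * m - 1) \<le> 2 * (m - p - 1)" and "p + 1 \<le> m"
        using bound' far by (simp_all add: algebra_simps min_def)
      then show ?thesis using k by (intro mean_gain_pos_tall n) (simp_all add: m p)
    qed
  qed
qed

end
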